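(* Let $\phi=\frac{1+\sqrt5}{2}$ be the golden ratio and let $K$ be an imaginary quadratic number field, with ring of integers $\mathcal{O}_K$, discriminant $D_K$ and Dedekind zeta function $\zeta_K$. As $t\to+\infty$, the cardinality $$\operatorname{Card}\big(\{\alpha\in\operatorname{PSL}_2(\mathcal{O}_K)\cdot\phi\ \operatorname{mod}\ \mathcal{O}_K\;:\;|\alpha-\alpha^\sigma|^{-1}\leq t\}\big)$$ is equivalent to $$\frac{8\,\pi^2\,\log\phi}{|D_K|\,\zeta_K(2)}\;t^2$$ if $D_K\neq-4$, and to half of this quantity if $D_K=-4$.
   Context: The group $\operatorname{PSL}_2(\mathcal{O}_K)$ acts on $\mathbb{C}\cup\{\infty\}$ by homographies, preserving the set of elements of $\mathbb{C}$ that are quadratic irrational over $K$ (i.e. of degree exactly $2$ over $K$). For such an $\alpha$, $\alpha^\sigma$ is its Galois conjugate over $K$. "mod $\mathcal{O}_K$" means that elements of the orbit are counted modulo translations by elements of $\mathcal{O}_K$. *)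

theory Defs
  imports
    "HOL-Analysis.Analysis"
    "HOL-Library.Landau_Symbols"
    "HOL-Algebra.Algebraic_Closure_Type"
begin

text \<open>Number fields are subfields of the complex numbers; \<open>CC\<close> is the field of
  complex numbers as a ring record.\<close>

abbreviation CC :: "complex ring"
  where "CC \<equiv> ring_of_type_algebra"

definition imaginary_quadratic_field :: "complex set \<Rightarrow> bool"
  where "imaginary_quadratic_field K \<longleftrightarrow>
    subfield K CC \<and> ring.dimension CC 2 \<rat> K \<and> \<not> K \<subseteq> \<real>"

definition ring_of_integers :: "complex set \<Rightarrow> complex set"
  where "ring_of_integers K = {z \<in> K. algebraic_int z}"

definition quadratic_integral_basis :: "complex set \<Rightarrow> complex \<Rightarrow> complex \<Rightarrow> bool"
  where "quadratic_integral_basis K w\<^sub>1 w\<^sub>2 \<longleftrightarrow>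
    bij_betw (\<lambda>(m::int, n::int). of_int m * w\<^sub>1 + of_int n * w\<^sub>2) UNIV (ring_of_integers K)"

text \<open>The square of the determinant of the matrix of the conjugates of an integral basis.
  This is specific to imaginary quadratic fields, whose two complex embeddings are the
  inclusion and its composition with complex conjugation.\<close>

definition imaginary_quadratic_disc :: "complex set \<Rightarrow> int"
  where "imaginary_quadratic_disc K =
    (THE D. \<exists>w\<^sub>1 w\<^sub>2. quadratic_integral_basis K w\<^sub>1 w\<^sub>2 \<and>
              of_int D = (w\<^sub>1 * cnj w\<^sub>2 - w\<^sub>2 * cnj w\<^sub>1)\<^sup>2)"

text \<open>The Dirichlet series over the nonzero integral ideals, weighted by their norms
  (the cardinality of the quotient ring); it represents the Dedekind zeta function for
  real \<open>s > 1\<close> only.\<close>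

definition dedekind_zeta :: "complex set \<Rightarrow> real \<Rightarrow> real"
  where "dedekind_zeta K s =
    (let R = CC\<lparr>carrier := ring_of_integers K\<rparr>
     in \<Sum>\<^sub>\<infinity>I\<in>{I. ideal I R \<and> I \<noteq> {0}}. real (card (carrier (R Quot I))) powr (-s))"

text \<open>The orbit of \<open>z\<close> under homographies. A matrix and its opposite give the same homography,
  so this is the orbit under the projective group. The point at infinity is omitted from the
  model: for \<open>z\<close> outside the fraction field of \<open>R\<close>, the denominator \<open>c * z + d\<close> never vanishes.\<close>

definition PSL2_orbit :: "complex set \<Rightarrow> complex \<Rightarrow> complex set"
  where "PSL2_orbit R z =
    {moebius a b c d z | a b c d. a \<in> R \<and> b \<in> R \<and> c \<in> R \<and> d \<in> R \<and> a * d - b * c = 1}"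

text \<open>For \<open>\<alpha>\<close> of degree 2 over \<open>K\<close>: the conjugate of \<open>\<alpha>\<close> over \<open>K\<close> other than \<open>\<alpha>\<close> itself,
  where the conjugates are the complex numbers annihilated by every polynomial over \<open>K\<close>
  that annihilates \<open>\<alpha>\<close> (i.e. the roots of its minimal polynomial).\<close>

definition galois_conj :: "complex set \<Rightarrow> complex \<Rightarrow> complex"
  where "galois_conj K \<alpha> =
    (THE \<beta>. \<beta> \<noteq> \<alpha> \<and> (\<forall>p. (\<forall>i. poly.coeff p i \<in> K) \<and> poly p \<alpha> = 0 \<longrightarrow> poly p \<beta> = 0))"

definition translation_rel :: "complex set \<Rightarrow> (complex \<times> complex) set"
  where "translation_rel R = {(\<alpha>, \<beta>). \<beta> - \<alpha> \<in> R}"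

definition golden_ratio :: real
  where "golden_ratio = (1 + sqrt 5) / 2"

end

theory Submission
  imports Defs "HOL-Computational_Algebra.Squarefree"
begin

text \<open>Write \<open>R = O\<^sub>K\<close>, \<open>\<phi>' = 1 - \<phi>\<close>, and for a matrix in \<open>SL\<^sub>2(R)\<close> with bottom row \<open>(c, d)\<close> put
  \<open>u = d + c \<phi>\<close> and \<open>v = d + c \<phi>'\<close>. The image \<open>\<alpha>\<close> of \<open>\<phi>\<close> satisfies \<open>\<alpha> - \<alpha>\<^sup>\<sigma> = sqrt 5 / (u v)\<close>
  (lemma \<open>orbit_height\<close>), and a bottom row determines \<open>\<alpha>\<close> modulo \<open>R\<close>. So the theorem counts the
  unimodular pairs \<open>(c, d)\<close> with \<open>|u v| \<le> sqrt 5 t\<close> modulo the stabilizer of \<open>\<phi>\<close>, which acts by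
  multiplication with the units of \<open>R[\<phi>]\<close> of relative norm one over \<open>R\<close>. These units are \<open>\<plusminus>\<phi>\<^sup>2\<^sup>k\<close>, or
  \<open>\<plusminus>(\<i> \<phi>)\<^sup>k\<close> if \<open>\<i> \<in> R\<close> (lemma \<open>unit_trivial\<close>); the latter happens exactly for discriminant \<open>-4\<close>
  and explains the factor one half. A fundamental domain is \<open>1 \<le> |u / v| < q\<close> with \<open>q = \<phi>\<^sup>4\<close> or
  \<open>q = \<phi>\<^sup>2\<close>, and it meets every class in two pairs that differ by sign (lemma \<open>card_orbit\<close>).

  The pairs in question are the unimodular lattice points in the dilation by \<open>r = (sqrt 5 t)\<^sup>1\<^sup>/\<^sup>2\<close> of a
  bounded region of \<open>\<complex>\<^sup>2\<close> with negligible boundary, whose volume is \<open>\<pi>\<^sup>2 ln q / 5\<close> (lemma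
  \<open>measure_fundamental_region\<close>). For a nonzero ideal \<open>J\<close> of norm \<open>N(J)\<close> the points of \<open>J \<times> J\<close> in the
  dilated region are asymptotically as many as \<open>r\<^sup>4\<close> times its volume divided by \<open>N(J)\<^sup>2 |D\<^sub>K| / 4\<close>
  (theorem \<open>lattice_pairs_asymptotics\<close>). A pair is unimodular iff no maximal ideal contains both
  entries, and inclusion-exclusion over the maximal ideals turns the counts for all \<open>J\<close> into the count
  of unimodular pairs (theorem \<open>unimodular_asymptotics\<close>). The limit may be taken termwise, since the
  count for \<open>J\<close> is bounded by a constant times \<open>r\<^sup>4 / N(J)\<^sup>2\<close> uniformly in \<open>J\<close> (lemma
  \<open>lattice_count_bound\<close>) and the sum of \<open>N(J)\<^sup>-\<^sup>2\<close> converges (lemma \<open>summable_ideal_norm\<close>).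

  The alternating sum of the densities \<open>N(J)\<^sup>-\<^sup>2\<close> is \<open>1 / \<zeta>\<^sub>K(2)\<close> (lemma \<open>infsum_ideal_mu_zeta\<close>). This
  rests on the multiplicativity of the norm and on unique division of ideals, both of which follow
  from \<open>J * cnj J = N(J) R\<close> (lemmas \<open>conj_mult\<close> and \<open>conj_generates\<close>), a special feature of
  quadratic fields.\<close>

section \<open>Imaginary quadratic fields and their rings of integers\<close>

text \<open>Gauss's lemma in the form needed after a pseudo-division: the factor \<open>c\<close> is absorbed by the
  content of the cofactor.\<close>

lemma primitive_dvd_smult:
  fixes q s p :: "int poly"
  assumes "content q = 1" "c \<noteq> 0" "Polynomial.smult c p = q * s"
  shows "q dvd p"
proof -
  have "\<bar>c\<bar> * content p = content s"
    using arg_cong[OF assms(3), of content] assms(1) by (simp add: content_mult)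
  hence "c dvd content s" by (metis dvd_triv_left abs_dvd_iff)
  hence "[:c:] dvd s" by (simp add: const_poly_dvd_iff_dvd_content)
  then obtain s' where s': "s = Polynomial.smult c s'" by (auto elim: dvdE)
  have "Polynomial.smult c p = Polynomial.smult c (q * s')" using assms(3) s' by simp
  hence "Polynomial.smult c (p - q * s') = 0" by (simp add: smult_diff_right)
  hence "p = q * s'" using assms(2) by simp
  thus ?thesis by simp
qed

lemma ipoly_add:
  fixes p q :: "int poly" and z :: complex
  shows "poly (map_poly of_int (p + q)) z = poly (map_poly of_int p) z + poly (map_poly of_int q) z"
proof -
  have "map_poly of_int (p + q) = (map_poly of_int p + map_poly of_int q :: complex poly)"
    by (intro poly_eqI) (simp add: coeff_map_poly)
  thus ?thesis by simp
qed

lemma ipoly_mult: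
  fixes p q :: "int poly" and z :: complex
  shows "poly (map_poly of_int (p * q)) z = poly (map_poly of_int p) z * poly (map_poly of_int q) z"
  by (induction p) (simp_all add: ipoly_add map_poly_pCons map_poly_smult algebra_simps)

text \<open>By Gauss's lemma the primitive integral multiple of the minimal polynomial divides a monic
  integral polynomial, so it is itself monic up to sign.\<close>

lemma quadratic_algebraic_int:
  fixes z :: complex
  assumes int: "algebraic_int z" and nonreal: "z \<notin> \<real>"
    and tr: "2 * Re z \<in> \<rat>" and nm: "(cmod z)\<^sup>2 \<in> \<rat>"
  shows "2 * Re z \<in> \<int>" "(cmod z)\<^sup>2 \<in> \<int>"
proof -
  obtain p where p: "poly (map_poly of_int p) z = 0" "Polynomial.lead_coeff (p::int poly) = 1"
    using int algebraic_int_altdef_ipoly by blast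
  obtain a b where ab: "2 * Re z = of_int a / of_int b" "b > 0"
    using tr by (auto elim: Rats_cases')
  obtain c d where cd: "(cmod z)\<^sup>2 = of_int c / of_int d" "d > 0"
    using nm by (auto elim: Rats_cases')
  \<comment> \<open>An integral multiple of the minimal polynomial; its leading coefficient turns out to be its content.\<close>
  define q0 :: "int poly" where "q0 = [:c * b, - (a * d), b * d:]"
  have q0: "q0 \<noteq> 0" using ab cd by (simp add: q0_def)
  define q where "q = primitive_part q0"
  have quad: "z\<^sup>2 - of_real (2 * Re z) * z + of_real ((cmod z)\<^sup>2) = 0"
    by (simp add: complex_eq_iff cmod_def power2_eq_square)
  have "poly (map_poly of_int q0) z =
     of_int (b * d) * (z\<^sup>2 - of_real (2 * Re z) * z + of_real ((cmod z)\<^sup>2))"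
    unfolding ab(1) cd(1) using ab(2) cd(2)
    by (simp add: q0_def map_poly_pCons field_simps power2_eq_square)
  hence q0z: "poly (map_poly of_int q0) z = 0" using quad by simp
  have deg: "Polynomial.degree q0 = 2" using ab cd by (simp add: q0_def)
  have decomp: "Polynomial.smult (content q0) q = q0" by (simp add: q_def)
  have "of_int (content q0) * poly (map_poly of_int q) z = poly (map_poly of_int q0) z"
    by (subst (2) decomp [symmetric]) (simp add: map_poly_smult)
  hence qz: "poly (map_poly of_int q) z = 0" using q0z q0 by simp
  have q1: "content q = 1" using q0 by (simp add: q_def)
  have qn: "q \<noteq> 0" using q1 by auto
  have degq: "Polynomial.degree q = 2" using deg decomp q0 by (metis degree_smult_eq content_eq_zero_iff)
  obtain e s where es: "e \<noteq> 0" "Polynomial.smult e p = q * s + pseudo_mod p q"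
    using pseudo_mod(1)[OF qn] by blast
  define r where "r = pseudo_mod p q"
  have degr: "r = 0 \<or> Polynomial.degree r < 2" using pseudo_mod(2)[OF qn] degq by (simp add: r_def)
  have "poly (map_poly of_int (Polynomial.smult e p)) z = poly (map_poly of_int (q * s + r)) z"
    using es by (simp add: r_def)
  hence rz: "poly (map_poly of_int r) z = 0"
    using p qz by (simp add: map_poly_smult ipoly_add ipoly_mult)
  have "r = [:Polynomial.coeff r 0, Polynomial.coeff r 1:]"
  proof (rule poly_eqI)
    fix n
    have "Polynomial.coeff r (Suc (Suc k)) = 0" for k
      using degr by (auto intro: Polynomial.coeff_eq_0)
    thus "Polynomial.coeff r n = Polynomial.coeff [:Polynomial.coeff r 0, Polynomial.coeff r 1:] n"
      by (auto simp: coeff_pCons split: nat.splits)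
  qed
  then obtain r0 r1 where r01: "r = [:r0, r1:]" by blast
  have "of_int r0 + z * of_int r1 = 0" using rz r01 by (simp add: map_poly_pCons)
  hence "of_int r0 + Re z * of_int r1 = 0" "Im z * of_int r1 = 0"
    by (auto simp: complex_eq_iff)
  moreover have "Im z \<noteq> 0" using nonreal by (simp add: complex_is_Real_iff)
  ultimately have "r = 0" using r01 by auto
  hence "q dvd p" using primitive_dvd_smult[OF q1 es(1)] es(2) r_def by simp
  then obtain g where "p = q * g" by (elim dvdE)
  hence "Polynomial.lead_coeff q * Polynomial.lead_coeff g = 1" using p(2) by (simp add: lead_coeff_mult)
  hence "Polynomial.lead_coeff q dvd 1" by (metis dvd_triv_left)
  hence u: "\<bar>Polynomial.lead_coeff q\<bar> = 1" by simp
  have "Polynomial.lead_coeff q0 = content q0 * Polynomial.lead_coeff q"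
    by (metis decomp lead_coeff_smult)
  hence l: "\<bar>b * d\<bar> = content q0"
  proof -
    have "b * d = Polynomial.lead_coeff q0" using deg ab(2) cd(2) by (simp add: q0_def numeral_2_eq_2)
    moreover have "\<bar>Polynomial.lead_coeff q0\<bar> = \<bar>content q0\<bar>"
      unfolding \<open>Polynomial.lead_coeff q0 = _\<close> abs_mult u by simp
    moreover have "\<bar>content q0\<bar> = content q0"
      using normalize_content[of q0] by (simp del: normalize_content)
    ultimately show ?thesis by simp
  qed
  have div: "\<And>i. b * d dvd Polynomial.coeff q0 i"
  proof -
    fix i
    have "Polynomial.coeff q0 i = content q0 * Polynomial.coeff q i" by (metis decomp coeff_smult)
    hence "\<bar>b * d\<bar> dvd Polynomial.coeff q0 i" using l by simp
    thus "b * d dvd Polynomial.coeff q0 i" by (simp only: abs_dvd_iff)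
  qed
  have "d * b dvd c * b" using div[of 0] by (simp add: q0_def mult.commute)
  hence "d dvd c" using ab(2) by simp
  thus "(cmod z)\<^sup>2 \<in> \<int>" unfolding cd(1) using cd(2) by (auto elim!: dvdE)
  have "b * d dvd a * d" using div[of 1] by (simp add: q0_def)
  hence "b dvd a" using cd(2) by simp
  thus "2 * Re z \<in> \<int>" unfolding ab(1) using ab(2) by (auto elim!: dvdE)
qed

lemma algebraic_int_quadratic:
  fixes z :: complex
  assumes "z + cnj z \<in> \<int>" "z * cnj z \<in> \<int>"
  shows "algebraic_int z"
proof (rule algebraic_int.intros)
  let ?p = "[:z * cnj z, - (z + cnj z), 1:]"
  show "Polynomial.lead_coeff ?p = 1" by simp
  show "\<forall>i. Polynomial.coeff ?p i \<in> \<int>" using assms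
    by (auto simp: coeff_pCons split: nat.splits intro: Ints_minus Ints_diff)
       (metis Ints_minus minus_add_distrib uminus_add_conv_diff add.commute)
  show "poly ?p z = 0" by (simp add: algebra_simps)
qed

lemma of_real_of_rat: "of_real (of_rat r) = (of_rat r :: complex)"
  by (cases r) (simp add: of_rat_rat)

lemma CC_ops:
  "x \<otimes>\<^bsub>CC\<^esub> y = x * y" "x \<oplus>\<^bsub>CC\<^esub> y = x + y" "\<zero>\<^bsub>CC\<^esub> = 0" "\<one>\<^bsub>CC\<^esub> = 1" "carrier CC = UNIV"
  by (simp_all add: ring_of_type_algebra_def)

text \<open>From here on the subfield is handled through the field operations of the complex numbers.\<close>

lemma subfield_CC:
  assumes "subfield K CC"
  shows "0 \<in> K" "1 \<in> K" "\<And>x y. x \<in> K \<Longrightarrow> y \<in> K \<Longrightarrow> x + y \<in> K"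
    "\<And>x y. x \<in> K \<Longrightarrow> y \<in> K \<Longrightarrow> x * y \<in> K" "\<And>x. x \<in> K \<Longrightarrow> - x \<in> K"
    "\<And>x. x \<in> K \<Longrightarrow> inverse x \<in> K"
proof -
  interpret C: Ring.field CC by (rule field_from_type_algebra)
  have sub: "subring K CC" using assms by (rule subfieldE(1))
  note s = subringE[OF sub]
  show 0: "0 \<in> K" and "1 \<in> K" and ad: "\<And>x y. x \<in> K \<Longrightarrow> y \<in> K \<Longrightarrow> x + y \<in> K"
    and ideal_mu: "\<And>x y. x \<in> K \<Longrightarrow> y \<in> K \<Longrightarrow> x * y \<in> K"
    using s(2,3,6,7) by (simp_all add: ring_of_type_algebra_def)
  have a_inv: "\<ominus>\<^bsub>CC\<^esub> x = - x" for x
    by (rule C.minus_equality) (simp_all add: ring_of_type_algebra_def)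
  show "\<And>x. x \<in> K \<Longrightarrow> - x \<in> K" using s(5) a_inv by simp
  fix x assume x: "x \<in> K"
  show "inverse x \<in> K"
  proof (cases "x = 0")
    case False
    have "inv\<^bsub>CC\<^esub> x = inverse x"
      by (rule C.inv_unique'[symmetric]) (use False in \<open>simp_all add: ring_of_type_algebra_def\<close>)
    moreover have "x \<in> K - {\<zero>\<^bsub>CC\<^esub>}" using x False by (simp add: ring_of_type_algebra_def)
    ultimately show ?thesis using C.subfield_m_inv(1)[OF assms] by fastforce
  qed (use 0 in simp)
qed

lemma subfield_CC_rat: assumes "subfield K CC" "x \<in> \<rat>" shows "x \<in> K"
proof -
  note s = subfield_CC[OF assms(1)]
  have nat: "of_nat n \<in> K" for n by (induction n) (use s in auto)
  have int: "of_int n \<in> K" for n :: int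
    by (cases n) (use nat s in \<open>auto simp del: of_nat_Suc\<close>)
  obtain a b where "x = of_int a / of_int b" using assms(2) by (auto elim: Rats_cases')
  thus ?thesis using int s(4,6) by (simp add: divide_inverse)
qed

text \<open>Every imaginary quadratic field is \<open>\<rat>(\<surd>-m)\<close> for a squarefree \<open>m\<close>; in real coordinates
  this makes the real part and the scaled imaginary part the two rational coordinates.\<close>

lemma imaginary_quadratic_field_coordinates:
  assumes "imaginary_quadratic_field K"
  obtains m :: int where "m > 0" "squarefree m"
    "K = {Complex x (y * sqrt (of_int m)) | x y. x \<in> \<rat> \<and> y \<in> \<rat>}"
proof -
  have sub: "subfield K CC" and dim: "ring.dimension CC 2 \<rat> K" and nr: "\<not> K \<subseteq> \<real>"
    using assms by (auto simp: imaginary_quadratic_field_def)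
  note s = subfield_CC[OF sub]
  note rat = subfield_CC_rat[OF sub]
  interpret C: Ring.ring CC by (rule ring_from_type_algebra)
  obtain v E where vE: "K = C.line_extension \<rat> v E" "C.dimension 1 \<rat> E"
    using dim by (cases rule: C.dimension.cases) (auto simp: numeral_2_eq_2)
  obtain v' E' where vE': "E = C.line_extension \<rat> v' E'" "C.dimension 0 \<rat> E'"
    using vE(2) by (cases rule: C.dimension.cases) auto
  have E': "E' = {0}"
    using vE'(2) by (cases rule: C.dimension.cases) (auto simp: ring_of_type_algebra_def)
  have K: "K = {k * v + l * v' | k l. k \<in> \<rat> \<and> l \<in> \<rat>}"
    unfolding vE(1) vE'(1) E'
    by (auto simp: set_eq_iff C.line_extension_mem_iff CC_ops Bex_def)
  obtain z where z: "z \<in> K" "z \<notin> \<real>" using nr by blast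
  obtain a b where ab: "1 = a * v + b * v'" "a \<in> \<rat>" "b \<in> \<rat>" using s(2) K by auto
  obtain c d where cd: "z = c * v + d * v'" "c \<in> \<rat>" "d \<in> \<rat>" using z(1) K by auto
  have ratreal: "x \<in> \<rat> \<Longrightarrow> x \<in> \<real>" for x :: complex by (metis Rats_cases Reals_of_real of_real_of_rat)
  have det: "a * d - b * c \<noteq> 0"
  proof
    assume 0: "a * d - b * c = 0"
    have "z * a = c" "z * b = d"
    proof -
      have "z * a = c * (a * v + b * v') + (a * d - b * c) * v'"
        unfolding cd(1) by (simp add: algebra_simps)
      thus "z * a = c" using 0 ab(1) by simp
      have "z * b = d * (a * v + b * v') - (a * d - b * c) * v"
        unfolding cd(1) by (simp add: algebra_simps)
      thus "z * b = d" using 0 ab(1) by simp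
    qed
    moreover have "a \<noteq> 0 \<or> b \<noteq> 0" using ab(1) by auto
    ultimately have "z = c / a \<or> z = d / b" by (auto simp: field_simps)
    hence "z \<in> \<rat>" using ab cd by auto
    thus False using z(2) ratreal by blast
  qed
  define e where "e = a * d - b * c"
  have e0: "e \<noteq> 0" using det by (simp add: e_def)
  have vv: "v = d / e - b / e * z" "v' = a / e * z - c / e"
  proof -
    have "e * v = d * (a * v + b * v') - b * (c * v + d * v')" by (simp add: e_def algebra_simps)
    hence "e * v = d - b * z" unfolding ab(1)[symmetric] cd(1)[symmetric] by simp
    thus "v = d / e - b / e * z" using e0 by (simp add: field_simps)
    have "e * v' = a * (c * v + d * v') - c * (a * v + b * v')" by (simp add: e_def algebra_simps)
    hence "e * v' = a * z - c" unfolding ab(1)[symmetric] cd(1)[symmetric] by simp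
    thus "v' = a / e * z - c / e" using e0 by (simp add: field_simps)
  qed
  have er: "e \<in> \<rat>" unfolding e_def using ab cd by simp
  have Kz: "\<exists>p q. x = p + q * z \<and> p \<in> \<rat> \<and> q \<in> \<rat>" if x: "x \<in> K" for x
  proof -
    obtain k l where kl: "x = k * v + l * v'" "k \<in> \<rat>" "l \<in> \<rat>" using x K by auto
    have "x = (k * (d / e) - l * (c / e)) + (l * (a / e) - k * (b / e)) * z"
      unfolding kl(1) vv by (simp add: algebra_simps)
    thus ?thesis using kl ab cd er
      by (intro exI[of _ "k * (d / e) - l * (c / e)"] exI[of _ "l * (a / e) - k * (b / e)"] conjI) auto
  qed
  obtain p q where pq: "z\<^sup>2 = p + q * z" "p \<in> \<rat>" "q \<in> \<rat>"
    using Kz[OF s(4)[OF z(1) z(1)]] by (auto simp: power2_eq_square)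
  define s0 where "s0 = z - q / 2"
  have s0: "s0 \<in> K" "s0 \<notin> \<real>"
  proof -
    have "- (q / 2) \<in> K" by (rule rat) (use pq in auto)
    from s(3)[OF z(1) this] show "s0 \<in> K" by (simp add: s0_def)
    have "z = s0 + q / 2" by (simp add: s0_def)
    thus "s0 \<notin> \<real>" using z(2) ratreal pq(3) by (metis Reals_add Rats_divide Rats_number_of)
  qed
  have "s0\<^sup>2 = p + q\<^sup>2 / 4"
    using pq(1) by (simp add: s0_def power2_eq_square algebra_simps)
  hence s0sq: "s0\<^sup>2 \<in> \<rat>" using pq by simp
  then obtain a0 b0 where a0: "s0\<^sup>2 = of_int a0 / of_int b0" "b0 > 0"
    by (auto elim: Rats_cases')
  have Re0: "Re s0 = 0"
  proof -
    have "s0\<^sup>2 \<in> \<real>" using s0sq ratreal by blast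
    hence "Re s0 * Im s0 = 0" by (auto simp: complex_is_Real_iff power2_eq_square)
    thus ?thesis using s0(2) by (simp add: complex_is_Real_iff)
  qed
  have Im0: "Im s0 \<noteq> 0" using s0(2) by (simp add: complex_is_Real_iff)
  have "Re (s0\<^sup>2) = - (Im s0)\<^sup>2" using Re0 by (simp add: power2_eq_square)
  moreover have "s0\<^sup>2 = of_real (of_int a0 / of_int b0)" using a0(1) by simp
  hence "Re (s0\<^sup>2) = of_int a0 / of_int b0" by (metis Re_complex_of_real)
  ultimately have Im0sq: "(Im s0)\<^sup>2 * of_int b0 = - of_int a0"
    using a0(2) by (simp add: field_simps)
  define n where "n = - a0 * b0"
  have "(Im s0 * of_int b0)\<^sup>2 = ((Im s0)\<^sup>2 * of_int b0) * of_int b0" by (simp add: power2_eq_square)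
  hence n: "(Im s0 * of_int b0)\<^sup>2 = of_int n" unfolding Im0sq n_def by simp
  have npos: "n > 0"
  proof -
    have "(Im s0 * of_int b0)\<^sup>2 > 0" using Im0 a0(2) by simp
    thus ?thesis unfolding n by simp
  qed
  obtain k m where km: "n = m * k\<^sup>2" "squarefree m" "k \<noteq> 0"
  proof (rule that)
    show "n = squarefree_part n * (square_part n)\<^sup>2"
      by (simp add: squarefree_decompose)
    show "squarefree (squarefree_part n)" using npos by (simp add: squarefree_squarefree_part)
    show "square_part n \<noteq> 0" using npos by simp
  qed
  have mpos: "m > 0" using npos km by (simp add: zero_less_mult_iff)
  define r where "r = Im s0 * of_int b0 / of_int k"
  have "r\<^sup>2 = of_int m" using n km(3) unfolding km(1) by (simp add: r_def power_divide)
  hence r: "sqrt (of_int m) = \<bar>r\<bar>" by (metis real_sqrt_abs)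
  define t where "t = Complex 0 (sqrt (of_int m))"
  have "s0 * (of_int b0 / of_int k) = s0 * of_real (of_int b0 / of_int k)" by simp
  also have "\<dots> = Complex 0 r"
    using Re0 by (simp add: complex_eq_iff r_def del: of_real_divide of_real_of_int_eq)
  finally have "Complex 0 r = s0 * (of_int b0 / of_int k)" ..
  moreover have "of_int b0 / of_int k \<in> K" by (rule rat) simp
  note s(4)[OF s0(1) this]
  ultimately have "Complex 0 r \<in> K" by (simp only:)
  hence tK: "t \<in> K" using s(5)[of "Complex 0 r"] unfolding t_def r
    by (cases "r \<ge> 0") (simp_all add: complex_minus)
  have ratc: "of_real x \<in> (\<rat>::complex set)" if "x \<in> \<rat>" for x
    using that by (auto elim!: Rats_cases simp: of_real_of_rat)
  have tt: "of_real x + of_real y * t = Complex x (y * sqrt (of_int m))" for x y :: real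
    by (simp add: t_def complex_eq_iff)
  have "K = {Complex x (y * sqrt (of_int m)) | x y. x \<in> \<rat> \<and> y \<in> \<rat>}" (is "_ = ?S")
  proof
    show "?S \<subseteq> K"
    proof safe
      fix x y :: real assume "x \<in> \<rat>" "y \<in> \<rat>"
      hence "of_real x + of_real y * t \<in> K" using s(3,4) rat ratc tK by simp
      thus "Complex x (y * sqrt (of_int m)) \<in> K" by (simp only: tt)
    qed
    show "K \<subseteq> ?S"
    proof
      fix x assume "x \<in> K"
      then obtain p' q' where pq': "x = p' + q' * z" "p' \<in> \<rat>" "q' \<in> \<rat>" using Kz by blast
      define c where "c = (if r \<ge> 0 then of_int k / of_int b0 else - of_int k / of_int b0 :: complex)"
      have "t = (if r \<ge> 0 then 1 else -1) * (s0 * (of_int b0 / of_int k))"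
        unfolding \<open>Complex 0 r = _\<close>[symmetric] by (simp add: t_def r complex_eq_iff)
      hence s0t: "s0 = c * t" using km(3) a0(2) by (simp add: c_def)
      have "x = (p' + q' * q / 2) + (q' * c) * t"
        using pq'(1) s0t by (simp add: s0_def algebra_simps)
      moreover have "p' + q' * q / 2 \<in> \<rat>" "q' * c \<in> \<rat>"
        using pq' pq by (simp_all add: c_def)
      ultimately obtain x1 y1 where xy: "x = of_rat x1 + of_rat y1 * t"
        by (metis Rats_cases)
      have "x = of_real (of_rat x1) + of_real (of_rat y1) * t" unfolding of_real_of_rat by (rule xy)
      also note tt
      finally have "x = Complex (of_rat x1) (of_rat y1 * sqrt (of_int m))" .
      moreover have "of_rat x1 \<in> (\<rat>::real set)" "of_rat y1 \<in> (\<rat>::real set)" by (rule Rats_of_rat)+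
      ultimately show "x \<in> ?S" by blast
    qed
  qed
  thus ?thesis using that mpos km(2) by blast
qed


lemma squarefree_rational_square:
  assumes "squarefree (m::int)" "m \<noteq> 0" "y \<in> \<rat>" "of_int m * (y::real)\<^sup>2 \<in> \<int>"
  shows "y \<in> \<int>"
proof -
  obtain p q where pq: "y = of_int p / of_int q" "q > 0" "coprime p q"
    using assms(3) by (auto elim: Rats_cases')
  obtain N where "of_int m * y\<^sup>2 = (of_int N :: real)" using assms(4) by (auto elim: Ints_cases)
  hence "of_int (m * p\<^sup>2) = (of_int (N * q\<^sup>2) :: real)"
    using pq by (simp add: field_simps power_divide)
  hence "m * p\<^sup>2 = N * q\<^sup>2" by (simp only: of_int_eq_iff)
  hence "q\<^sup>2 dvd m * p\<^sup>2" by simp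
  moreover have "coprime (q\<^sup>2) (p\<^sup>2)" using pq(3) by (simp add: coprime_commute)
  ultimately have "q\<^sup>2 dvd m" by (simp add: coprime_dvd_mult_left_iff)
  hence "q dvd 1" by (rule squarefreeD[OF assms(1)])
  hence "q = 1" using pq(2) by simp
  thus ?thesis using pq(1) by simp
qed

lemma algebraic_int_coordinates:
  assumes "x \<in> \<rat>" "y \<in> \<rat>" "(m::int) > 0"
  shows "algebraic_int (Complex x (y * sqrt (of_int m))) \<longleftrightarrow>
    2 * x \<in> \<int> \<and> x\<^sup>2 + of_int m * y\<^sup>2 \<in> \<int>" (is "algebraic_int ?z \<longleftrightarrow> _")
proof -
  have sq: "(y * sqrt (of_int m))\<^sup>2 = of_int m * y\<^sup>2"
    using assms(3) by (simp add: power_mult_distrib)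
  have nm: "(cmod ?z)\<^sup>2 = x\<^sup>2 + of_int m * y\<^sup>2"
    by (simp add: cmod_power2 sq)
  have int: "of_real t \<in> (\<int>::complex set)" if "t \<in> \<int>" for t
    using that by (metis Ints_cases Ints_of_int of_real_of_int_eq)
  show ?thesis
  proof
    assume int: "algebraic_int ?z"
    show "2 * x \<in> \<int> \<and> x\<^sup>2 + of_int m * y\<^sup>2 \<in> \<int>"
    proof (cases "y = 0")
      case True
      hence "?z = of_real x" by (simp add: complex_eq_iff)
      hence "algebraic_int x" using int by (simp only: algebraic_int_of_real_iff)
      hence "x \<in> \<int>" using assms(1) rational_algebraic_int_is_int by blast
      thus ?thesis using True by simp
    next
      case False
      have "?z \<notin> \<real>" using False assms(3) by (simp add: complex_is_Real_iff)
      from quadratic_algebraic_int[OF int this] show ?thesis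
        unfolding nm using assms by simp
    qed
  next
    assume a: "2 * x \<in> \<int> \<and> x\<^sup>2 + of_int m * y\<^sup>2 \<in> \<int>"
    have "?z + cnj ?z = of_real (2 * x)" by (simp add: complex_eq_iff)
    moreover have "?z * cnj ?z = of_real (x\<^sup>2 + of_int m * y\<^sup>2)"
      by (metis nm complex_norm_square of_real_power)
    ultimately show "algebraic_int ?z"
      using a int by (intro algebraic_int_quadratic) presburger+
  qed
qed

text \<open>Everything about \<open>O\<^sub>K\<close> that the ideal theory and the counting need. Integral closedness is
  phrased for the quotients \<open>x / p\<close> with \<open>p\<close> an integer, which exhaust the field of fractions,
  and in terms of trace and norm, which determine integrality in degree two.\<close>

locale imag_quad_ring =
  fixes R :: "complex set" and w :: complex and tw nw :: int
  assumes R_eq: "R = {of_int m + of_int n * w | m n. True}"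
    and Im_w: "Im w > 0"
    and trace_w: "w + cnj w = of_int tw"
    and norm_w: "w * cnj w = of_int nw"
    and integrally_closed: "\<And>x p::int. x \<in> R \<Longrightarrow> p > 0 \<Longrightarrow>
      x / of_int p + cnj (x / of_int p) \<in> \<int> \<Longrightarrow> (x / of_int p) * cnj (x / of_int p) \<in> \<int> \<Longrightarrow>
      x / of_int p \<in> R"

lemma int_square_mod_4: "(k::int)\<^sup>2 mod 4 = (if even k then 0 else 1)"
proof (cases "even k")
  case True thus ?thesis by (auto elim!: evenE simp: power2_eq_square)
next
  case False
  then obtain j where "k = 2 * j + 1" by (elim oddE)
  hence "k\<^sup>2 = 1 + (j * j + j) * 4" by (simp add: power2_eq_square algebra_simps)
  thus ?thesis using False by (simp only: mod_mult_self1) simp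
qed

text \<open>The classical computation: \<open>x + y \<surd>-m\<close> is integral iff \<open>a = 2 x\<close> and \<open>b = 2 y\<close> are integers with
  \<open>a\<^sup>2 + m b\<^sup>2\<close> divisible by 4, and squares are 0 or 1 modulo 4.\<close>

lemma ring_of_integers_basis:
  assumes "(m::int) > 0" "squarefree m"
    "K = {Complex x (y * sqrt (of_int m)) | x y. x \<in> \<rat> \<and> y \<in> \<rat>}"
    "w = (if m mod 4 = 3 then Complex (1/2) (sqrt (of_int m) / 2) else Complex 0 (sqrt (of_int m)))"
  shows "ring_of_integers K = {of_int k + of_int l * w | k l. True}" (is "_ = ?S")
proof
  have KI: "z \<in> ring_of_integers K \<longleftrightarrow> (\<exists>x y. z = Complex x (y * sqrt (of_int m)) \<and> x \<in> \<rat> \<and> y \<in> \<rat> \<and>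
      2 * x \<in> \<int> \<and> x\<^sup>2 + of_int m * y\<^sup>2 \<in> \<int>)" for z
    unfolding ring_of_integers_def assms(3) using algebraic_int_coordinates[OF _ _ assms(1)] by blast
  show "?S \<subseteq> ring_of_integers K"
  proof safe
    fix k l :: int
    show "of_int k + of_int l * w \<in> ring_of_integers K"
    proof (cases "m mod 4 = 3")
      case True
      have e: "of_int k + of_int l * w = Complex (of_int k + of_int l / 2) (of_int l / 2 * sqrt (of_int m))"
        using True by (simp add: assms(4) complex_eq_iff)
      define j where "j = (m + 1) div 4"
      have "4 dvd m + 1" using True by presburger
      hence j: "m + 1 = 4 * j" by (simp add: j_def)
      have "(of_int k + of_int l / 2)\<^sup>2 + of_int m * (of_int l / 2)\<^sup>2
        = (of_int (k\<^sup>2 + k * l) + of_int ((m + 1) * l\<^sup>2) / 4 :: real)"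
        by (simp add: power2_eq_square algebra_simps add_divide_distrib)
      also have "\<dots> = of_int (k\<^sup>2 + k * l + j * l\<^sup>2)" unfolding j by simp
      finally have "(of_int k + of_int l / 2)\<^sup>2 + of_int m * (of_int l / 2)\<^sup>2 \<in> (\<int>::real set)" by simp
      moreover have "2 * (of_int k + of_int l / 2 :: real) = of_int (2 * k + l)" by simp
      hence "2 * (of_int k + of_int l / 2 :: real) \<in> \<int>" by (metis Ints_of_int)
      ultimately show ?thesis unfolding e KI by (intro exI[of _ "of_int k + of_int l / 2"] exI[of _ "of_int l / 2"]) auto
    next
      case False
      have e: "of_int k + of_int l * w = Complex (of_int k) (of_int l * sqrt (of_int m))"
        using False by (simp add: assms(4) complex_eq_iff)
      show ?thesis unfolding e KI by (intro exI[of _ "of_int k"] exI[of _ "of_int l"]) auto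
    qed
  qed
  show "ring_of_integers K \<subseteq> ?S"
  proof
    fix z assume "z \<in> ring_of_integers K"
    then obtain x y where z: "z = Complex x (y * sqrt (of_int m))" "x \<in> \<rat>" "y \<in> \<rat>"
      "2 * x \<in> \<int>" "x\<^sup>2 + of_int m * y\<^sup>2 \<in> \<int>" unfolding KI by blast
    obtain a where a: "2 * x = of_int a" using z(4) by (auto elim: Ints_cases)
    obtain N where N: "x\<^sup>2 + of_int m * y\<^sup>2 = of_int N" using z(5) by (auto elim: Ints_cases)
    have "of_int m * (2 * y)\<^sup>2 = 4 * (x\<^sup>2 + of_int m * y\<^sup>2) - (2 * x)\<^sup>2"
      by (simp add: power2_eq_square algebra_simps)
    also have "\<dots> = of_int (4 * N - a\<^sup>2)" unfolding a N by simp
    finally have 1: "of_int m * (2 * y)\<^sup>2 = of_int (4 * N - a\<^sup>2)" .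
    have "2 * y \<in> \<int>"
    proof (rule squarefree_rational_square[OF assms(2)])
      show "of_int m * (2 * y)\<^sup>2 \<in> \<int>" unfolding 1 by simp
    qed (use assms(1) z(3) in auto)
    then obtain b where b: "2 * y = of_int b" by (auto elim: Ints_cases)
    have "of_int (m * b\<^sup>2) = (of_int (4 * N - a\<^sup>2) :: real)" using 1 unfolding b by simp
    hence ab: "a\<^sup>2 + m * b\<^sup>2 = 4 * N" by (simp only: of_int_eq_iff)
    have xy: "x = of_int a / 2" "y = of_int b / 2" using a b by simp_all
    note sqm = int_square_mod_4
    have mod4: "(a\<^sup>2 mod 4 + (m mod 4) * (b\<^sup>2 mod 4)) mod 4 = 0"
      using ab by (metis mod_add_eq mod_mult_eq mod_mult_self1_is_0 mod_mod_trivial)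
    have m4: "m mod 4 \<noteq> 0"
    proof
      assume "m mod 4 = 0"
      hence "2\<^sup>2 dvd m" by (simp add: dvd_eq_mod_eq_0)
      from squarefreeD[OF assms(2) this] show False by simp
    qed
    have m4': "m mod 4 = 1 \<or> m mod 4 = 2 \<or> m mod 4 = 3" using m4 by presburger
    show "z \<in> ?S"
    proof (cases "m mod 4 = 3")
      case True
      have "even a \<longleftrightarrow> even b" using mod4 sqm[of a] sqm[of b] True by (auto split: if_splits)
      hence "even (a - b)" by simp
      then obtain k where k: "a - b = 2 * k" by (elim evenE)
      have "of_int a = 2 * of_int k + (of_int b :: real)"
        using arg_cong[OF k, of "of_int :: int \<Rightarrow> real"] by simp
      hence "z = of_int k + of_int b * w" using True
        by (simp add: z(1) assms(4) xy complex_eq_iff)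
      thus ?thesis by blast
    next
      case False
      hence "even a \<and> even b" using mod4 sqm[of a] sqm[of b] m4' by (auto split: if_splits)
      then obtain k l where "a = 2 * k" "b = 2 * l" by (auto elim!: evenE)
      hence "z = of_int k + of_int l * w" using False
        by (simp add: z(1) assms(4) xy complex_eq_iff)
      thus ?thesis by blast
    qed
  qed
qed

lemma imag_quad_ring_of_integers:
  assumes "imaginary_quadratic_field K"
  shows "\<exists>w tw nw. imag_quad_ring (ring_of_integers K) w tw nw"
proof -
  obtain m :: int where m: "m > 0" "squarefree m"
    "K = {Complex x (y * sqrt (of_int m)) | x y. x \<in> \<rat> \<and> y \<in> \<rat>}"
    using imaginary_quadratic_field_coordinates[OF assms] .
  define w where "w = (if m mod 4 = 3 then Complex (1/2) (sqrt (of_int m) / 2) else Complex 0 (sqrt (of_int m)))"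
  define tw :: int where "tw = (if m mod 4 = 3 then 1 else 0)"
  define nw where "nw = (if m mod 4 = 3 then (m + 1) div 4 else m)"
  have K: "subfield K CC" using assms by (simp add: imaginary_quadratic_field_def)
  have "imag_quad_ring (ring_of_integers K) w tw nw"
  proof
    show "ring_of_integers K = {of_int k + of_int l * w | k l. True}"
      by (rule ring_of_integers_basis[OF m]) (simp add: w_def)
    show "Im w > 0" using m(1) by (simp add: w_def)
    show "w + cnj w = of_int tw" by (simp add: w_def tw_def complex_eq_iff)
    have s: "sqrt (of_int m) * sqrt (of_int m) = of_int m" using m(1) by simp
    show "w * cnj w = of_int nw"
    proof (cases "m mod 4 = 3")
      case True
      have "4 dvd m + 1" using True by presburger
      then obtain j where j: "m + 1 = 4 * j" by (elim dvdE)
      hence "m = 4 * j - 1" by simp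
      hence "of_int m = 4 * of_int j - (1 :: real)" by simp
      thus ?thesis using True s j by (simp add: w_def nw_def complex_eq_iff)
    next
      case False
      thus ?thesis using s by (simp add: w_def nw_def complex_eq_iff)
    qed
    fix x and p :: int
    assume x: "x \<in> ring_of_integers K" "p > 0"
      and z: "x / of_int p + cnj (x / of_int p) \<in> \<int>" "(x / of_int p) * cnj (x / of_int p) \<in> \<int>"
    have "x / of_int p \<in> K"
      using x(1) subfield_CC(4)[OF K, of x "inverse (of_int p)"] subfield_CC_rat[OF K, of "inverse (of_int p)"]
      by (simp add: ring_of_integers_def divide_inverse)
    thus "x / of_int p \<in> ring_of_integers K"
      using algebraic_int_quadratic[OF z] by (simp add: ring_of_integers_def)
  qed
  thus ?thesis by blast
qed

lemma imaginary_quadratic_field_real: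
  assumes "imaginary_quadratic_field K" "of_real x \<in> K"
  shows "x \<in> \<rat>"
proof -
  obtain m :: int where m: "m > 0" "squarefree m"
    "K = {Complex x (y * sqrt (of_int m)) | x y. x \<in> \<rat> \<and> y \<in> \<rat>}"
    using imaginary_quadratic_field_coordinates[OF assms(1)] .
  show ?thesis using assms(2) unfolding m(3) by (auto simp: complex_eq_iff)
qed

context imag_quad_ring
begin

lemma R_I: "of_int m + of_int n * w \<in> R" by (auto simp: R_eq)
lemma R_E: assumes "x \<in> R" obtains m n where "x = of_int m + of_int n * w"
  using assms by (auto simp: R_eq)

lemma w_sq: "w * w = of_int tw * w - of_int nw"
  using trace_w norm_w by (metis add_diff_cancel_left' diff_diff_eq2 distrib_right mult.commute right_diff_distrib')

lemma cnj_w: "cnj w = of_int tw - w" using trace_w by (simp add: algebra_simps)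

lemma Re_w: "2 * Re w = of_int tw" using arg_cong[OF trace_w, of Re] by simp
lemma norm_w': "(Re w)\<^sup>2 + (Im w)\<^sup>2 = of_int nw"
  using arg_cong[OF norm_w, of Re] by (simp add: power2_eq_square)

lemma R_of_int [simp]: "of_int m \<in> R" using R_I[of m 0] by simp
lemma R_0 [simp]: "0 \<in> R" using R_of_int[of 0] by simp
lemma R_1 [simp]: "1 \<in> R" using R_of_int[of 1] by simp
lemma R_w [simp]: "w \<in> R" using R_I[of 0 1] by simp
lemma R_add [intro]: assumes "x \<in> R" "y \<in> R" shows "x + y \<in> R"
proof -
  obtain a b c d where "x = of_int a + of_int b * w" "y = of_int c + of_int d * w"
    using assms by (meson R_E)
  hence "x + y = of_int (a + c) + of_int (b + d) * w" by (simp add: algebra_simps)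
  thus ?thesis using R_I by metis
qed
lemma R_mult [intro]: assumes "x \<in> R" "y \<in> R" shows "x * y \<in> R"
proof -
  obtain a b c d where "x = of_int a + of_int b * w" "y = of_int c + of_int d * w"
    using assms by (meson R_E)
  hence "x * y = of_int a * of_int c + (of_int a * of_int d + of_int b * of_int c) * w + of_int b * of_int d * (w * w)"
    by (simp add: algebra_simps)
  also have "\<dots> = of_int (a * c - b * d * nw) + of_int (a * d + b * c + b * d * tw) * w"
    by (simp add: w_sq algebra_simps)
  finally show ?thesis using R_I by metis
qed
lemma R_uminus [intro]: "x \<in> R \<Longrightarrow> - x \<in> R" using R_mult[OF R_of_int[of "-1"]] by fastforce
lemma R_diff [intro]: "x \<in> R \<Longrightarrow> y \<in> R \<Longrightarrow> x - y \<in> R" using R_add[of x "- y"] by (auto simp: R_uminus)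
lemma R_cnj [intro]: assumes "x \<in> R" shows "cnj x \<in> R"
proof -
  obtain m n where "x = of_int m + of_int n * w" using assms by (rule R_E)
  hence "cnj x = of_int m + of_int n * (of_int tw - w)" by (simp add: cnj_w)
  thus ?thesis by (auto intro!: R_add R_mult R_diff)
qed

lemma R_real: assumes "x \<in> R" "Im x = 0" obtains n where "x = of_int n"
proof -
  obtain m n where x: "x = of_int m + of_int n * w" using assms(1) by (rule R_E)
  hence "n = 0" using assms(2) Im_w by simp
  thus ?thesis using x that by simp
qed

lemma R_norm: assumes "x \<in> R" obtains n :: nat where "(cmod x)\<^sup>2 = of_nat n"
proof -
  have "x * cnj x \<in> R" using assms by blast
  then obtain n where n: "x * cnj x = of_int n" by (rule R_real) simp
  have "(cmod x)\<^sup>2 = of_int n" using arg_cong[OF n, of Re] by (simp add: complex_norm_square[symmetric] del: of_real_power flip: of_real_power)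
  moreover from this have "n \<ge> 0" by (metis of_int_0_le_iff zero_le_power2)
  ultimately have "(cmod x)\<^sup>2 = of_nat (nat n)" by simp
  thus ?thesis using that by blast
qed

lemma R_norm_ge_1: assumes "x \<in> R" "x \<noteq> 0" shows "cmod x \<ge> 1"
proof -
  obtain n :: nat where n: "(cmod x)\<^sup>2 = of_nat n" using assms(1) by (rule R_norm)
  have "n \<noteq> 0" using n assms(2) by (metis norm_eq_zero of_nat_0 zero_eq_power2)
  hence "(cmod x)\<^sup>2 \<ge> 1\<^sup>2" using n by simp
  thus ?thesis by (rule power2_le_imp_le) simp
qed

lemma basis_unique:
  assumes "of_int a + of_int b * w = of_int c + of_int d * w"
  shows "a = c" "b = d"
proof -
  have "of_int b * Im w = of_int d * Im w" using arg_cong[OF assms, of Im] by simp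
  thus "b = d" using Im_w by simp
  thus "a = c" using assms by simp
qed

text \<open>The square of the covolume of \<open>R\<close> is a quarter of the absolute discriminant; this is how the
  discriminant enters the final constant.\<close>

lemma disc_int: "of_int (tw\<^sup>2 - 4 * nw) = - 4 * (Im w)\<^sup>2"
proof -
  have "of_int (tw\<^sup>2 - 4 * nw) = (2 * Re w)\<^sup>2 - 4 * ((Re w)\<^sup>2 + (Im w)\<^sup>2)"
    unfolding Re_w norm_w' by simp
  thus ?thesis by (simp add: power2_eq_square)
qed

lemma imaginary_quadratic_disc_eq:
  assumes "ring_of_integers K = R"
  shows "imaginary_quadratic_disc K = tw\<^sup>2 - 4 * nw"
proof -
  let ?\<Delta> = "\<lambda>x y. x * cnj y - y * cnj x"
  have basis: "quadratic_integral_basis K 1 w"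
    unfolding quadratic_integral_basis_def assms bij_betw_def
  proof
    show "inj (\<lambda>(m::int, n::int). of_int m * 1 + of_int n * w)"
      by (auto simp: inj_on_def dest: basis_unique)
    show "range (\<lambda>(m::int, n::int). of_int m * 1 + of_int n * w) = R"
      by (auto simp: R_eq image_def)
  qed
  have D1: "of_int (tw\<^sup>2 - 4 * nw) = (?\<Delta> 1 w)\<^sup>2"
  proof -
    have "(?\<Delta> 1 w)\<^sup>2 = of_real (- 4 * (Im w)\<^sup>2)" by (simp add: complex_eq_iff power2_eq_square)
    also have "\<dots> = of_real (of_int (tw\<^sup>2 - 4 * nw))" by (simp only: disc_int)
    finally show ?thesis by simp
  qed
  have change: "?\<Delta> (of_int a * x + of_int b * y) (of_int c * x + of_int d * y) = of_int (a * d - b * c) * ?\<Delta> x y"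
    for a b c d :: int and x y by (simp add: algebra_simps)
  have nz: "?\<Delta> 1 w \<noteq> 0" using Im_w by (simp add: complex_eq_iff)
  have invariant: "(?\<Delta> x y)\<^sup>2 = (?\<Delta> 1 w)\<^sup>2" if xy: "quadratic_integral_basis K x y" for x y
  proof -
    have b: "bij_betw (\<lambda>(m::int, n::int). of_int m * x + of_int n * y) UNIV R"
      using xy unfolding quadratic_integral_basis_def assms .
    hence img: "range (\<lambda>(m::int, n::int). of_int m * x + of_int n * y) = R" by (simp add: bij_betw_def)
    have ex: "\<exists>m n::int. z = of_int m * x + of_int n * y" if "z \<in> R" for z
      using that unfolding img[symmetric] by auto
    obtain a b where ab: "1 = of_int a * x + of_int b * y" using ex[OF R_1] by blast
    obtain c d where cd: "w = of_int c * x + of_int d * y" using ex[OF R_w] by blast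
    have "of_int 1 * x + of_int 0 * y \<in> R" "of_int 0 * x + of_int 1 * y \<in> R"
      using rangeI[of "\<lambda>(m::int, n::int). of_int m * x + of_int n * y" "(1, 0)"]
        rangeI[of "\<lambda>(m::int, n::int). of_int m * x + of_int n * y" "(0, 1)"]
      unfolding img by simp_all
    hence "x \<in> R" "y \<in> R" by simp_all
    obtain a' b' where x0: "x = of_int a' + of_int b' * w" using R_E[OF \<open>x \<in> R\<close>] .
    obtain c' d' where y0: "y = of_int c' + of_int d' * w" using R_E[OF \<open>y \<in> R\<close>] .
    have x': "x = of_int a' * 1 + of_int b' * w" "y = of_int c' * 1 + of_int d' * w"
      by (simp_all only: mult_1_right x0[symmetric] y0[symmetric])
    have 1: "?\<Delta> 1 w = of_int (a * d - b * c) * ?\<Delta> x y" unfolding change[symmetric] ab[symmetric] cd[symmetric] ..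
    have 2: "?\<Delta> x y = of_int (a' * d' - b' * c') * ?\<Delta> 1 w" unfolding change[symmetric] x'[symmetric] ..
    have "of_int ((a * d - b * c) * (a' * d' - b' * c')) * ?\<Delta> 1 w
        = of_int (a * d - b * c) * (of_int (a' * d' - b' * c') * ?\<Delta> 1 w)" by (simp only: of_int_mult mult.assoc)
    also have "\<dots> = of_int (a * d - b * c) * ?\<Delta> x y" by (simp only: 2)
    also have "\<dots> = 1 * ?\<Delta> 1 w" by (simp only: 1[symmetric] mult_1)
    finally have "of_int ((a * d - b * c) * (a' * d' - b' * c')) = (1::complex)"
      using nz by (simp only: mult_cancel_right) simp
    hence "(a * d - b * c) * (a' * d' - b' * c') = 1" by (simp only: of_int_eq_1_iff)
    hence "a' * d' - b' * c' dvd 1" by (metis dvd_triv_right)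
    hence "\<bar>a' * d' - b' * c'\<bar> = 1" by simp
    hence "(a' * d' - b' * c')\<^sup>2 = 1" by (simp add: abs_square_eq_1)
    hence "(of_int (a' * d' - b' * c'))\<^sup>2 = (1 :: complex)" by (metis of_int_1 of_int_power)
    thus ?thesis by (subst 2) (simp only: power_mult_distrib mult_1)
  qed
  show ?thesis unfolding imaginary_quadratic_disc_def
  proof (rule the_equality)
    show "\<exists>w\<^sub>1 w\<^sub>2. quadratic_integral_basis K w\<^sub>1 w\<^sub>2 \<and> of_int (tw\<^sup>2 - 4 * nw) = (?\<Delta> w\<^sub>1 w\<^sub>2)\<^sup>2"
      using basis D1 by blast
    fix D :: int assume "\<exists>w\<^sub>1 w\<^sub>2. quadratic_integral_basis K w\<^sub>1 w\<^sub>2 \<and> of_int D = (?\<Delta> w\<^sub>1 w\<^sub>2)\<^sup>2"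
    hence "of_int D = (?\<Delta> 1 w)\<^sup>2" using invariant by auto
    thus "D = tw\<^sup>2 - 4 * nw" unfolding D1[symmetric] by (simp only: of_int_eq_iff)
  qed
qed

text \<open>This decides which of the two cases of the final constant occurs: the extra stabilizer element
  \<open>\<i> \<phi>\<close> of relative norm one exists exactly when \<open>\<i>\<close> is available.\<close>

lemma ii_in_R_iff: "\<i> \<in> R \<longleftrightarrow> tw\<^sup>2 - 4 * nw = - 4"
proof
  assume "\<i> \<in> R"
  then obtain m n where i: "\<i> = of_int m + of_int n * w" by (rule R_E)
  have im: "of_int n * Im w = 1" using arg_cong[OF i, of Im] by simp
  have "2 * (of_int m + of_int n * Re w) = 0" using arg_cong[OF i, of Re] by simp
  hence re: "2 * of_int m + of_int n * (of_int tw :: real) = 0" unfolding Re_w[symmetric] by (simp add: algebra_simps)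
  hence "of_int (2 * m + n * tw) = (0::real)" by simp
  hence re': "2 * m + n * tw = 0" by (simp only: of_int_eq_0_iff)
  have "of_int (n\<^sup>2 * (tw\<^sup>2 - 4 * nw)) = - 4 * (of_int n * Im w)\<^sup>2"
    by (simp only: of_int_mult disc_int) (simp add: power_mult_distrib)
  hence "of_int (n\<^sup>2 * (tw\<^sup>2 - 4 * nw)) = (of_int (- 4) :: real)" unfolding im by simp
  hence e: "n\<^sup>2 * (tw\<^sup>2 - 4 * nw) = - 4" by (simp only: of_int_eq_iff)
  have "odd n"
  proof
    assume "even n"
    then obtain k where k: "n = 2 * k" by (elim evenE)
    have "k\<^sup>2 * (tw\<^sup>2 - 4 * nw) = - 1" using e unfolding k by (simp add: power2_eq_square)
    moreover have "m = - k * tw" using re' unfolding k by simp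
    ultimately have "m\<^sup>2 - 4 * (k\<^sup>2 * nw) = - 1" by (simp add: power2_eq_square algebra_simps)
    hence "m\<^sup>2 mod 4 = 3" by presburger
    moreover have "m\<^sup>2 mod 4 = 0 \<or> m\<^sup>2 mod 4 = 1" by (simp add: int_square_mod_4)
    ultimately show False by simp
  qed
  hence c: "coprime (n\<^sup>2) (2\<^sup>2)"
    by (simp only: coprime_power_left_iff coprime_power_right_iff coprime_right_2_iff_odd) simp
  have "n\<^sup>2 dvd 2\<^sup>2" using e by (metis dvd_minus_iff dvd_triv_left power2_eq_square mult_2 numeral_Bit0)
  hence "n\<^sup>2 dvd 1" using c by (metis coprime_common_divisor dvd_refl)
  hence "n\<^sup>2 = 1" by simp
  thus "tw\<^sup>2 - 4 * nw = - 4" using e by simp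
next
  assume a: "tw\<^sup>2 - 4 * nw = - 4"
  hence "4 * (Im w)\<^sup>2 = 4" using disc_int by simp
  hence im: "Im w = 1" using Im_w by (simp add: power2_eq_1_iff)
  have "tw\<^sup>2 = 2 * (2 * nw - 2)" using a by simp
  hence "even (tw\<^sup>2)" by simp
  hence "even tw" by simp
  then obtain k where k: "tw = 2 * k" by (elim evenE)
  hence "\<i> = of_int (- k) + of_int 1 * w" using Re_w im by (simp add: complex_eq_iff)
  thus "\<i> \<in> R" using R_I by metis
qed

end

section \<open>Ideals, their norms, and unique division\<close>

context imag_quad_ring
begin

definition nonzero_ideal :: "complex set \<Rightarrow> bool" where
  "nonzero_ideal J \<longleftrightarrow> J \<subseteq> R \<and> (\<exists>x\<in>J. x \<noteq> 0) \<and> (\<forall>x\<in>J. \<forall>y\<in>J. x + y \<in> J) \<and> (\<forall>r\<in>R. \<forall>x\<in>J. r * x \<in> J)"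

text \<open>The order of the summands is that of the cosets in the ring-theoretic quotient.\<close>

definition coset :: "complex set \<Rightarrow> complex \<Rightarrow> complex set" where
  "coset J x = (\<lambda>y. y + x) ` J"

definition ideal_norm :: "complex set \<Rightarrow> nat" where
  "ideal_norm J = card (coset J ` R)"

lemma nonzero_idealD:
  assumes "nonzero_ideal J"
  shows "J \<subseteq> R" "\<And>x. x \<in> J \<Longrightarrow> x \<in> R" "\<And>x y. x \<in> J \<Longrightarrow> y \<in> J \<Longrightarrow> x + y \<in> J"
    "\<And>r x. r \<in> R \<Longrightarrow> x \<in> J \<Longrightarrow> r * x \<in> J" "\<And>r x. r \<in> R \<Longrightarrow> x \<in> J \<Longrightarrow> x * r \<in> J"
    "\<And>x. x \<in> J \<Longrightarrow> - x \<in> J" "\<And>x y. x \<in> J \<Longrightarrow> y \<in> J \<Longrightarrow> x - y \<in> J" "0 \<in> J"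
    "\<exists>x\<in>J. x \<noteq> 0"
proof -
  show 1: "J \<subseteq> R" "\<And>x. x \<in> J \<Longrightarrow> x \<in> R" "\<And>x y. x \<in> J \<Longrightarrow> y \<in> J \<Longrightarrow> x + y \<in> J"
    "\<And>r x. r \<in> R \<Longrightarrow> x \<in> J \<Longrightarrow> r * x \<in> J" "\<exists>x\<in>J. x \<noteq> 0"
    using assms by (auto simp: nonzero_ideal_def)
  show "\<And>r x. r \<in> R \<Longrightarrow> x \<in> J \<Longrightarrow> x * r \<in> J" using 1(4) by (simp add: mult.commute)
  show neg: "- x \<in> J" if "x \<in> J" for x using 1(4)[OF R_of_int[of "-1"] that] by simp
  show "\<And>x y. x \<in> J \<Longrightarrow> y \<in> J \<Longrightarrow> x - y \<in> J" using neg 1(3) by (metis uminus_add_conv_diff add.commute)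
  obtain x where "x \<in> J" using 1(5) by blast
  thus "0 \<in> J" using 1(4)[OF R_0] by fastforce
qed

lemma nonzero_ideal_R: "nonzero_ideal R" unfolding nonzero_ideal_def using R_1 by (auto intro!: bexI[of _ 1])

lemma nonzero_ideal_Int: assumes "nonzero_ideal I" "nonzero_ideal J" shows "nonzero_ideal (I \<inter> J)"
proof -
  obtain x y where "x \<in> I" "x \<noteq> 0" "y \<in> J" "y \<noteq> 0" using assms by (meson nonzero_idealD(9))
  hence "x * y \<in> I \<inter> J" "x * y \<noteq> 0" using nonzero_idealD[OF assms(1)] nonzero_idealD[OF assms(2)] by auto
  thus ?thesis using assms unfolding nonzero_ideal_def by blast
qed

lemma coset_eq_iff: assumes "nonzero_ideal J" shows "coset J x = coset J y \<longleftrightarrow> x - y \<in> J"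
proof
  assume "coset J x = coset J y"
  moreover have "x \<in> coset J x" using nonzero_idealD(8)[OF assms] by (auto simp: coset_def)
  ultimately show "x - y \<in> J" by (auto simp: coset_def)
next
  assume d: "x - y \<in> J"
  show "coset J x = coset J y"
  proof
    show "coset J x \<subseteq> coset J y"
    proof
      fix z assume "z \<in> coset J x"
      then obtain u where u: "u \<in> J" "z = u + x" by (auto simp: coset_def)
      have "z = (u + (x - y)) + y" "u + (x - y) \<in> J" using u d nonzero_idealD(3)[OF assms] by auto
      thus "z \<in> coset J y" unfolding coset_def by (rule image_eqI)
    qed
    show "coset J y \<subseteq> coset J x"
    proof
      fix z assume "z \<in> coset J y"
      then obtain u where u: "u \<in> J" "z = u + y" by (auto simp: coset_def)
      have "z = (u - (x - y)) + x" "u - (x - y) \<in> J" using u d nonzero_idealD(7)[OF assms] by auto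
      thus "z \<in> coset J x" unfolding coset_def by (rule image_eqI)
    qed
  qed
qed

text \<open>Hermite normal form: besides the shape of the \<open>\<int>\<close>-basis, multiplication by \<open>w\<close> forces the
  divisibility condition, which is what makes \<open>J * cnj J\<close> principal.\<close>

definition hermite_form :: "complex set \<Rightarrow> int \<Rightarrow> int \<Rightarrow> int \<Rightarrow> bool" where
  "hermite_form J a b c \<longleftrightarrow> a > 0 \<and> c > 0 \<and> 0 \<le> b \<and> b < a \<and> a dvd b\<^sup>2 + b * tw + nw \<and>
     J = {of_int c * (of_int m * of_int a + of_int n * (of_int b + w)) | m n. True}"

lemma norm_of_int_plus_w: "(of_int b + w) * (of_int b + cnj w) = of_int (b\<^sup>2 + b * tw + nw)"
proof -
  have "(of_int b + w) * (of_int b + cnj w) = of_int b * of_int b + of_int b * (w + cnj w) + w * cnj w"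
    by (simp add: algebra_simps)
  thus ?thesis unfolding trace_w norm_w by (simp add: power2_eq_square)
qed

text \<open>The generators are the least positive integer of \<open>J\<close> and an element of \<open>J\<close> with least positive
  \<open>w\<close>-coordinate; everything else in \<open>J\<close> reduces to zero by division with remainder.\<close>

lemma ex_hermite_form:
  assumes "nonzero_ideal J"
  shows "\<exists>a b c. hermite_form J a b c"
proof -
  note J = nonzero_idealD[OF assms]
  obtain x where x: "x \<in> J" "x \<noteq> 0" using J(9) by blast
  have xx: "x * cnj x \<in> J" using J(5)[OF R_cnj x(1)] J(2)[OF x(1)] by simp
  obtain N :: nat where N: "(cmod x)\<^sup>2 = of_nat N" using R_norm J(2)[OF x(1)] by blast
  have "x * cnj x = of_nat N" using N by (metis complex_norm_square of_real_of_nat_eq)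
  hence NJ: "of_nat N \<in> J" using xx by simp
  have N0: "N > 0" using N x(2) by (metis gr0I norm_eq_zero of_nat_0 zero_eq_power2)
  define A where "A = (LEAST a. a > 0 \<and> of_nat a \<in> J)"
  have A: "A > 0" "of_nat A \<in> J"
    using LeastI[of "\<lambda>a. a > 0 \<and> of_nat a \<in> J" N] N0 NJ by (auto simp: A_def)
  have Amin: "A \<le> k" if "k > 0" "of_nat k \<in> J" for k
    unfolding A_def using that by (intro Least_le) auto
  define P where "P c \<longleftrightarrow> c > 0 \<and> (\<exists>b::int. of_int b + of_nat c * w \<in> J)" for c :: nat
  have PN: "P N" unfolding P_def using N0 J(5)[OF R_w NJ] by (auto intro: exI[of _ 0])
  define C where "C = (LEAST c. P c)"
  have PC: "P C" unfolding C_def using PN by (rule LeastI)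
  obtain B :: int where B: "of_int B + of_nat C * w \<in> J" using PC P_def by blast
  have C0: "C > 0" using PC P_def by blast
  have Cmin: "C \<le> k" if "P k" for k unfolding C_def using that by (rule Least_le)
  have multA: "int A dvd m" if "of_int m \<in> J" for m
  proof (rule ccontr)
    assume n: "\<not> int A dvd m"
    have "of_int m - of_int (m div int A) * of_nat A \<in> J"
      using J(7)[OF that J(4)[OF R_of_int A(2)]] .
    moreover have "of_int m - of_int (m div int A) * of_nat A = (of_int (m mod int A) :: complex)"
      by (metis minus_div_mult_eq_mod of_int_diff of_int_mult of_int_of_nat_eq)
    moreover have r: "m mod int A > 0" using n A(1) by (metis dvd_eq_mod_eq_0 of_nat_0_less_iff pos_mod_sign order_le_less)
    ultimately have "of_nat (nat (m mod int A)) \<in> J" by simp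
    hence "A \<le> nat (m mod int A)" using Amin r by simp
    moreover have "nat (m mod int A) < A" using A(1) r by (simp add: nat_less_iff)
    ultimately show False by linarith
  qed
  have multC: "int C dvd n" if "of_int m + of_int n * w \<in> J" for m n
  proof (rule ccontr)
    assume nd: "\<not> int C dvd n"
    define q where "q = n div int C"
    have "of_int m + of_int n * w - of_int q * (of_int B + of_nat C * w) \<in> J"
      using J(7)[OF that J(4)[OF R_of_int B]] .
    moreover have "of_int m + of_int n * w - of_int q * (of_int B + of_nat C * w)
       = of_int (m - q * B) + of_int (n - q * int C) * w" by (simp add: algebra_simps)
    moreover have "n - q * int C = n mod int C" by (simp add: q_def minus_div_mult_eq_mod)
    moreover have r: "n mod int C > 0" using nd C0 by (metis dvd_eq_mod_eq_0 of_nat_0_less_iff pos_mod_sign order_le_less)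
    ultimately have "of_int (m - q * B) + of_nat (nat (n mod int C)) * w \<in> J" by simp
    hence "P (nat (n mod int C))" unfolding P_def using r by (intro conjI exI[of _ "m - q * B"]) auto
    hence "C \<le> nat (n mod int C)" by (rule Cmin)
    moreover have "nat (n mod int C) < C" using C0 r by (simp add: nat_less_iff)
    ultimately show False by linarith
  qed
  have "of_int 0 + of_int (int A) * w \<in> J" using J(5)[OF R_w A(2)] by simp
  hence "int C dvd int A" by (rule multC)
  then obtain a where a: "int A = int C * a" by (elim dvdE)
  have "of_int (- int C * nw) + of_int (B + int C * tw) * w
      = of_int B * w + of_nat C * (of_int tw * w - of_int nw)" by (simp add: algebra_simps)
  also have "\<dots> = (of_int B + of_nat C * w) * w"
    unfolding w_sq[symmetric] by (simp add: algebra_simps)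
  finally have "of_int (- int C * nw) + of_int (B + int C * tw) * w \<in> J" using J(5)[OF R_w B] by simp
  hence "int C dvd B + int C * tw" by (rule multC)
  hence "int C dvd B" by (simp add: dvd_add_left_iff)
  then obtain b where b: "B = int C * b" by (elim dvdE)
  have a0: "a > 0" using A(1) C0 a by (metis of_nat_0_less_iff zero_less_mult_pos)
  define c where "c = int C"
  have c0: "c > 0" using C0 by (simp add: c_def)
  define b' where "b' = b mod a"
  have BJ: "of_int c * (of_int b + w) \<in> J" using B by (simp add: b c_def algebra_simps)
  have AJ: "of_int c * of_int a \<in> J" using A(2) a by (metis c_def of_int_mult of_int_of_nat_eq)
  have B'J: "of_int c * (of_int b' + w) \<in> J"
  proof -
    have "of_int c * (of_int b + w) - of_int (b div a) * (of_int c * of_int a) \<in> J"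
      using J(7)[OF BJ J(4)[OF R_of_int AJ]] .
    moreover have "of_int b = of_int (b div a) * of_int a + (of_int b' :: complex)"
      unfolding b'_def by (metis div_mult_mod_eq of_int_add of_int_mult)
    hence "of_int c * (of_int b + w) - of_int (b div a) * (of_int c * of_int a) = of_int c * (of_int b' + w)"
      by (simp add: algebra_simps)
    ultimately show ?thesis by simp
  qed
  have spanned: "J = {of_int c * (of_int m * of_int a + of_int n * (of_int b' + w)) | m n. True}" (is "_ = ?S")
  proof
    show "?S \<subseteq> J"
    proof safe
      fix m n
      have "of_int m * (of_int c * of_int a) + of_int n * (of_int c * (of_int b' + w)) \<in> J"
        using J(3)[OF J(4)[OF R_of_int AJ] J(4)[OF R_of_int B'J]] .
      thus "of_int c * (of_int m * of_int a + of_int n * (of_int b' + w)) \<in> J" by (simp add: algebra_simps)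
    qed
    show "J \<subseteq> ?S"
    proof
      fix z assume z: "z \<in> J"
      obtain m n where mn: "z = of_int m + of_int n * w" using R_E[OF J(2)[OF z]] .
      have "c dvd n" using multC z mn by (simp add: c_def)
      then obtain k where k: "n = c * k" by (elim dvdE)
      have "z - of_int k * (of_int c * (of_int b' + w)) \<in> J" using J(7)[OF z J(4)[OF R_of_int B'J]] .
      moreover have e: "z - of_int k * (of_int c * (of_int b' + w)) = of_int (m - k * c * b')"
        by (simp add: mn k algebra_simps)
      ultimately have "int A dvd m - k * c * b'" using multA by simp
      then obtain l where l: "m - k * c * b' = c * a * l" by (auto simp: a c_def elim!: dvdE)
      have "z = of_int c * (of_int l * of_int a + of_int k * (of_int b' + w))"
        using e unfolding l by (simp add: algebra_simps)
      thus "z \<in> ?S" by blast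
    qed
  qed
  have "a dvd b'\<^sup>2 + b' * tw + nw"
  proof -
    have "of_int b' + cnj w \<in> R" by (intro R_add R_of_int R_cnj R_w)
    hence "(of_int b' + cnj w) * (of_int c * (of_int b' + w)) \<in> J" using J(4) B'J by blast
    moreover have "(of_int b' + cnj w) * (of_int c * (of_int b' + w)) = of_int c * of_int (b'\<^sup>2 + b' * tw + nw)"
      unfolding norm_of_int_plus_w[symmetric] by (simp add: mult_ac)
    ultimately have "of_int (c * (b'\<^sup>2 + b' * tw + nw)) \<in> J" by simp
    hence "int A dvd c * (b'\<^sup>2 + b' * tw + nw)" by (rule multA)
    thus ?thesis unfolding a c_def[symmetric] using c0 by simp
  qed
  hence "hermite_form J a b' c" unfolding hermite_form_def using spanned a0 c0 by (simp add: b'_def)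
  thus ?thesis by blast
qed

lemma hermite_form_mem:
  assumes "hermite_form J a b c"
  shows "z \<in> J \<longleftrightarrow> (\<exists>m n. z = of_int c * (of_int m * of_int a + of_int n * (of_int b + w)))"
  using assms unfolding hermite_form_def by auto

lemma ideal_norm_hermite_form:
  assumes J: "nonzero_ideal J" and h: "hermite_form J a b c"
  shows "of_nat (ideal_norm J) = c * c * a"
proof -
  have ac: "a > 0" "c > 0" using h by (auto simp: hermite_form_def)
  define f where "f = (\<lambda>(i::int, j::int). coset J (of_int i + of_int j * w))"
  let ?D = "{0..<c * a} \<times> {0..<c}"
  have "bij_betw f ?D (coset J ` R)"
    unfolding bij_betw_def
  proof
    show "inj_on f ?D"
    proof (rule inj_onI, clarify)
      fix i j i' j' assume r: "i \<in> {0..<c * a}" "j \<in> {0..<c}" "i' \<in> {0..<c * a}" "j' \<in> {0..<c}"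
        and "f (i, j) = f (i', j')"
      hence "(of_int i + of_int j * w) - (of_int i' + of_int j' * w) \<in> J"
        by (simp add: f_def coset_eq_iff[OF J])
      then obtain m n where "(of_int i + of_int j * w) - (of_int i' + of_int j' * w)
          = of_int c * (of_int m * of_int a + of_int n * (of_int b + w))" using hermite_form_mem[OF h] by blast
      hence "of_int (i - i') + of_int (j - j') * w = of_int (c * m * a + c * n * b) + of_int (c * n) * w"
        by (simp add: algebra_simps)
      note e = basis_unique[OF this]
      have "j = j'"
      proof -
        have "c dvd j - j'" using e(2) by simp
        moreover have "\<bar>j - j'\<bar> < c" using r by auto
        ultimately show ?thesis using zdvd_not_zless[of "\<bar>j - j'\<bar>" c] by (cases "j = j'") auto
      qed
      hence "n = 0" using e(2) ac by simp
      hence "c * a dvd i - i'" using e(1) by simp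
      moreover have "\<bar>i - i'\<bar> < c * a" using r by auto
      ultimately have "i = i'" using zdvd_not_zless[of "\<bar>i - i'\<bar>" "c * a"] by (cases "i = i'") auto
      thus "i = i' \<and> j = j'" using \<open>j = j'\<close> by simp
    qed
    show "f ` ?D = coset J ` R"
    proof
      show "f ` ?D \<subseteq> coset J ` R" using R_I by (auto simp: f_def)
      show "coset J ` R \<subseteq> f ` ?D"
      proof
        fix Y assume "Y \<in> coset J ` R"
        then obtain m n where Y: "Y = coset J (of_int m + of_int n * w)" by (auto elim!: R_E)
        define q where "q = n div c"
        define m' where "m' = m - c * q * b"
        define p where "p = m' div (c * a)"
        have n: "of_int n = of_int c * of_int q + (of_int (n mod c) :: complex)"
          unfolding q_def by (metis mult_div_mod_eq of_int_add of_int_mult)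
        have m: "of_int m' = of_int c * of_int a * of_int p + (of_int (m' mod (c * a)) :: complex)"
          unfolding p_def by (metis mult_div_mod_eq of_int_add of_int_mult)
        have "(of_int m + of_int n * w) - (of_int (m' mod (c * a)) + of_int (n mod c) * w)
           = of_int c * (of_int p * of_int a + of_int q * (of_int b + w))"
        proof -
          have "of_int m = of_int m' + of_int c * of_int q * (of_int b :: complex)" by (simp add: m'_def)
          thus ?thesis unfolding n m by (simp add: algebra_simps)
        qed
        hence "(of_int m + of_int n * w) - (of_int (m' mod (c * a)) + of_int (n mod c) * w) \<in> J"
          using hermite_form_mem[OF h] by blast
        hence "Y = f (m' mod (c * a), n mod c)" unfolding Y f_def by (simp add: coset_eq_iff[OF J])
        thus "Y \<in> f ` ?D" using ac by (intro image_eqI) auto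
      qed
    qed
  qed
  hence "ideal_norm J = card ?D" unfolding ideal_norm_def by (metis bij_betw_same_card)
  also have "\<dots> = nat (c * a) * nat c" by simp
  finally show ?thesis using ac by (simp add: mult_ac)
qed

lemma ideal_norm_pos: assumes "nonzero_ideal J" shows "ideal_norm J > 0"
proof -
  obtain a b c where h: "hermite_form J a b c" using ex_hermite_form[OF assms] by blast
  have "int (ideal_norm J) > 0" unfolding ideal_norm_hermite_form[OF assms h] using h by (simp add: hermite_form_def)
  thus ?thesis by simp
qed

lemma finite_cosets: assumes "nonzero_ideal J" shows "finite (coset J ` R)"
  using ideal_norm_pos[OF assms] unfolding ideal_norm_def by (rule card_ge_0_finite)

text \<open>The two halves of \<open>J * cnj J = N(J) R\<close>. The second one uses that the three integers
  \<open>a\<close>, \<open>N(b + w) / a\<close> and \<open>2b + tr w\<close> are jointly coprime: dividing \<open>b + w\<close> by a common factor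
  would give an element integral over \<open>\<int>\<close> outside \<open>R\<close>.\<close>

lemma conj_mult:
  assumes J: "nonzero_ideal J" and "x \<in> J" "y \<in> J"
  shows "\<exists>r\<in>R. x * cnj y = of_nat (ideal_norm J) * r"
proof -
  obtain a b c where h: "hermite_form J a b c" using ex_hermite_form[OF J] by blast
  have N: "of_nat (ideal_norm J) = (of_int (c * c * a) :: complex)"
    using ideal_norm_hermite_form[OF J h] by (metis of_int_of_nat_eq)
  obtain k where k: "b\<^sup>2 + b * tw + nw = a * k" using h by (auto simp: hermite_form_def elim!: dvdE)
  define \<beta> where "\<beta> = of_int b + w"
  have bb: "\<beta> * cnj \<beta> = of_int (a * k)" unfolding k[symmetric] \<beta>_def using norm_of_int_plus_w[of b] by simp
  obtain m n where x: "x = of_int c * (of_int m * of_int a + of_int n * \<beta>)"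
    using assms(2) hermite_form_mem[OF h] \<beta>_def by blast
  obtain m' n' where y: "y = of_int c * (of_int m' * of_int a + of_int n' * \<beta>)"
    using assms(3) hermite_form_mem[OF h] \<beta>_def by blast
  define r where "r = of_int (m * m' * a) + of_int (m * n') * cnj \<beta> + of_int (n * m') * \<beta> + of_int (n * n' * k)"
  have "x * cnj y = of_int c * of_int c * (of_int m * of_int m' * of_int a * of_int a
     + of_int m * of_int n' * of_int a * cnj \<beta> + of_int n * of_int m' * of_int a * \<beta>
     + of_int n * of_int n' * (\<beta> * cnj \<beta>))"
    unfolding x y by (simp add: algebra_simps)
  also have "\<dots> = of_nat (ideal_norm J) * r" unfolding N bb r_def by (simp add: algebra_simps)
  finally have "x * cnj y = of_nat (ideal_norm J) * r" .
  moreover have "\<beta> \<in> R" unfolding \<beta>_def by (intro R_add R_of_int R_w)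
  hence "r \<in> R" unfolding r_def by (intro R_add R_mult R_of_int R_cnj)
  ultimately show ?thesis by blast
qed

lemma conj_generates:
  assumes J: "nonzero_ideal J"
  shows "\<exists>e1\<in>J. \<exists>e2\<in>J. \<exists>j1\<in>J. \<exists>j2\<in>J. e1 * cnj j1 + e2 * cnj j2 = of_nat (ideal_norm J)"
proof -
  obtain a b c where h: "hermite_form J a b c" using ex_hermite_form[OF J] by blast
  have N: "of_nat (ideal_norm J) = (of_int (c * c * a) :: complex)"
    using ideal_norm_hermite_form[OF J h] by (metis of_int_of_nat_eq)
  have ac: "a > 0" "c > 0" using h by (auto simp: hermite_form_def)
  obtain k where k: "b\<^sup>2 + b * tw + nw = a * k" using h by (auto simp: hermite_form_def elim!: dvdE)
  define \<beta> where "\<beta> = of_int b + w"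
  have bb: "\<beta> * cnj \<beta> = of_int (a * k)" unfolding k[symmetric] \<beta>_def using norm_of_int_plus_w[of b] by simp
  have tb: "\<beta> + cnj \<beta> = of_int (2 * b + tw)" unfolding \<beta>_def using trace_w by (simp add: algebra_simps)
  have bR: "\<beta> \<in> R" unfolding \<beta>_def by (intro R_add R_of_int R_w)
  \<comment> \<open>If \<open>g\<close> divides trace and norm of \<open>\<beta>\<close> in this sense, then \<open>\<beta> / g\<close> is integral, but its \<open>w\<close>-coordinate is \<open>1 / g\<close>.\<close>
  define g where "g = gcd (gcd a k) (2 * b + tw)"
  have g0: "g > 0" using ac by (simp add: g_def)
  have ga: "g dvd a" and gk: "g dvd k" and gt: "g dvd 2 * b + tw"
    unfolding g_def by (meson dvd_trans gcd_dvd1 gcd_dvd2)+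
  obtain a' where a': "a = g * a'" using ga by (elim dvdE)
  obtain k' where k': "k = g * k'" using gk by (elim dvdE)
  obtain t' where t': "2 * b + tw = g * t'" using gt by (elim dvdE)
  have "\<beta> / of_int g \<in> R"
  proof (rule integrally_closed[OF bR g0])
    have "\<beta> / of_int g + cnj (\<beta> / of_int g) = (\<beta> + cnj \<beta>) / of_int g" by (simp add: add_divide_distrib)
    also have "\<dots> = of_int t'" unfolding tb t' using g0 by simp
    finally show "\<beta> / of_int g + cnj (\<beta> / of_int g) \<in> \<int>" by simp
    have "\<beta> / of_int g * cnj (\<beta> / of_int g) = (\<beta> * cnj \<beta>) / (of_int g * of_int g)" by simp
    also have "\<dots> = of_int (a' * k')" unfolding bb a' k' using g0 by simp
    finally show "\<beta> / of_int g * cnj (\<beta> / of_int g) \<in> \<int>" by simp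
  qed
  then obtain m n where "\<beta> / of_int g = of_int m + of_int n * w" by (rule R_E)
  hence "of_int b + of_int 1 * w = of_int (g * m) + of_int (g * n) * w"
    unfolding \<beta>_def using g0 by (simp add: field_simps)
  hence "1 = g * n" by (rule basis_unique(2))
  hence g1: "g = 1" using g0 by (metis dvd_triv_left zdvd1_eq abs_of_pos)
  obtain u v where uv: "u * a + v * k = gcd a k" using bezout_int by blast
  obtain p z where pz: "p * gcd a k + z * (2 * b + tw) = g" using bezout_int unfolding g_def by blast
  define x y where "x = p * u" and "y = p * v"
  have "x * a + y * k + z * (2 * b + tw) = 1"
    using pz uv g1 by (simp add: x_def y_def algebra_simps flip: uv)
  hence one: "of_int x * of_int a + of_int y * of_int k + of_int z * (\<beta> + cnj \<beta>) = (1 :: complex)"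
    unfolding tb by (metis of_int_1 of_int_add of_int_mult)
  define j1 j2 :: complex where "j1 = of_int c * of_int a" and "j2 = of_int c * \<beta>"
  have j1: "j1 \<in> J" unfolding j1_def hermite_form_mem[OF h] by (intro exI[of _ 1] exI[of _ 0]) simp
  have j2: "j2 \<in> J" unfolding j2_def hermite_form_mem[OF h] \<beta>_def by (intro exI[of _ 0] exI[of _ 1]) simp
  define e1 e2 where "e1 = of_int x * j1 + of_int z * j2" and "e2 = of_int y * j2 + of_int z * j1"
  have e: "e1 \<in> J" "e2 \<in> J"
    unfolding e1_def e2_def using nonzero_idealD(3,4)[OF J] j1 j2 by auto
  have "e1 * cnj j1 + e2 * cnj j2
     = of_int c * of_int c * (of_int x * of_int a * of_int a + of_int z * of_int a * (\<beta> + cnj \<beta>) + of_int y * (\<beta> * cnj \<beta>))"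
    unfolding e1_def e2_def j1_def j2_def by (simp add: algebra_simps)
  also have "\<dots> = of_int c * of_int c * of_int a * (of_int x * of_int a + of_int y * of_int k + of_int z * (\<beta> + cnj \<beta>))"
    unfolding bb by (simp add: algebra_simps)
  also have "\<dots> = of_nat (ideal_norm J)" unfolding one N by simp
  finally show ?thesis using e j1 j2 by blast
qed

lemma ideal_norm_le_norm:
  assumes "nonzero_ideal J" "x \<in> J" "x \<noteq> 0"
  shows "real (ideal_norm J) \<le> (cmod x)\<^sup>2"
proof -
  obtain r where r: "r \<in> R" "x * cnj x = of_nat (ideal_norm J) * r" using conj_mult[OF assms(1,2,2)] by blast
  have "r \<noteq> 0" using r(2) assms(3) by auto
  hence "cmod r \<ge> 1" using R_norm_ge_1 r(1) by blast
  have "(cmod x)\<^sup>2 = real (ideal_norm J) * cmod r"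
    using arg_cong[OF r(2), of cmod] by (simp add: norm_mult power2_eq_square)
  thus ?thesis using \<open>cmod r \<ge> 1\<close> by (simp add: mult_le_cancel_left1)
qed

text \<open>The integer \<open>n\<close> with \<open>J * cnj J = n R\<close> is unique up to units, hence unique among the positive
  integers. This characterization makes the norm multiplicative.\<close>

lemma ideal_norm_eqI:
  assumes J: "nonzero_ideal J" and n: "n > 0"
    and sub: "\<And>x y. x \<in> J \<Longrightarrow> y \<in> J \<Longrightarrow> \<exists>r\<in>R. x * cnj y = of_nat n * r"
    and divides: "\<exists>r\<in>R. of_nat n = of_nat (ideal_norm J) * r"
  shows "ideal_norm J = n"
proof -
  obtain e1 e2 j1 j2 where e: "e1 \<in> J" "e2 \<in> J" "j1 \<in> J" "j2 \<in> J" "e1 * cnj j1 + e2 * cnj j2 = of_nat (ideal_norm J)"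
    using conj_generates[OF J] by blast
  obtain r1 where r1: "r1 \<in> R" "e1 * cnj j1 = of_nat n * r1" using sub e by blast
  obtain r2 where r2: "r2 \<in> R" "e2 * cnj j2 = of_nat n * r2" using sub e by blast
  have 1: "of_nat (ideal_norm J) = of_nat n * (r1 + r2)" using e(5) r1 r2 by (simp add: algebra_simps)
  obtain r where r: "r \<in> R" "of_nat n = of_nat (ideal_norm J) * r" using divides by blast
  have le: "p \<le> q" if "of_nat q = of_nat p * s" "s \<in> R" "q > 0" for p q :: nat and s
  proof -
    have "s \<noteq> 0" using that by auto
    hence "cmod s \<ge> 1" using R_norm_ge_1 that by blast
    moreover have "real q = real p * cmod s" using arg_cong[OF that(1), of cmod] by (simp add: norm_mult)
    ultimately have "real p \<le> real q" by (simp add: mult_le_cancel_left1)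
    thus ?thesis by simp
  qed
  have "n \<le> ideal_norm J" using le[OF 1] R_add[OF r1(1) r2(1)] ideal_norm_pos[OF J] by blast
  moreover have "ideal_norm J \<le> n" using le[OF r(2) r(1) n] .
  ultimately show ?thesis by simp
qed

text \<open>For \<open>L \<subseteq> J\<close> this is the ideal \<open>L J\<^sup>-\<^sup>1\<close>. Working with the quotient instead of the product
  avoids sums of arbitrarily many products.\<close>

definition colon :: "complex set \<Rightarrow> complex set \<Rightarrow> complex set" where
  "colon L J = {z \<in> R. \<forall>x\<in>J. z * x \<in> L}"

text \<open>\<open>cnj J / N(J)\<close> is the inverse of \<open>J\<close>.\<close>

lemma colon_quotient:
  assumes J: "nonzero_ideal J" and L: "nonzero_ideal L" "L \<subseteq> J" and "l \<in> L" "j \<in> J"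
  shows "l * cnj j / of_nat (ideal_norm J) \<in> colon L J"
proof -
  have N0: "(of_nat (ideal_norm J) :: complex) \<noteq> 0" using ideal_norm_pos[OF J] by simp
  have lJ: "l \<in> J" using assms by blast
  have "l * cnj j / of_nat (ideal_norm J) \<in> R" using conj_mult[OF J lJ assms(5)] N0 by auto
  moreover have "l * cnj j / of_nat (ideal_norm J) * x \<in> L" if x: "x \<in> J" for x
  proof -
    obtain r where r: "r \<in> R" "x * cnj j = of_nat (ideal_norm J) * r" using conj_mult[OF J x assms(5)] by blast
    have "l * cnj j / of_nat (ideal_norm J) * x = l * (x * cnj j) / of_nat (ideal_norm J)" by simp
    also have "\<dots> = l * r" unfolding r(2) using N0 by simp
    finally show ?thesis using nonzero_idealD(5)[OF L(1) r(1) assms(4)] by simp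
  qed
  ultimately show ?thesis by (simp add: colon_def)
qed

lemma nonzero_ideal_colon:
  assumes J: "nonzero_ideal J" and L: "nonzero_ideal L" "L \<subseteq> J"
  shows "nonzero_ideal (colon L J)"
proof -
  obtain l where l: "l \<in> L" "l \<noteq> 0" using nonzero_idealD(9)[OF L(1)] by blast
  obtain j where j: "j \<in> J" "j \<noteq> 0" using nonzero_idealD(9)[OF J] by blast
  have "l * cnj j / of_nat (ideal_norm J) \<in> colon L J" using colon_quotient[OF J L l(1) j(1)] .
  moreover have "l * cnj j / of_nat (ideal_norm J) \<noteq> 0" using l j ideal_norm_pos[OF J] by simp
  moreover have "x + y \<in> colon L J" if "x \<in> colon L J" "y \<in> colon L J" for x y
    using that nonzero_idealD(3)[OF L(1)] by (auto simp: colon_def algebra_simps)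
  moreover have "r * x \<in> colon L J" if "r \<in> R" "x \<in> colon L J" for r x
    using that nonzero_idealD(4)[OF L(1) that(1)] by (auto simp: colon_def mult.assoc)
  moreover have "colon L J \<subseteq> R" by (auto simp: colon_def)
  ultimately show ?thesis unfolding nonzero_ideal_def by blast
qed

lemma colon_mult:
  assumes J: "nonzero_ideal J" and L: "nonzero_ideal L" "L \<subseteq> J"
    and e: "e1 \<in> J" "e2 \<in> J" "j1 \<in> J" "j2 \<in> J" "e1 * cnj j1 + e2 * cnj j2 = of_nat (ideal_norm J)"
  shows "L = {e1 * x + e2 * y | x y. x \<in> colon L J \<and> y \<in> colon L J}" (is "_ = ?S")
proof
  have N0: "(of_nat (ideal_norm J) :: complex) \<noteq> 0" using ideal_norm_pos[OF J] by simp
  show "L \<subseteq> ?S"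
  proof
    fix l assume l: "l \<in> L"
    have "l = l * (e1 * cnj j1 + e2 * cnj j2) / of_nat (ideal_norm J)" unfolding e(5) using N0 by simp
    also have "\<dots> = e1 * (l * cnj j1 / of_nat (ideal_norm J)) + e2 * (l * cnj j2 / of_nat (ideal_norm J))"
      by (simp add: algebra_simps add_divide_distrib)
    finally show "l \<in> ?S" using colon_quotient[OF J L l e(3)] colon_quotient[OF J L l e(4)] by blast
  qed
  show "?S \<subseteq> L"
    using e(1,2) nonzero_idealD(3)[OF L(1)] by (auto simp: colon_def mult.commute)
qed

text \<open>With \<open>L = J I\<close>, the equations \<open>J * cnj J = N(J) R\<close> and \<open>I * cnj I = N(I) R\<close> multiply to
  \<open>L * cnj L = N(J) N(I) R\<close>.\<close>

lemma ideal_norm_colon: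
  assumes J: "nonzero_ideal J" and L: "nonzero_ideal L" "L \<subseteq> J"
  shows "ideal_norm L = ideal_norm J * ideal_norm (colon L J)"
proof (rule ideal_norm_eqI[OF L(1)])
  define I where "I = colon L J"
  have I: "nonzero_ideal I" unfolding I_def by (rule nonzero_ideal_colon[OF J L])
  show "0 < ideal_norm J * ideal_norm (colon L J)" using ideal_norm_pos[OF J] ideal_norm_pos[OF I] by (simp add: I_def)
  obtain e1 e2 j1 j2 where e: "e1 \<in> J" "e2 \<in> J" "j1 \<in> J" "j2 \<in> J" "e1 * cnj j1 + e2 * cnj j2 = of_nat (ideal_norm J)"
    using conj_generates[OF J] by blast
  obtain f1 f2 i1 i2 where f: "f1 \<in> I" "f2 \<in> I" "i1 \<in> I" "i2 \<in> I" "f1 * cnj i1 + f2 * cnj i2 = of_nat (ideal_norm I)"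
    using conj_generates[OF I] by blast
  have Leq: "L = {e1 * x + e2 * y | x y. x \<in> I \<and> y \<in> I}" using colon_mult[OF J L e] by (simp add: I_def)
  have prod: "\<exists>r\<in>R. (p * x) * cnj (q * y) = of_nat (ideal_norm J * ideal_norm I) * r"
    if prem: "p \<in> J" "q \<in> J" "x \<in> I" "y \<in> I" for p q x y
  proof -
    obtain r where r: "r \<in> R" "p * cnj q = of_nat (ideal_norm J) * r" using conj_mult[OF J prem(1,2)] by blast
    obtain s where s: "s \<in> R" "x * cnj y = of_nat (ideal_norm I) * s" using conj_mult[OF I prem(3,4)] by blast
    have "(p * x) * cnj (q * y) = (p * cnj q) * (x * cnj y)" by simp
    also have "\<dots> = of_nat (ideal_norm J * ideal_norm I) * (r * s)" unfolding r s by simp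
    finally show ?thesis using R_mult[OF r(1) s(1)] by blast
  qed
  show "\<exists>r\<in>R. x * cnj y = of_nat (ideal_norm J * ideal_norm (colon L J)) * r" if xy: "x \<in> L" "y \<in> L" for x y
  proof -
    obtain x1 x2 where x: "x = e1 * x1 + e2 * x2" "x1 \<in> I" "x2 \<in> I" using xy(1) Leq by blast
    obtain y1 y2 where y: "y = e1 * y1 + e2 * y2" "y1 \<in> I" "y2 \<in> I" using xy(2) Leq by blast
    obtain r1 where r1: "r1 \<in> R" "(e1 * x1) * cnj (e1 * y1) = of_nat (ideal_norm J * ideal_norm I) * r1"
      using prod[OF e(1) e(1) x(2) y(2)] by blast
    obtain r2 where r2: "r2 \<in> R" "(e1 * x1) * cnj (e2 * y2) = of_nat (ideal_norm J * ideal_norm I) * r2"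
      using prod[OF e(1) e(2) x(2) y(3)] by blast
    obtain r3 where r3: "r3 \<in> R" "(e2 * x2) * cnj (e1 * y1) = of_nat (ideal_norm J * ideal_norm I) * r3"
      using prod[OF e(2) e(1) x(3) y(2)] by blast
    obtain r4 where r4: "r4 \<in> R" "(e2 * x2) * cnj (e2 * y2) = of_nat (ideal_norm J * ideal_norm I) * r4"
      using prod[OF e(2) e(2) x(3) y(3)] by blast
    have "x * cnj y = (e1 * x1) * cnj (e1 * y1) + (e1 * x1) * cnj (e2 * y2)
       + (e2 * x2) * cnj (e1 * y1) + (e2 * x2) * cnj (e2 * y2)"
      unfolding x(1) y(1) by (simp add: algebra_simps)
    also have "\<dots> = of_nat (ideal_norm J * ideal_norm I) * (r1 + r2 + r3 + r4)" unfolding r1 r2 r3 r4 by (simp only: distrib_left)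
    finally show ?thesis using R_add[OF R_add[OF R_add[OF r1(1) r2(1)] r3(1)] r4(1)] unfolding I_def by blast
  qed
  have LI: "p * x \<in> L" if "p \<in> J" "x \<in> I" for p x
    using that unfolding I_def colon_def by (auto simp: mult.commute)
  obtain r1 where r1: "r1 \<in> R" "(e1 * f1) * cnj (j1 * i1) = of_nat (ideal_norm L) * r1"
    using conj_mult[OF L(1) LI[OF e(1) f(1)] LI[OF e(3) f(3)]] by blast
  obtain r2 where r2: "r2 \<in> R" "(e1 * f2) * cnj (j1 * i2) = of_nat (ideal_norm L) * r2"
    using conj_mult[OF L(1) LI[OF e(1) f(2)] LI[OF e(3) f(4)]] by blast
  obtain r3 where r3: "r3 \<in> R" "(e2 * f1) * cnj (j2 * i1) = of_nat (ideal_norm L) * r3"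
    using conj_mult[OF L(1) LI[OF e(2) f(1)] LI[OF e(4) f(3)]] by blast
  obtain r4 where r4: "r4 \<in> R" "(e2 * f2) * cnj (j2 * i2) = of_nat (ideal_norm L) * r4"
    using conj_mult[OF L(1) LI[OF e(2) f(2)] LI[OF e(4) f(4)]] by blast
  have "of_nat (ideal_norm J * ideal_norm I) = (e1 * cnj j1 + e2 * cnj j2) * (f1 * cnj i1 + f2 * cnj i2)"
    unfolding e(5) f(5) by simp
  also have "\<dots> = (e1 * f1) * cnj (j1 * i1) + (e1 * f2) * cnj (j1 * i2)
      + (e2 * f1) * cnj (j2 * i1) + (e2 * f2) * cnj (j2 * i2)" by (simp add: algebra_simps)
  also have "\<dots> = of_nat (ideal_norm L) * (r1 + r2 + r3 + r4)" unfolding r1 r2 r3 r4 by (simp only: distrib_left)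
  finally show "\<exists>r\<in>R. of_nat (ideal_norm J * ideal_norm (colon L J)) = of_nat (ideal_norm L) * r"
    using R_add[OF R_add[OF R_add[OF r1(1) r2(1)] r3(1)] r4(1)] unfolding I_def by blast
qed

text \<open>Surjectivity is the cancellation \<open>(J I) J\<^sup>-\<^sup>1 = I\<close>; the product \<open>J I\<close> is spanned over \<open>I\<close> by
  the two generators \<open>e1, e2\<close> of \<open>J\<close>.\<close>

lemma bij_betw_colon:
  assumes J: "nonzero_ideal J"
  shows "bij_betw (\<lambda>L. colon L J) {L. nonzero_ideal L \<and> L \<subseteq> J} {I. nonzero_ideal I}"
  unfolding bij_betw_def
proof
  obtain e1 e2 j1 j2 where e: "e1 \<in> J" "e2 \<in> J" "j1 \<in> J" "j2 \<in> J" "e1 * cnj j1 + e2 * cnj j2 = of_nat (ideal_norm J)"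
    using conj_generates[OF J] by blast
  have N0: "(of_nat (ideal_norm J) :: complex) \<noteq> 0" using ideal_norm_pos[OF J] by simp
  show "inj_on (\<lambda>L. colon L J) {L. nonzero_ideal L \<and> L \<subseteq> J}"
  proof (rule inj_onI)
    fix L L' assume a: "L \<in> {L. nonzero_ideal L \<and> L \<subseteq> J}" "L' \<in> {L. nonzero_ideal L \<and> L \<subseteq> J}" "colon L J = colon L' J"
    have "L = {e1 * x + e2 * y | x y. x \<in> colon L J \<and> y \<in> colon L J}" using colon_mult[OF J _ _ e] a by blast
    also have "\<dots> = L'" unfolding a(3) using colon_mult[OF J _ _ e, of L'] a by simp
    finally show "L = L'" .
  qed
  show "(\<lambda>L. colon L J) ` {L. nonzero_ideal L \<and> L \<subseteq> J} = {I. nonzero_ideal I}"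
  proof
    show "(\<lambda>L. colon L J) ` {L. nonzero_ideal L \<and> L \<subseteq> J} \<subseteq> {I. nonzero_ideal I}" using nonzero_ideal_colon[OF J] by blast
    show "{I. nonzero_ideal I} \<subseteq> (\<lambda>L. colon L J) ` {L. nonzero_ideal L \<and> L \<subseteq> J}"
    proof clarify
      fix I assume I: "nonzero_ideal I"
      note Ii = nonzero_idealD[OF I]
      define L where "L = {e1 * x + e2 * y | x y. x \<in> I \<and> y \<in> I}"
      have Jgen: "\<exists>r1\<in>R. \<exists>r2\<in>R. x = e1 * r1 + e2 * r2" if xJ: "x \<in> J" for x
      proof -
        obtain r1 where r1: "r1 \<in> R" "x * cnj j1 = of_nat (ideal_norm J) * r1" using conj_mult[OF J xJ e(3)] by blast
        obtain r2 where r2: "r2 \<in> R" "x * cnj j2 = of_nat (ideal_norm J) * r2" using conj_mult[OF J xJ e(4)] by blast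
        have "of_nat (ideal_norm J) * x = e1 * (x * cnj j1) + e2 * (x * cnj j2)"
          unfolding e(5)[symmetric] by (simp add: algebra_simps)
        also have "\<dots> = of_nat (ideal_norm J) * (e1 * r1 + e2 * r2)" unfolding r1 r2 by (simp add: algebra_simps)
        finally have "x = e1 * r1 + e2 * r2" using N0 by simp
        thus ?thesis using r1 r2 by blast
      qed
      have Jx: "x * z \<in> L" if x: "x \<in> J" and z: "z \<in> I" for x z
      proof -
        obtain r1 r2 where r: "r1 \<in> R" "r2 \<in> R" "x = e1 * r1 + e2 * r2" using Jgen[OF x] by blast
        have "x * z = e1 * (r1 * z) + e2 * (r2 * z)" unfolding r(3) by (simp add: algebra_simps)
        thus ?thesis unfolding L_def using Ii(4) r z by blast
      qed
      have "nonzero_ideal L" unfolding nonzero_ideal_def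
      proof (intro conjI ballI)
        show "L \<subseteq> R" unfolding L_def using nonzero_idealD(2)[OF J] e(1,2) Ii(2) by (auto intro!: R_add R_mult)
        obtain x z where "x \<in> J" "x \<noteq> 0" "z \<in> I" "z \<noteq> 0" using nonzero_idealD(9)[OF J] Ii(9) by blast
        thus "\<exists>x\<in>L. x \<noteq> 0" using Jx by (intro bexI[of _ "x * z"]) auto
        show "x + y \<in> L" if xy: "x \<in> L" "y \<in> L" for x y
        proof -
          obtain x1 x2 where x: "x = e1 * x1 + e2 * x2" "x1 \<in> I" "x2 \<in> I" using xy(1) L_def by blast
          obtain y1 y2 where y: "y = e1 * y1 + e2 * y2" "y1 \<in> I" "y2 \<in> I" using xy(2) L_def by blast
          have "x + y = e1 * (x1 + y1) + e2 * (x2 + y2)" unfolding x y by (simp add: algebra_simps)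
          thus ?thesis unfolding L_def using Ii(3) x y by blast
        qed
        show "r * x \<in> L" if rx: "r \<in> R" "x \<in> L" for r x
        proof -
          obtain x1 x2 where x: "x = e1 * x1 + e2 * x2" "x1 \<in> I" "x2 \<in> I" using rx(2) L_def by blast
          have "r * x = e1 * (r * x1) + e2 * (r * x2)" unfolding x by (simp add: algebra_simps)
          thus ?thesis unfolding L_def using Ii(4) x rx by blast
        qed
      qed
      moreover have "L \<subseteq> J"
        unfolding L_def using nonzero_idealD(3,5)[OF J] e(1,2) Ii(2) by auto
      moreover have "colon L J = I"
      proof
        show "I \<subseteq> colon L J"
        proof
          fix z assume z: "z \<in> I"
          have "z * x \<in> L" if "x \<in> J" for x using Jx[OF that z] by (simp only: mult.commute)
          thus "z \<in> colon L J" using Ii(2)[OF z] by (simp add: colon_def)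
        qed
        have LI: "\<exists>s\<in>I. l * cnj j = of_nat (ideal_norm J) * s" if lj: "l \<in> L" "j \<in> J" for l j
        proof -
          obtain x y where l: "l = e1 * x + e2 * y" "x \<in> I" "y \<in> I" using lj(1) L_def by blast
          obtain r1 where r1: "r1 \<in> R" "e1 * cnj j = of_nat (ideal_norm J) * r1" using conj_mult[OF J e(1) lj(2)] by blast
          obtain r2 where r2: "r2 \<in> R" "e2 * cnj j = of_nat (ideal_norm J) * r2" using conj_mult[OF J e(2) lj(2)] by blast
          have "l * cnj j = (e1 * cnj j) * x + (e2 * cnj j) * y" unfolding l by (simp add: algebra_simps)
          also have "\<dots> = of_nat (ideal_norm J) * (r1 * x + r2 * y)" unfolding r1 r2 by (simp add: algebra_simps)
          finally show ?thesis using Ii(3,4) l r1 r2 by blast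
        qed
        show "colon L J \<subseteq> I"
        proof
          fix z assume z: "z \<in> colon L J"
          have "z * e1 \<in> L" "z * e2 \<in> L" using z e by (auto simp: colon_def)
          then obtain s1 s2 where s: "s1 \<in> I" "s2 \<in> I" "z * e1 * cnj j1 = of_nat (ideal_norm J) * s1" "z * e2 * cnj j2 = of_nat (ideal_norm J) * s2"
            using LI e(3,4) by meson
          have "of_nat (ideal_norm J) * z = z * e1 * cnj j1 + z * e2 * cnj j2"
            unfolding e(5)[symmetric] by (simp add: algebra_simps)
          also have "\<dots> = of_nat (ideal_norm J) * (s1 + s2)" unfolding s by (simp add: algebra_simps)
          finally have "z = s1 + s2" using N0 by simp
          thus "z \<in> I" using Ii(3) s by simp
        qed
      qed
      ultimately show "I \<in> (\<lambda>L. colon L J) ` {L. nonzero_ideal L \<and> L \<subseteq> J}" by blast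
    qed
  qed
qed

lemma ideal_norm_mono: assumes "nonzero_ideal L" "nonzero_ideal J" "L \<subseteq> J" shows "ideal_norm J \<le> ideal_norm L"
  using ideal_norm_colon[OF assms(2,1,3)] ideal_norm_pos[OF nonzero_ideal_colon[OF assms(2,1,3)]] by simp

lemma ideal_norm_1: assumes "nonzero_ideal J" "ideal_norm J = 1" shows "J = R"
proof -
  have "coset J 1 = coset J 0"
    using assms(2) R_0 R_1 unfolding ideal_norm_def by (metis card_1_singletonE imageI singletonD)
  hence "1 \<in> J" using coset_eq_iff[OF assms(1)] by simp
  hence "r \<in> J" if "r \<in> R" for r using nonzero_idealD(4)[OF assms(1) that] by fastforce
  thus ?thesis using nonzero_idealD(1)[OF assms(1)] by blast
qed

lemma nonzero_ideal_eq_R: assumes "nonzero_ideal J" "1 \<in> J" shows "J = R"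
  using nonzero_idealD(1,4)[OF assms(1)] assms(2) by (metis mult.right_neutral subsetI subset_antisym)

lemma ideal_norm_eq_subset: assumes "nonzero_ideal L" "nonzero_ideal J" "L \<subseteq> J" "ideal_norm L = ideal_norm J" shows "L = J"
proof -
  have "ideal_norm (colon L J) = 1"
    using ideal_norm_colon[OF assms(2,1,3)] ideal_norm_pos[OF assms(2)] assms(4) by simp
  hence "1 \<in> colon L J" using ideal_norm_1[OF nonzero_ideal_colon[OF assms(2,1,3)]] by simp
  thus ?thesis using assms(3) by (auto simp: colon_def)
qed

lemma colon_colon: assumes J: "nonzero_ideal J" and L: "nonzero_ideal L" "L \<subseteq> J"
  shows "colon L (colon L J) = J"
proof -
  let ?I = "colon L J"
  have I: "nonzero_ideal ?I" by (rule nonzero_ideal_colon[OF assms])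
  have LI: "L \<subseteq> ?I" unfolding colon_def using nonzero_idealD(2)[OF L(1)] nonzero_idealD(5)[OF L(1)] nonzero_idealD(2)[OF J] by auto
  have sub: "J \<subseteq> colon L ?I" unfolding colon_def[of L ?I] using nonzero_idealD(2)[OF J] by (auto simp: colon_def mult.commute)
  have "ideal_norm ?I * ideal_norm (colon L ?I) = ideal_norm J * ideal_norm ?I" using trans[OF ideal_norm_colon[OF I L(1) LI, symmetric] ideal_norm_colon[OF assms]] .
  hence "ideal_norm J = ideal_norm (colon L ?I)" using ideal_norm_pos[OF I] by (metis mult.commute nat_mult_eq_cancel1)
  from ideal_norm_eq_subset[OF J nonzero_ideal_colon[OF I L(1) LI] sub this] show ?thesis by simp
qed

lemma finite_nonzero_ideal_le: "finite {I. nonzero_ideal I \<and> ideal_norm I \<le> Y}"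
proof -
  let ?B = "{0..int Y} \<times> {0..int Y} \<times> {0..int Y}"
  define F where "F = (\<lambda>(a, b, c). {of_int c * (of_int m * of_int a + of_int n * (of_int b + w)) | m n. True})"
  have "{I. nonzero_ideal I \<and> ideal_norm I \<le> Y} \<subseteq> F ` ?B"
  proof clarify
    fix I assume I: "nonzero_ideal I" "ideal_norm I \<le> Y"
    obtain a b c where h: "hermite_form I a b c" using ex_hermite_form[OF I(1)] by blast
    have N: "int (ideal_norm I) = c * c * a" by (rule ideal_norm_hermite_form[OF I(1) h])
    have p: "a > 0" "c > 0" "0 \<le> b" "b < a" using h by (auto simp: hermite_form_def)
    have "1 \<le> c * c" "1 \<le> c * a" using p by (simp_all add: int_one_le_iff_zero_less)
    have "a \<le> c * c * a" using mult_right_mono[of 1 "c * c" a] \<open>1 \<le> c * c\<close> p by simp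
    moreover have "c \<le> c * c * a" using mult_left_mono[of 1 "c * a" c] \<open>1 \<le> c * a\<close> p by (simp add: mult.assoc)
    moreover have "c * c * a \<le> int Y" using N I(2) by linarith
    ultimately have "a \<le> int Y" "c \<le> int Y" by linarith+
    hence "(a, b, c) \<in> ?B" using p by auto
    moreover have "I = F (a, b, c)" using h by (simp add: F_def hermite_form_def)
    ultimately show "I \<in> F ` ?B" by blast
  qed
  thus ?thesis by (rule finite_subset) auto
qed

lemma finite_nonzero_ideal_above: assumes "nonzero_ideal L" shows "finite {J. nonzero_ideal J \<and> L \<subseteq> J}"
  by (rule finite_subset[OF _ finite_nonzero_ideal_le[of "ideal_norm L"]]) (use ideal_norm_mono assms in auto)

end

text \<open>The induction carries the telescoping bound \<open>4 - 2 / (M + 1)\<close>.\<close>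

lemma sum_int_inverse_squares_le:
  assumes "finite F"
  shows "(\<Sum>m\<in>F. 1 / (1 + \<bar>of_int m\<bar> :: real)\<^sup>2) \<le> 4"
proof -
  have sym: "(\<Sum>m\<in>{- int M..int M}. 1 / (1 + \<bar>of_int m\<bar> :: real)\<^sup>2) \<le> 4 - 2 / (real M + 1)" for M
  proof (induction M)
    case (Suc M)
    have "{- int (Suc M)..int (Suc M)} = insert (- int (Suc M)) (insert (int (Suc M)) {- int M..int M})" by auto
    hence "(\<Sum>m\<in>{- int (Suc M)..int (Suc M)}. 1 / (1 + \<bar>of_int m\<bar> :: real)\<^sup>2)
        = 2 / (real M + 2)\<^sup>2 + (\<Sum>m\<in>{- int M..int M}. 1 / (1 + \<bar>of_int m\<bar>)\<^sup>2)"
      by (simp add: algebra_simps)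
    also have "\<dots> \<le> 2 / (real M + 2)\<^sup>2 + (4 - 2 / (real M + 1))" using Suc by simp
    also have "2 / (real M + 2)\<^sup>2 \<le> 2 / ((real M + 1) * (real M + 2))"
      by (intro divide_left_mono) (auto simp: power2_eq_square)
    also have "2 / ((real M + 1) * (real M + 2)) = 2 / (real M + 1) - 2 / (real M + 2)"
      by (simp add: field_simps)
    finally show ?case by (simp add: add.commute)
  qed simp
  obtain M :: nat where M: "F \<subseteq> {- int M..int M}"
  proof -
    have "finite (abs ` F)" using assms by simp
    then obtain B where B: "\<And>m. m \<in> F \<Longrightarrow> \<bar>m\<bar> \<le> B" by (meson bdd_above_finite bdd_above_def imageI bdd_above.unfold)
    have "F \<subseteq> {- int (nat \<bar>B\<bar>)..int (nat \<bar>B\<bar>)}" using B by fastforce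
    thus ?thesis using that by blast
  qed
  have "(\<Sum>m\<in>F. 1 / (1 + \<bar>of_int m\<bar> :: real)\<^sup>2) \<le> (\<Sum>m\<in>{- int M..int M}. 1 / (1 + \<bar>of_int m\<bar>)\<^sup>2)"
    by (rule sum_mono2) (use M in auto)
  also have "\<dots> \<le> 4" using sym[of M] by (smt (verit) divide_nonneg_nonneg of_nat_0_le_iff)
  finally show ?thesis .
qed

context imag_quad_ring
begin

text \<open>In coordinates \<open>x = m + n w\<close> both \<open>1 + |m|\<close> and \<open>1 + |n|\<close> are at most a constant times \<open>|x|\<close>, so the
  series is dominated by a product of two convergent series.\<close>

lemma sum_inverse_fourth_powers_bounded:
  "\<exists>B. \<forall>F. finite F \<longrightarrow> F \<subseteq> R - {0} \<longrightarrow> (\<Sum>x\<in>F. 1 / cmod x ^ 4) \<le> B"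
proof -
  define C where "C = 2 + cmod w / Im w + 1 / Im w"
  have C0: "C > 0" using Im_w by (simp add: C_def add_pos_nonneg)
  have bound: "1 / cmod x ^ 4 \<le> C ^ 4 * (1 / (1 + \<bar>of_int m\<bar>)\<^sup>2 * (1 / (1 + \<bar>of_int n\<bar>)\<^sup>2))"
    if x: "x = of_int m + of_int n * w" "x \<noteq> 0" for x m n
  proof -
    have x1: "cmod x \<ge> 1" using R_norm_ge_1 R_I x by metis
    have "\<bar>of_int n\<bar> * Im w = \<bar>Im x\<bar>" using Im_w by (simp add: x(1) abs_mult)
    also have "\<dots> \<le> cmod x" by (rule abs_Im_le_cmod)
    finally have n: "\<bar>of_int n\<bar> \<le> cmod x / Im w" using Im_w by (simp add: field_simps)
    have "\<bar>of_int m\<bar> = cmod (x - of_int n * w)" by (simp add: x(1))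
    also have "\<dots> \<le> cmod x + \<bar>of_int n\<bar> * cmod w" by (metis norm_triangle_ineq4 norm_mult norm_of_int)
    also have "\<dots> \<le> cmod x + cmod x / Im w * cmod w" using mult_right_mono[OF n norm_ge_zero[of w]] by simp
    finally have m: "\<bar>of_int m\<bar> \<le> cmod x * (1 + cmod w / Im w)" by (simp add: algebra_simps)
    have "1 + \<bar>of_int m\<bar> \<le> cmod x * (2 + cmod w / Im w)" using m x1 by (simp add: algebra_simps)
    also have "\<dots> \<le> cmod x * C" using Im_w by (intro mult_left_mono) (auto simp: C_def)
    finally have m': "1 + \<bar>of_int m\<bar> \<le> cmod x * C" .
    have "1 + \<bar>of_int n\<bar> \<le> cmod x * (1 + 1 / Im w)" using n x1 by (simp add: algebra_simps)
    also have "\<dots> \<le> cmod x * C" using Im_w by (intro mult_left_mono) (auto simp: C_def)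
    finally have n': "1 + \<bar>of_int n\<bar> \<le> cmod x * C" .
    have "(1 + \<bar>of_int m\<bar>)\<^sup>2 * (1 + \<bar>of_int n\<bar>)\<^sup>2 \<le> (cmod x * C)\<^sup>2 * (cmod x * C)\<^sup>2"
      by (intro mult_mono power_mono m' n') auto
    also have "\<dots> = C ^ 4 * cmod x ^ 4" by (simp add: power_mult_distrib power2_eq_square power4_eq_xxxx mult_ac)
    finally have le: "(1 + \<bar>of_int m\<bar>)\<^sup>2 * (1 + \<bar>of_int n\<bar>)\<^sup>2 \<le> C ^ 4 * cmod x ^ 4" .
    have pos: "(1 + \<bar>of_int m\<bar>)\<^sup>2 * (1 + \<bar>of_int n\<bar>)\<^sup>2 > (0::real)"
      by (intro mult_pos_pos zero_less_power) auto
    have "1 / cmod x ^ 4 \<le> C ^ 4 / ((1 + \<bar>of_int m\<bar>)\<^sup>2 * (1 + \<bar>of_int n\<bar>)\<^sup>2)"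
      using le pos x(2) by (simp add: divide_simps mult_ac)
    thus ?thesis by simp
  qed
  have "(\<Sum>x\<in>F. 1 / cmod x ^ 4) \<le> C ^ 4 * 16" if F: "finite F" "F \<subseteq> R - {0}" for F
  proof -
    define g where "g = (\<lambda>(m::int, n::int). of_int m + of_int n * w)"
    have inj: "inj g" by (auto simp: g_def inj_on_def dest: basis_unique)
    define P where "P = g -` F"
    have fin: "finite P" unfolding P_def by (rule finite_vimageI[OF F(1) inj])
    have FP: "F = g ` P"
    proof
      show "F \<subseteq> g ` P"
      proof
        fix x assume x: "x \<in> F"
        then obtain m n where "x = of_int m + of_int n * w" using F(2) by (meson DiffE R_E subsetD)
        hence "x = g (m, n)" by (simp add: g_def)
        thus "x \<in> g ` P" using x by (auto simp: P_def)
      qed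
    qed (auto simp: P_def)
    define A B where "A = fst ` P" and "B = snd ` P"
    have AB: "finite A" "finite B" "P \<subseteq> A \<times> B" using fin by (auto simp: A_def B_def image_iff) (metis fst_conv snd_conv)+
    have "(\<Sum>x\<in>F. 1 / cmod x ^ 4) = (\<Sum>p\<in>P. 1 / cmod (g p) ^ 4)"
      unfolding FP by (rule sum.reindex_cong[OF inj_on_subset[OF inj subset_UNIV] refl]) simp
    also have "\<dots> \<le> (\<Sum>p\<in>P. C ^ 4 * (1 / (1 + \<bar>of_int (fst p)\<bar>)\<^sup>2 * (1 / (1 + \<bar>of_int (snd p)\<bar>)\<^sup>2)))"
    proof (rule sum_mono)
      fix p assume "p \<in> P"
      hence "g p \<noteq> 0" using F(2) by (auto simp: P_def)
      thus "1 / cmod (g p) ^ 4 \<le> C ^ 4 * (1 / (1 + \<bar>of_int (fst p)\<bar>)\<^sup>2 * (1 / (1 + \<bar>of_int (snd p)\<bar>)\<^sup>2))"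
        by (intro bound) (auto simp: g_def case_prod_beta)
    qed
    also have "\<dots> \<le> (\<Sum>p\<in>A \<times> B. C ^ 4 * (1 / (1 + \<bar>of_int (fst p)\<bar>)\<^sup>2 * (1 / (1 + \<bar>of_int (snd p)\<bar>)\<^sup>2)))"
      by (rule sum_mono2) (use AB C0 in auto)
    also have "\<dots> = C ^ 4 * (\<Sum>p\<in>A \<times> B. 1 / (1 + \<bar>of_int (fst p)\<bar>)\<^sup>2 * (1 / (1 + \<bar>of_int (snd p)\<bar>)\<^sup>2))"
      by (rule sum_distrib_left[symmetric])
    also have "(\<Sum>p\<in>A \<times> B. 1 / (1 + \<bar>of_int (fst p)\<bar>)\<^sup>2 * (1 / (1 + \<bar>of_int (snd p)\<bar>)\<^sup>2))
        = (\<Sum>m\<in>A. 1 / (1 + \<bar>of_int m\<bar> :: real)\<^sup>2) * (\<Sum>n\<in>B. 1 / (1 + \<bar>of_int n\<bar> :: real)\<^sup>2)"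
      unfolding sum_product by (subst sum.cartesian_product, rule sum.cong) auto
    also have "C ^ 4 * ((\<Sum>m\<in>A. 1 / (1 + \<bar>of_int m\<bar> :: real)\<^sup>2) * (\<Sum>n\<in>B. 1 / (1 + \<bar>of_int n\<bar> :: real)\<^sup>2)) \<le> C ^ 4 * (4 * 4)"
      by (rule mult_left_mono[OF mult_mono]) (use AB C0 in \<open>auto intro!: sum_int_inverse_squares_le sum_nonneg\<close>)
    finally show ?thesis by simp
  qed
  thus ?thesis by blast
qed

text \<open>A pigeonhole form of Minkowski's theorem.\<close>

lemma short_vector:
  assumes I: "nonzero_ideal I"
  shows "\<exists>x\<in>I. x \<noteq> 0 \<and> (cmod x)\<^sup>2 \<le> (1 + cmod w)\<^sup>2 * real (ideal_norm I)"
proof -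
  define s where "s = nat \<lfloor>sqrt (real (ideal_norm I))\<rfloor>"
  have s: "real s \<le> sqrt (real (ideal_norm I))" "sqrt (real (ideal_norm I)) < real s + 1"
    unfolding s_def by (simp_all add: of_nat_nat)
  have "real (ideal_norm I) < (real s + 1)\<^sup>2"
    using s(2) by (metis of_nat_0_le_iff real_sqrt_ge_zero real_sqrt_pow2 power_strict_mono zero_less_numeral)
  also have "\<dots> = real ((s + 1) * (s + 1))" by (simp add: power2_eq_square algebra_simps)
  finally have lt: "ideal_norm I < (s + 1) * (s + 1)" by (simp only: of_nat_less_iff)
  define f where "f = (\<lambda>(i::nat, j::nat). coset I (of_nat i + of_nat j * w))"
  let ?D = "{..s} \<times> {..s}"
  have "f ` ?D \<subseteq> coset I ` R" using R_I[of "int _" "int _"] by (auto simp: f_def)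
  hence "card (f ` ?D) \<le> ideal_norm I" unfolding ideal_norm_def using finite_cosets[OF I] by (rule card_mono[rotated])
  also have "\<dots> < card ?D" using lt by simp
  finally have "\<not> inj_on f ?D" by (metis card_image less_irrefl)
  then obtain i j i' j' where ij: "i \<le> s" "j \<le> s" "i' \<le> s" "j' \<le> s" "(i, j) \<noteq> (i', j')" "f (i, j) = f (i', j')"
    by (auto simp: inj_on_def)
  define x where "x = (of_nat i + of_nat j * w) - (of_nat i' + of_nat j' * w)"
  have xI: "x \<in> I" using ij(6) by (simp add: f_def coset_eq_iff[OF I] x_def)
  have "x \<noteq> 0"
  proof
    assume "x = 0"
    hence "of_int (int i) + of_int (int j) * w = of_int (int i') + of_int (int j') * w" by (simp add: x_def)
    from basis_unique[OF this] ij(5) show False by simp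
  qed
  moreover have "(cmod x)\<^sup>2 \<le> (1 + cmod w)\<^sup>2 * real (ideal_norm I)"
  proof -
    have "x = of_real (real i - real i') + of_real (real j - real j') * w" by (simp add: x_def algebra_simps)
    hence "cmod x \<le> \<bar>real i - real i'\<bar> + \<bar>real j - real j'\<bar> * cmod w"
      by (metis norm_triangle_ineq norm_mult norm_of_real)
    also have "\<dots> \<le> real s + real s * cmod w"
      using ij(1-4) by (intro add_mono mult_right_mono) auto
    also have "\<dots> = real s * (1 + cmod w)" by (simp add: algebra_simps)
    also have "\<dots> \<le> sqrt (real (ideal_norm I)) * (1 + cmod w)" using s(1) by (intro mult_right_mono) auto
    finally have "(cmod x)\<^sup>2 \<le> (sqrt (real (ideal_norm I)) * (1 + cmod w))\<^sup>2" by (rule power_mono) simp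
    thus ?thesis by (simp add: power_mult_distrib mult.commute)
  qed
  ultimately show ?thesis using xI by blast
qed

lemma nonzero_ideal_principal: assumes "x \<in> R" "x \<noteq> 0" shows "nonzero_ideal ((*) x ` R)"
  unfolding nonzero_ideal_def
proof (intro conjI ballI)
  show "(*) x ` R \<subseteq> R" using assms(1) by auto
  show "\<exists>y\<in>(*) x ` R. y \<noteq> 0" using assms(2) R_1 by (intro bexI[of _ "x * 1"]) auto
  show "y + z \<in> (*) x ` R" if yz: "y \<in> (*) x ` R" "z \<in> (*) x ` R" for y z
    using yz by (auto simp: distrib_left[symmetric])
  show "r * y \<in> (*) x ` R" if ry: "r \<in> R" "y \<in> (*) x ` R" for r y
    using ry by (auto simp: mult.left_commute)
qed

text \<open>\<open>(x R) * cnj (x R) = |x|\<^sup>2 R\<close>.\<close>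

lemma ideal_norm_principal: assumes "x \<in> R" "x \<noteq> 0" shows "real (ideal_norm ((*) x ` R)) = (cmod x)\<^sup>2"
proof -
  obtain N :: nat where N: "(cmod x)\<^sup>2 = of_nat N" using R_norm[OF assms(1)] .
  have N': "of_nat N = x * cnj x" using N by (metis complex_norm_square of_real_of_nat_eq)
  have "ideal_norm ((*) x ` R) = N"
  proof (rule ideal_norm_eqI[OF nonzero_ideal_principal[OF assms]])
    show "N > 0" using N assms(2) by (metis gr0I norm_eq_zero of_nat_0 zero_eq_power2)
    show "\<exists>r\<in>R. y * cnj z = of_nat N * r" if yz: "y \<in> (*) x ` R" "z \<in> (*) x ` R" for y z
    proof -
      obtain a b where ab: "y = x * a" "z = x * b" "a \<in> R" "b \<in> R" using yz by blast
      have "y * cnj z = of_nat N * (a * cnj b)" unfolding ab N' by simp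
      thus ?thesis using ab R_mult[OF ab(3) R_cnj[OF ab(4)]] by blast
    qed
    have "x \<in> (*) x ` R" by (rule image_eqI[of _ _ 1]) simp_all
    from conj_mult[OF nonzero_ideal_principal[OF assms] this this]
    show "\<exists>r\<in>R. of_nat N = of_nat (ideal_norm ((*) x ` R)) * r" unfolding N' .
  qed
  thus ?thesis using N by simp
qed

text \<open>Absolute convergence of \<open>\<zeta>(2)\<close>: an ideal \<open>I\<close> with short vector \<open>x\<close> is determined by \<open>x\<close> and
  the cofactor of \<open>I\<close> in \<open>x R\<close>, which ranges over a finite set.\<close>

lemma summable_ideal_norm: "(\<lambda>I. 1 / (real (ideal_norm I))\<^sup>2) summable_on {I. nonzero_ideal I}"
proof (rule nonneg_bdd_above_summable_on)
  define C where "C = (1 + cmod w)\<^sup>2"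
  have C0: "C \<ge> 1" unfolding C_def by (rule one_le_power) simp
  obtain sh where sh: "\<And>I. nonzero_ideal I \<Longrightarrow> sh I \<in> I \<and> sh I \<noteq> 0 \<and> (cmod (sh I))\<^sup>2 \<le> C * real (ideal_norm I)"
    using short_vector unfolding C_def by metis
  define T where "T = {I. nonzero_ideal I \<and> ideal_norm I \<le> nat \<lfloor>C\<rfloor>}"
  have finT: "finite T" unfolding T_def by (rule finite_nonzero_ideal_le)
  define g where "g I = (sh I, colon ((*) (sh I) ` R) I)" for I
  obtain B where B: "\<And>F. finite F \<Longrightarrow> F \<subseteq> R - {0} \<Longrightarrow> (\<Sum>x\<in>F. 1 / cmod x ^ 4) \<le> B"
    using sum_inverse_fourth_powers_bounded by blast
  have key: "sh I \<in> R - {0}" "colon ((*) (sh I) ` R) I \<in> T" "1 / (real (ideal_norm I))\<^sup>2 \<le> C\<^sup>2 * (1 / cmod (sh I) ^ 4)"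
    "colon ((*) (sh I) ` R) (colon ((*) (sh I) ` R) I) = I" if I: "nonzero_ideal I" for I
  proof -
    note s = sh[OF I]
    show sR: "sh I \<in> R - {0}" using s nonzero_idealD(2)[OF I] by blast
    have L: "nonzero_ideal ((*) (sh I) ` R)" using nonzero_ideal_principal sR by blast
    have sub: "(*) (sh I) ` R \<subseteq> I" using s nonzero_idealD(5)[OF I] by auto
    have N0: "real (ideal_norm I) > 0" using ideal_norm_pos[OF I] by simp
    have "(cmod (sh I))\<^sup>2 = real (ideal_norm I) * real (ideal_norm (colon ((*) (sh I) ` R) I))"
      using ideal_norm_colon[OF I L sub] ideal_norm_principal[of "sh I"] sR by simp
    hence "real (ideal_norm I) * real (ideal_norm (colon ((*) (sh I) ` R) I)) \<le> real (ideal_norm I) * C" using s by (simp add: mult.commute)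
    hence "real (ideal_norm (colon ((*) (sh I) ` R) I)) \<le> C" using N0 by simp
    hence "ideal_norm (colon ((*) (sh I) ` R) I) \<le> nat \<lfloor>C\<rfloor>" by (simp add: le_nat_floor)
    thus "colon ((*) (sh I) ` R) I \<in> T" unfolding T_def using nonzero_ideal_colon[OF I L sub] by simp
    show "colon ((*) (sh I) ` R) (colon ((*) (sh I) ` R) I) = I" by (rule colon_colon[OF I L sub])
    have "((cmod (sh I))\<^sup>2)\<^sup>2 \<le> (C * real (ideal_norm I))\<^sup>2" using s by (intro power_mono) auto
    hence "cmod (sh I) ^ 4 \<le> C\<^sup>2 * (real (ideal_norm I))\<^sup>2" by (simp add: power_mult_distrib flip: power_mult)
    thus "1 / (real (ideal_norm I))\<^sup>2 \<le> C\<^sup>2 * (1 / cmod (sh I) ^ 4)"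
      using N0 s by (simp add: divide_simps mult_ac)
  qed
  show "bdd_above (sum (\<lambda>I. 1 / (real (ideal_norm I))\<^sup>2) ` {F. F \<subseteq> {I. nonzero_ideal I} \<and> finite F})"
  proof (rule bdd_aboveI2)
    fix F assume "F \<in> {F. F \<subseteq> {I. nonzero_ideal I} \<and> finite F}"
    hence F: "\<And>I. I \<in> F \<Longrightarrow> nonzero_ideal I" "finite F" by auto
    have inj: "inj_on g F" unfolding g_def by (rule inj_onI) (metis F(1) key(4) prod.inject)
    let ?Y = "sh ` F"
    have sub: "g ` F \<subseteq> ?Y \<times> T" unfolding g_def using key(2) F(1) by auto
    have "(\<Sum>I\<in>F. 1 / (real (ideal_norm I))\<^sup>2) \<le> (\<Sum>I\<in>F. C\<^sup>2 * (1 / cmod (fst (g I)) ^ 4))"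
      by (rule sum_mono) (use key(3) F(1) in \<open>auto simp: g_def\<close>)
    also have "\<dots> = (\<Sum>p\<in>g ` F. C\<^sup>2 * (1 / cmod (fst p) ^ 4))"
      using sum.reindex[OF inj, of "\<lambda>p. C\<^sup>2 * (1 / cmod (fst p) ^ 4)"] by simp
    also have "\<dots> \<le> (\<Sum>p\<in>?Y \<times> T. C\<^sup>2 * (1 / cmod (fst p) ^ 4))"
      by (rule sum_mono2) (use sub F(2) finT in auto)
    also have "\<dots> = (\<Sum>x\<in>?Y. \<Sum>I\<in>T. C\<^sup>2 * (1 / cmod x ^ 4))"
      by (subst sum.cartesian_product) (simp add: case_prod_beta)
    also have "\<dots> = real (card T) * C\<^sup>2 * (\<Sum>x\<in>?Y. 1 / cmod x ^ 4)"
      by (simp add: sum_distrib_left mult_ac)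
    also have "\<dots> \<le> real (card T) * C\<^sup>2 * B"
      using F key(1) by (intro mult_left_mono B) auto
    finally show "(\<Sum>I\<in>F. 1 / (real (ideal_norm I))\<^sup>2) \<le> real (card T) * C\<^sup>2 * B" .
  qed
qed auto

end

section \<open>Counting points of product lattices in dilated regions\<close>

text \<open>Every lattice in the plane that contains a nonzero real number has such a basis.\<close>

definition plane_lattice :: "real \<Rightarrow> complex \<Rightarrow> complex set" where
  "plane_lattice a w = {of_real (a * of_int m) + of_int n * w | m n. True}"

text \<open>A rectangle is a fundamental domain although the lattice need not be rectangular: the vector \<open>w\<close>
  serves to adjust the imaginary part and the vector \<open>a\<close> the real part. Its area is immediate.\<close>

definition cell :: "real \<Rightarrow> complex \<Rightarrow> complex set" where
  "cell a w = {z. 0 \<le> Re z \<and> Re z < a \<and> 0 \<le> Im z \<and> Im z < Im w}"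

lemma cell_tiling:
  assumes "a > 0" "Im w > 0"
  shows "\<exists>!p. p \<in> plane_lattice a w \<and> z - p \<in> cell a w"
proof -
  define n where "n = \<lfloor>Im z / Im w\<rfloor>"
  define m where "m = \<lfloor>(Re z - of_int n * Re w) / a\<rfloor>"
  have n: "of_int n * Im w \<le> Im z" "Im z < (of_int n + 1) * Im w"
    using floor_divide_lower[OF assms(2), of "Im z"] floor_divide_upper[OF assms(2), of "Im z"] by (auto simp: n_def)
  have m: "of_int m * a \<le> Re z - of_int n * Re w" "Re z - of_int n * Re w < (of_int m + 1) * a"
    using floor_divide_lower[OF assms(1)] floor_divide_upper[OF assms(1)] by (auto simp: m_def)
  show ?thesis
  proof (rule ex1I[of _ "of_real (a * of_int m) + of_int n * w"])
    show "of_real (a * of_int m) + of_int n * w \<in> plane_lattice a w \<and> z - (of_real (a * of_int m) + of_int n * w) \<in> cell a w"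
      using n m by (auto simp: plane_lattice_def cell_def algebra_simps)
    fix p assume p: "p \<in> plane_lattice a w \<and> z - p \<in> cell a w"
    then obtain m' n' where p': "p = of_real (a * of_int m') + of_int n' * w" by (auto simp: plane_lattice_def)
    have c: "0 \<le> Re z - (a * of_int m' + of_int n' * Re w)" "Re z - (a * of_int m' + of_int n' * Re w) < a"
      "0 \<le> Im z - of_int n' * Im w" "Im z - of_int n' * Im w < Im w"
      using p by (auto simp: p' cell_def)
    have "n' = n" unfolding n_def
      by (rule floor_unique[symmetric]) (use c(3,4) assms(2) in \<open>auto simp: field_simps\<close>)
    moreover have "m' = m" unfolding m_def \<open>n' = n\<close>[symmetric]
      by (rule floor_unique[symmetric]) (use c(1,2) assms(1) in \<open>auto simp: field_simps\<close>)
    ultimately show "p = of_real (a * of_int m) + of_int n * w" by (simp add: p')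
  qed
qed

lemma finite_plane_lattice_bounded:
  assumes "a > 0" "Im w > 0"
  shows "finite {p \<in> plane_lattice a w. cmod p \<le> B}"
proof -
  define N where "N = \<lceil>B / Im w\<rceil>"
  define M where "M = \<lceil>(B + of_int \<bar>N\<bar> * cmod w) / a\<rceil>"
  have "{p \<in> plane_lattice a w. cmod p \<le> B} \<subseteq> (\<lambda>(m, n). of_real (a * of_int m) + of_int n * w) ` ({-M..M} \<times> {-N..N})"
  proof clarify
    fix p assume "p \<in> plane_lattice a w" and B: "cmod p \<le> B"
    then obtain m n where p: "p = of_real (a * of_int m) + of_int n * w" by (auto simp: plane_lattice_def)
    have "\<bar>of_int n\<bar> * Im w = \<bar>Im p\<bar>" using assms(2) by (simp add: p abs_mult)
    also have "\<dots> \<le> B" using abs_Im_le_cmod B by (rule order_trans)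
    finally have "\<bar>of_int n\<bar> \<le> B / Im w" using assms(2) by (simp add: field_simps)
    hence n: "\<bar>n\<bar> \<le> N" unfolding N_def by linarith
    have "a * \<bar>of_int m\<bar> = cmod (p - of_int n * w)" using assms(1) by (simp add: p norm_mult)
    also have "\<dots> \<le> B + \<bar>of_int n\<bar> * cmod w" using B norm_triangle_ineq4[of p "of_int n * w"] by (simp add: norm_mult)
    also have "\<dots> \<le> B + of_int \<bar>N\<bar> * cmod w" using n by (intro add_left_mono mult_right_mono norm_ge_zero) linarith
    finally have "\<bar>of_int m\<bar> \<le> (B + of_int \<bar>N\<bar> * cmod w) / a" using assms(1) by (simp add: field_simps)
    hence "\<bar>m\<bar> \<le> M" unfolding M_def by linarith
    thus "p \<in> (\<lambda>(m, n). of_real (a * of_int m) + of_int n * w) ` ({-M..M} \<times> {-N..N})"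
      using n p by (intro image_eqI[of _ _ "(m, n)"]) auto
  qed
  thus ?thesis by (rule finite_subset) auto
qed

lemma emeasure_scaled_cell:
  fixes p :: complex
  assumes "r > 0" "a > 0" "Im w > 0"
  defines "S \<equiv> {z. of_real r * z - p \<in> cell a w}"
  shows "S \<in> sets borel" "emeasure lborel S = ennreal (a * Im w / r\<^sup>2)"
proof -
  have S: "S = {z. Re p \<le> r * Re z \<and> r * Re z < Re p + a \<and> Im p \<le> r * Im z \<and> r * Im z < Im p + Im w}"
    by (auto simp: S_def cell_def)
  show sets: "S \<in> sets borel" unfolding S by measurable
  define l where "l = p /\<^sub>R r"
  define u where "u = Complex ((Re p + a) / r) ((Im p + Im w) / r)"
  have sub: "box l u \<subseteq> S" "S \<subseteq> cbox l u"
    using assms(1) by (auto simp: S l_def u_def box_def cbox_def Basis_complex_def field_simps)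
  have le: "\<And>b. b \<in> Basis \<Longrightarrow> l \<bullet> b \<le> u \<bullet> b"
    using assms by (auto simp: l_def u_def Basis_complex_def field_simps)
  have vol: "(\<Prod>b\<in>Basis. (u - l) \<bullet> b) = a * Im w / r\<^sup>2"
    using assms(1) by (simp add: Basis_complex_def l_def u_def field_simps power2_eq_square)
  show "emeasure lborel S = ennreal (a * Im w / r\<^sup>2)"
  proof (rule antisym)
    have "emeasure lborel S \<le> emeasure lborel (cbox l u)" by (rule emeasure_mono) (use sub in auto)
    also have "\<dots> = ennreal (a * Im w / r\<^sup>2)" using emeasure_lborel_cbox[OF le] vol by simp
    finally show "emeasure lborel S \<le> ennreal (a * Im w / r\<^sup>2)" .
    have "ennreal (a * Im w / r\<^sup>2) = emeasure lborel (box l u)" using emeasure_lborel_box[OF le] vol by simp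
    also have "\<dots> \<le> emeasure lborel S" by (rule emeasure_mono) (use sub sets in auto)
    finally show "ennreal (a * Im w / r\<^sup>2) \<le> emeasure lborel S" .
  qed
qed

text \<open>Replace each lattice point by its cell, scaled down by \<open>r\<close>: off the boundary of \<open>E\<close> the
  indicator of the union of the cells with base point in \<open>r E\<close> is eventually equal to that of \<open>E\<close>.\<close>

theorem lattice_pairs_asymptotics:
  fixes E :: "(complex \<times> complex) set"
  assumes a: "a > 0" and w: "Im w > 0" and bE: "bounded E" and mE: "E \<in> sets borel"
    and fr: "AE x in lborel. x \<notin> frontier E"
  defines "L \<equiv> plane_lattice a w"
  shows "((\<lambda>r. real (card {p \<in> L \<times> L. p /\<^sub>R r \<in> E}) / r ^ 4) \<longlongrightarrow> measure lborel E / (a * Im w)\<^sup>2) at_top"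
    and "\<And>r. r > 0 \<Longrightarrow> finite {p \<in> L \<times> L. p /\<^sub>R r \<in> E}"
proof -
  define S where "S r = {p \<in> L \<times> L. p /\<^sub>R r \<in> E}" for r
  define C where "C r p = {z. of_real r * fst z - fst p \<in> cell a w \<and> of_real r * snd z - snd p \<in> cell a w}"
    for r and p :: "complex \<times> complex"
  define G where "G r = (\<Union>p\<in>S r. C r p)" for r
  define D where "D = 2 * (a + Im w)"
  obtain B where B: "\<And>x. x \<in> E \<Longrightarrow> norm x \<le> B" using bE unfolding bounded_iff by blast
  have finS: "finite (S r)" if "r > 0" for r
  proof (rule finite_subset)
    let ?F = "{p \<in> L. cmod p \<le> r * B}"
    show "S r \<subseteq> ?F \<times> ?F"
    proof
      fix p assume p: "p \<in> S r"
      have "norm p / r \<le> B" using B[of "p /\<^sub>R r"] p that by (simp add: S_def divide_inverse mult.commute)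
      hence "norm p \<le> r * B" using that by (simp add: field_simps)
      hence "cmod (fst p) \<le> r * B" "cmod (snd p) \<le> r * B"
        using norm_fst_le[of "fst p" "snd p"] norm_snd_le[of "snd p" "fst p"] by auto
      thus "p \<in> ?F \<times> ?F" using p by (auto simp: S_def)
    qed
    show "finite (?F \<times> ?F)" using finite_plane_lattice_bounded[OF a w] by (simp add: L_def)
  qed
  thus "\<And>r. r > 0 \<Longrightarrow> finite {p \<in> L \<times> L. p /\<^sub>R r \<in> E}" by (simp add: S_def)
  have cellD: "cmod z \<le> a + Im w" if "z \<in> cell a w" for z
    using cmod_le[of z] that by (auto simp: cell_def)
  have near: "dist (p /\<^sub>R r) z \<le> D / r" if "r > 0" "z \<in> C r p" for r p z
  proof -
    have "norm (r *\<^sub>R z - p) \<le> norm (fst (r *\<^sub>R z - p)) + norm (snd (r *\<^sub>R z - p))"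
      by (metis norm_Pair_le prod.collapse)
    also have "\<dots> \<le> D"
      using cellD[of "of_real r * fst z - fst p"] cellD[of "of_real r * snd z - snd p"] that(2)
      by (auto simp: C_def D_def scaleR_conv_of_real)
    finally have "norm (r *\<^sub>R z - p) / r \<le> D / r" using that(1) by (simp add: divide_right_mono)
    moreover have "p /\<^sub>R r - z = - ((r *\<^sub>R z - p) /\<^sub>R r)" using that(1) by (simp add: algebra_simps)
    hence "dist (p /\<^sub>R r) z = norm (r *\<^sub>R z - p) / r" using that(1) by (simp add: dist_norm divide_inverse mult.commute)
    ultimately show ?thesis by simp
  qed
  have ex: "\<exists>p\<in>L \<times> L. z \<in> C r p" for z r
  proof -
    obtain p1 where "p1 \<in> L" "of_real r * fst z - p1 \<in> cell a w" using cell_tiling[OF a w] unfolding L_def by blast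
    moreover obtain p2 where "p2 \<in> L" "of_real r * snd z - p2 \<in> cell a w" using cell_tiling[OF a w] unfolding L_def by blast
    ultimately show ?thesis by (intro bexI[of _ "(p1, p2)"]) (auto simp: C_def)
  qed
  have unique: "p = p'" if "p \<in> L \<times> L" "p' \<in> L \<times> L" "z \<in> C r p" "z \<in> C r p'" for p p' z r
    using cell_tiling[OF a w, of "of_real r * fst z"] cell_tiling[OF a w, of "of_real r * snd z"] that
    unfolding L_def C_def by (auto simp: prod_eq_iff)
  have Cprod: "C r p = {z. of_real r * z - fst p \<in> cell a w} \<times> {z. of_real r * z - snd p \<in> cell a w}" for r p
    by (auto simp: C_def)
  have Csets: "C r p \<in> sets borel" if "r > 0" for r p
    unfolding Cprod borel_prod[symmetric] by (intro pair_measureI emeasure_scaled_cell that a w)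
  have Cvol: "emeasure lborel (C r p) = ennreal ((a * Im w)\<^sup>2 / r ^ 4)" if r: "r > 0" for r p
  proof -
    have "emeasure lborel (C r p) = emeasure (lborel \<Otimes>\<^sub>M lborel) (C r p)" by (simp add: lborel_prod)
    also have "\<dots> = ennreal (a * Im w / r\<^sup>2) * ennreal (a * Im w / r\<^sup>2)"
      unfolding Cprod using emeasure_scaled_cell[OF r a w]
      by (subst lborel.emeasure_pair_measure_Times) auto
    also have "\<dots> = ennreal ((a * Im w)\<^sup>2 / r ^ 4)"
      using a w by (simp add: power2_eq_square power4_eq_xxxx mult_ac flip: ennreal_mult)
    finally show ?thesis .
  qed
  have Gsets: "G r \<in> sets borel" if "r > 0" for r
    unfolding G_def using finS[OF that] Csets[OF that] by auto
  have Gvol: "measure lborel (G r) = real (card (S r)) * ((a * Im w)\<^sup>2 / r ^ 4)" if r: "r > 0" for r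
  proof -
    have "measure lborel (G r) = (\<Sum>p\<in>S r. measure lborel (C r p))"
      unfolding G_def
    proof (rule measure_finite_Union[OF finS[OF r]])
      show "disjoint_family_on (C r) (S r)"
        unfolding disjoint_family_on_def S_def using unique by blast
    qed (use Csets[OF r] Cvol[OF r] in auto)
    also have "\<dots> = (\<Sum>p\<in>S r. (a * Im w)\<^sup>2 / r ^ 4)"
      by (rule sum.cong) (use Cvol[OF r] r in \<open>auto simp: measure_def\<close>)
    finally show ?thesis by simp
  qed
  have Gball: "G r \<subseteq> cball 0 (B + D)" if "r \<ge> 1" for r
  proof
    fix z assume "z \<in> G r"
    then obtain p where p: "p \<in> S r" "z \<in> C r p" by (auto simp: G_def)
    have "norm z \<le> norm (p /\<^sub>R r) + dist (p /\<^sub>R r) z" by (metis dist_commute dist_norm norm_triangle_sub)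
    also have "\<dots> \<le> B + D / r"
    proof (rule add_mono)
      show "norm (p /\<^sub>R r) \<le> B" using B[of "p /\<^sub>R r"] p(1) unfolding S_def by blast
      show "dist (p /\<^sub>R r) z \<le> D / r" using near[OF _ p(2)] that by simp
    qed
    also have "D / r \<le> D / 1" using that a w by (intro divide_left_mono) (auto simp: D_def)
    finally have "norm z \<le> B + D" by simp
    thus "z \<in> cball 0 (B + D)" by simp
  qed
  have "((\<lambda>r. integral\<^sup>L lborel (\<lambda>z. indicator (G r) z * indicator {1..} r :: real)) \<longlongrightarrow>
      integral\<^sup>L lborel (indicator E)) at_top"
  proof (rule integral_dominated_convergence_at_top[where w="indicator (cball 0 (B + D))"])
    show "(indicator E :: _ \<Rightarrow> real) \<in> borel_measurable lborel" using mE by simp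
    show "(\<lambda>z. indicator (G r) z * indicator {1..} r :: real) \<in> borel_measurable lborel" for r
      using Gsets[of r] by (cases "r \<ge> 1") auto
    show "integrable lborel (indicator (cball 0 (B + D) :: (complex \<times> complex) set) :: _ \<Rightarrow> real)"
      using emeasure_bounded_finite[of "cball 0 (B + D) :: (complex \<times> complex) set"]
      by (intro integrable_real_indicator) auto
    show "\<forall>\<^sub>F r in at_top. AE z in lborel. norm (indicator (G r) z * indicator {1..} r :: real) \<le> indicator (cball 0 (B + D)) z"
      using eventually_ge_at_top[of 1]
    proof eventually_elim
      case (elim r)
      have "norm (indicator (G r) z * indicator {1..} r :: real) \<le> indicator (cball 0 (B + D)) z" for z
        using Gball[OF elim] by (auto simp: indicator_def)
      thus ?case by (intro AE_I2)
    qed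
    show "AE z in lborel. ((\<lambda>r. indicator (G r) z * indicator {1..} r :: real) \<longlongrightarrow> indicator E z) at_top"
      using fr
    proof eventually_elim
      fix z assume z: "z \<notin> frontier E"
      have lim: "\<forall>\<^sub>F r in at_top. D / r < e" if "e > 0" for e
      proof -
        have "((\<lambda>r. D / r) \<longlongrightarrow> 0) at_top" by (rule tendsto_divide_0[OF tendsto_const]) (simp add: filterlim_ident filterlim_at_top_imp_at_infinity)
        thus ?thesis using that by (rule order_tendstoD)
      qed
      have "\<forall>\<^sub>F r in at_top. z \<in> G r \<longleftrightarrow> z \<in> E"
      proof (cases "z \<in> E")
        case True
        hence "z \<in> interior E" using z closure_subset by (auto simp: frontier_def)
        then obtain e where e: "e > 0" "ball z e \<subseteq> E" by (meson mem_interior)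
        from lim[OF e(1)] eventually_gt_at_top[of 0] show ?thesis
        proof eventually_elim
          case (elim r)
          obtain p where p: "p \<in> L \<times> L" "z \<in> C r p" using ex by blast
          have "p /\<^sub>R r \<in> ball z e" using near[OF elim(2) p(2)] elim(1) by (simp add: dist_commute)
          hence "p \<in> S r" using p e by (auto simp: S_def)
          thus ?case using p True by (auto simp: G_def)
        qed
      next
        case False
        hence "z \<notin> closure E" using z interior_subset by (auto simp: frontier_def)
        then obtain e where e: "e > 0" "ball z e \<subseteq> - closure E" using open_contains_ball[of "- closure E"] by (auto simp: open_Compl)
        from lim[OF e(1)] eventually_gt_at_top[of 0] show ?thesis
        proof eventually_elim
          case (elim r)
          have "z \<notin> G r"
          proof
            assume "z \<in> G r"
            then obtain p where p: "p \<in> S r" "z \<in> C r p" by (auto simp: G_def)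
            have "p /\<^sub>R r \<in> ball z e" using near[OF elim(2) p(2)] elim(1) by (simp add: dist_commute)
            hence "p /\<^sub>R r \<notin> E" using e closure_subset[of E] by blast
            thus False using p by (simp add: S_def)
          qed
          thus ?case using False by simp
        qed
      qed
      hence "\<forall>\<^sub>F r in at_top. indicator (G r) z * indicator {1..} r = (indicator E z :: real)"
        using eventually_ge_at_top[of 1] by eventually_elim (auto simp: indicator_def)
      thus "((\<lambda>r. indicator (G r) z * indicator {1..} r :: real) \<longlongrightarrow> indicator E z) at_top"
        by (rule tendsto_eventually)
    qed
  qed
  moreover have "integral\<^sup>L lborel (indicator E) = measure lborel E" by simp
  moreover have "\<forall>\<^sub>F r in at_top. integral\<^sup>L lborel (\<lambda>z. indicator (G r) z * indicator {1..} r :: real)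
     = real (card (S r)) * ((a * Im w)\<^sup>2 / r ^ 4)"
    using eventually_ge_at_top[of 1]
  proof eventually_elim
    case (elim r)
    hence "integral\<^sup>L lborel (\<lambda>z. indicator (G r) z * indicator {1..} r :: real) = measure lborel (G r)" by simp
    thus ?case using Gvol[of r] elim by simp
  qed
  ultimately have "((\<lambda>r. real (card (S r)) * ((a * Im w)\<^sup>2 / r ^ 4)) \<longlongrightarrow> measure lborel E) at_top"
    by (simp add: filterlim_cong)
  hence "((\<lambda>r. real (card (S r)) * ((a * Im w)\<^sup>2 / r ^ 4) / (a * Im w)\<^sup>2) \<longlongrightarrow> measure lborel E / (a * Im w)\<^sup>2) at_top"
    using a w by (intro tendsto_divide tendsto_const) auto
  thus "((\<lambda>r. real (card {p \<in> L \<times> L. p /\<^sub>R r \<in> E}) / r ^ 4) \<longlongrightarrow> measure lborel E / (a * Im w)\<^sup>2) at_top"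
    using a w by (simp add: S_def)
qed

section \<open>The volume of the fundamental region\<close>

lemma nn_integral_complex_affine:
  fixes t :: complex and c :: real
  assumes [measurable]: "f \<in> borel_measurable borel" and "c \<noteq> 0"
  shows "(\<integral>\<^sup>+x. f x \<partial>lborel) = ennreal (c\<^sup>2) * (\<integral>\<^sup>+x. f (t + of_real c * x) \<partial>lborel)"
  by (subst lborel_affine[OF assms(2), of t])
     (simp add: nn_integral_density nn_integral_distr nn_integral_cmult scaleR_conv_of_real)

text \<open>Under area measure on the plane the squared modulus is uniformly distributed, with density
  \<open>\<pi>\<close>. The reflection only serves to make the rays that generate the Borel sets have finite measure.\<close>

lemma distr_neg_norm_square:
  "distr lborel borel (\<lambda>z::complex. - (cmod z)\<^sup>2) = density lborel (\<lambda>x. ennreal pi * indicator {..0} x)"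
proof (rule measure_eqI_lessThan)
  let ?M = "distr lborel borel (\<lambda>z::complex. - (cmod z)\<^sup>2)"
  let ?N = "density lborel (\<lambda>x. ennreal pi * indicator {..0::real} x)"
  show "sets ?M = sets borel" "sets ?N = sets borel" by simp_all
  have M: "emeasure ?M {x<..} = ennreal (pi * max 0 (- x))" for x
  proof -
    have "emeasure ?M {x<..} = emeasure lborel {z::complex. x < - (cmod z)\<^sup>2}"
      by (subst emeasure_distr) (auto simp: vimage_def)
    also have "{z::complex. x < - (cmod z)\<^sup>2} = (if x < 0 then ball 0 (sqrt (- x)) else {})"
    proof -
      have eq: "x < - (cmod z)\<^sup>2 \<longleftrightarrow> x < 0 \<and> cmod z < sqrt (- x)" for z
      proof (cases "x < 0")
        case True
        have "x < - (cmod z)\<^sup>2 \<longleftrightarrow> (cmod z)\<^sup>2 < - x" by linarith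
        also have "\<dots> \<longleftrightarrow> sqrt ((cmod z)\<^sup>2) < sqrt (- x)" by (simp only: real_sqrt_less_iff)
        finally show ?thesis using True by simp
      next
        case False
        thus ?thesis using zero_le_power2[of "cmod z"] by linarith
      qed
      show ?thesis unfolding eq by auto
    qed
    also have "emeasure lborel \<dots> = ennreal (pi * max 0 (- x))"
      by (simp add: emeasure_ball unit_ball_vol_2)
    finally show ?thesis .
  qed
  show "emeasure ?M {x<..} < \<infinity>" for x unfolding M by simp
  show "emeasure ?M {x<..} = emeasure ?N {x<..}" for x
  proof -
    have "emeasure ?N {x<..} = (\<integral>\<^sup>+y. ennreal pi * indicator {x<..0} y \<partial>lborel)"
      by (subst emeasure_density) (auto intro!: nn_integral_cong simp: indicator_def)
    also have "\<dots> = ennreal pi * emeasure lborel {x<..0}"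
      by (simp add: nn_integral_cmult_indicator)
    also have "emeasure lborel {x<..0} = ennreal (max 0 (- x))"
      by (cases "x \<le> 0") (auto simp: max_def)
    finally show ?thesis unfolding M by (simp add: ennreal_mult')
  qed
qed

lemma nn_integral_norm_square:
  fixes f :: "real \<Rightarrow> ennreal"
  assumes [measurable]: "f \<in> borel_measurable borel"
  shows "(\<integral>\<^sup>+z. f ((cmod z)\<^sup>2) \<partial>lborel) = ennreal pi * (\<integral>\<^sup>+x. f x * indicator {0..} x \<partial>lborel)"
proof -
  have "(\<integral>\<^sup>+z. f ((cmod z)\<^sup>2) \<partial>lborel) = (\<integral>\<^sup>+x. f (- x) \<partial>distr lborel borel (\<lambda>z::complex. - (cmod z)\<^sup>2))"
    by (subst nn_integral_distr) auto
  also have "\<dots> = (\<integral>\<^sup>+x. ennreal pi * (f (- x) * indicator {0..} (- x)) \<partial>lborel)"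
    unfolding distr_neg_norm_square
    by (subst nn_integral_density) (auto intro!: nn_integral_cong simp: indicator_def mult_ac)
  also have "\<dots> = ennreal pi * (\<integral>\<^sup>+x. f (- x) * indicator {0..} (- x) \<partial>lborel)"
    by (rule nn_integral_cmult) simp
  also have "(\<integral>\<^sup>+x. f (- x) * indicator {0..} (- x) \<partial>lborel) = (\<integral>\<^sup>+x. f x * indicator {0..} x \<partial>lborel)"
    using nn_integral_real_affine[of "\<lambda>x. f x * indicator {0..} x" "-1" 0] by simp
  finally show ?thesis .
qed

text \<open>In the coordinates \<open>(u, v)\<close> of the two conjugate values, \<open>|u v|\<close> is the absolute value of the norm
  form and the condition on \<open>|u / v|\<close> cuts out a fundamental domain of a unit multiplying this
  ratio by \<open>q\<close>. The strict inequality excludes the axes.\<close>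

definition hyperbolic_region :: "real \<Rightarrow> (complex \<times> complex) set" where
  "hyperbolic_region q = {(u, v). cmod v \<le> cmod u \<and> cmod u < q * cmod v \<and> cmod u * cmod v \<le> 1}"

lemma hyperbolic_region_sets: "hyperbolic_region q \<in> sets borel"
proof -
  have "hyperbolic_region q = {x. cmod (snd x) \<le> cmod (fst x)} \<inter> {x. cmod (fst x) < q * cmod (snd x)}
      \<inter> {x. cmod (fst x) * cmod (snd x) \<le> 1}"
    by (auto simp: hyperbolic_region_def)
  also have "\<dots> \<in> sets borel"
    by (intro sets.Int borel_closed borel_open closed_Collect_le open_Collect_less continuous_intros)
  finally show ?thesis .
qed

lemma hyperbola_section_length:
  assumes "Q > 1" "(y::real) \<ge> 0"
  shows "(\<integral>\<^sup>+x. indicator {(x, y). y \<le> x \<and> x < Q * y \<and> x * y \<le> 1} (x, y) * indicator {0..} x \<partial>lborel)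
    = indicator {0..1 / sqrt Q} y * ennreal ((Q - 1) * y) + indicator {1 / sqrt Q<..1} y * ennreal (1 / y - y)"
proof -
  have s1: "1 / sqrt Q < 1" "1 / sqrt Q > 0" using assms(1) by auto
  define A where "A = {x. y \<le> x \<and> x < Q * y \<and> x * y \<le> 1}"
  have "(\<integral>\<^sup>+x. indicator {(x, y). y \<le> x \<and> x < Q * y \<and> x * y \<le> 1} (x, y) * indicator {0..} x \<partial>lborel)
      = (\<integral>\<^sup>+x. indicator A x \<partial>lborel)"
    using assms(2) by (intro nn_integral_cong) (auto simp: A_def indicator_def)
  also have "\<dots> = emeasure lborel A"
    unfolding A_def by (intro nn_integral_indicator) measurable
  also have "\<dots> = indicator {0..1 / sqrt Q} y * ennreal ((Q - 1) * y) + indicator {1 / sqrt Q<..1} y * ennreal (1 / y - y)"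
  proof -
    have sq: "y \<le> 1 / sqrt Q \<longleftrightarrow> Q * y * y \<le> 1"
    proof -
      have "y \<le> 1 / sqrt Q \<longleftrightarrow> sqrt Q * y \<le> 1" using assms(1) by (simp add: field_simps)
      also have "\<dots> \<longleftrightarrow> (sqrt Q * y)\<^sup>2 \<le> 1\<^sup>2"
        using assms by (intro power_mono_iff[symmetric]) auto
      also have "(sqrt Q * y)\<^sup>2 = Q * y * y" using assms by (simp add: power_mult_distrib power2_eq_square)
      finally show ?thesis by simp
    qed
    consider "y = 0" | "y > 0" "y \<le> 1 / sqrt Q" | "y > 1 / sqrt Q" "y \<le> 1" | "y > 1" using assms(2) by linarith
    thus ?thesis
    proof cases
      case 1
      hence "A = {}" by (auto simp: A_def)
      thus ?thesis using 1 s1 by simp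
    next
      case 2
      have "A = {y..<Q * y}"
      proof -
        have "x * y \<le> 1" if "x < Q * y" for x
        proof -
          have "x * y \<le> Q * y * y" using that 2 by (intro mult_right_mono) auto
          thus ?thesis using 2 sq by linarith
        qed
        thus ?thesis by (auto simp: A_def)
      qed
      hence "emeasure lborel A = ennreal (Q * y - y)" using 2 assms by simp
      also have "Q * y - y = (Q - 1) * y" by (simp add: algebra_simps)
      finally show ?thesis using 2 by (simp add: indicator_def)
    next
      case 3
      hence y0: "y > 0" using s1 by linarith
      have "A = {y..1 / y}"
      proof -
        have lt: "1 / y < Q * y" using 3 sq y0 by (simp add: field_simps)
        have eqv: "x * y \<le> 1 \<longleftrightarrow> x \<le> 1 / y" for x using y0 by (simp add: field_simps)
        have "x \<in> A \<longleftrightarrow> x \<in> {y..1 / y}" for x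
          unfolding A_def mem_Collect_eq atLeastAtMost_iff eqv using lt by (meson le_less_trans)
        thus ?thesis by blast
      qed
      moreover have "y \<le> 1 / y" using 3 y0 by (simp add: field_simps mult_le_one)
      ultimately have "emeasure lborel A = ennreal (1 / y - y)" by simp
      thus ?thesis using 3 y0 s1 by (simp add: indicator_def)
    next
      case 4
      have "A = {}"
      proof -
        have False if "y \<le> x" "x * y \<le> 1" for x
        proof -
          have "1 < y * y" using 4 by (simp add: less_1_mult)
          also have "\<dots> \<le> x * y" using that 4 by (intro mult_right_mono) auto
          finally show False using that by simp
        qed
        thus ?thesis by (auto simp: A_def)
      qed
      moreover have "\<not> y \<le> 1 / sqrt Q" using 4 s1 by linarith
      ultimately show ?thesis using 4 by (simp add: indicator_def)
    qed
  qed
  finally show ?thesis .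
qed

lemma nn_integral_indicator_Icc:
  fixes f :: "real \<Rightarrow> real"
  assumes "\<And>x. x \<in> {a..b} \<Longrightarrow> 0 \<le> f x" "(f has_integral I) {a..b}"
  shows "(\<integral>\<^sup>+x. indicator {a..b} x * ennreal (f x) \<partial>lborel) = ennreal I"
proof -
  have "(\<integral>\<^sup>+x. indicator {a..b} x * ennreal (f x) \<partial>lborel) = (\<integral>\<^sup>+x. ennreal (indicator {a..b} x * f x) \<partial>lborel)"
    by (rule nn_integral_cong) (auto simp: indicator_def)
  also have "\<dots> = ennreal I" by (rule nn_integral_has_integral_lebesgue[OF assms])
  finally show ?thesis .
qed

text \<open>The area of \<open>{(x, y). y \<le> x < Q y \<and> x y \<le> 1}\<close>: the sections grow linearly up to the corner
  \<open>y = 1 / sqrt Q\<close> on the hyperbola and are bounded by the hyperbola from there on.\<close>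

lemma area_integral:
  assumes "Q > 1"
  shows "(\<integral>\<^sup>+y. (indicator {0..1 / sqrt Q} y * ennreal ((Q - 1) * y) + indicator {1 / sqrt Q<..1} y * ennreal (1 / y - y)) \<partial>lborel)
    = ennreal (ln Q / 2)"
proof -
  define s where "s = 1 / sqrt Q"
  have s: "0 < s" "s < 1" "s\<^sup>2 = 1 / Q" using assms by (auto simp: s_def power_divide)
  have 1: "(\<integral>\<^sup>+y. indicator {0..s} y * ennreal ((Q - 1) * y) \<partial>lborel) = ennreal ((Q - 1) * s\<^sup>2 / 2)"
  proof (rule nn_integral_indicator_Icc)
    have "((\<lambda>y. (Q - 1) * y) has_integral ((Q - 1) * s\<^sup>2 / 2 - (Q - 1) * 0\<^sup>2 / 2)) {0..s}"
    proof (rule fundamental_theorem_of_calculus)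
      fix x
      have "((\<lambda>y. (Q - 1) * y\<^sup>2 / 2) has_real_derivative ((Q - 1) * x)) (at x)"
        by (auto intro!: derivative_eq_intros)
      thus "((\<lambda>y. (Q - 1) * y\<^sup>2 / 2) has_vector_derivative ((Q - 1) * x)) (at x within {0..s})"
        by (metis has_field_derivative_at_within has_real_derivative_iff_has_vector_derivative)
    qed (use s in simp)
    thus "((\<lambda>y. (Q - 1) * y) has_integral (Q - 1) * s\<^sup>2 / 2) {0..s}" by simp
  qed (use assms in auto)
  have 2: "(\<integral>\<^sup>+y. indicator {s..1} y * ennreal (1 / y - y) \<partial>lborel) = ennreal (- ln s - (1 - s\<^sup>2) / 2)"
  proof (rule nn_integral_indicator_Icc)
    have "((\<lambda>y. 1 / y - y) has_integral ((ln 1 - 1\<^sup>2 / 2) - (ln s - s\<^sup>2 / 2))) {s..1}"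
    proof (rule fundamental_theorem_of_calculus)
      fix x assume "x \<in> {s..1}"
      hence "x > 0" using s by auto
      hence "((\<lambda>y. ln y - y\<^sup>2 / 2) has_real_derivative (1 / x - x)) (at x)"
        by (auto intro!: derivative_eq_intros)
      thus "((\<lambda>y. ln y - y\<^sup>2 / 2) has_vector_derivative (1 / x - x)) (at x within {s..1})"
        by (metis has_field_derivative_at_within has_real_derivative_iff_has_vector_derivative)
    qed (use s in simp)
    moreover have "(ln 1 - 1\<^sup>2 / 2) - (ln s - s\<^sup>2 / 2) = - ln s - (1 - s\<^sup>2) / 2" by (simp add: field_simps)
    ultimately show "((\<lambda>y. 1 / y - y) has_integral (- ln s - (1 - s\<^sup>2) / 2)) {s..1}" by (simp only:)
    fix y assume "y \<in> {s..1}"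
    hence "y > 0" "y \<le> 1" using s by auto
    thus "0 \<le> 1 / y - y" by (simp add: field_simps mult_le_one)
  qed
  have 3: "(\<integral>\<^sup>+y. indicator {s<..1} y * ennreal (1 / y - y) \<partial>lborel)
      = (\<integral>\<^sup>+y. indicator {s..1} y * ennreal (1 / y - y) \<partial>lborel)"
    by (rule nn_integral_cong_AE, rule AE_mp[OF AE_lborel_singleton[of s]]) (auto simp: indicator_def)
  have "- ln s = ln Q / 2" using assms by (simp add: s_def ln_div ln_sqrt)
  hence tot: "(Q - 1) * s\<^sup>2 / 2 + (- ln s - (1 - s\<^sup>2) / 2) = ln Q / 2" using assms by (simp add: s(3) field_simps)
  have "0 \<le> - ln s - (1 - s\<^sup>2) / 2"
  proof -
    have "ln (s\<^sup>2) \<le> s\<^sup>2 - 1" using zero_less_power[OF s(1)] by (rule ln_le_minus_one)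
    thus ?thesis using s(1) by (simp add: ln_realpow)
  qed
  hence "ennreal ((Q - 1) * s\<^sup>2 / 2) + ennreal (- ln s - (1 - s\<^sup>2) / 2) = ennreal (ln Q / 2)"
    using assms tot by (simp flip: ennreal_plus)
  thus ?thesis unfolding s_def[symmetric] by (subst nn_integral_add) (auto simp: 1 2 3)
qed

text \<open>The region depends on \<open>|u|\<^sup>2\<close> and \<open>|v|\<^sup>2\<close> only, so integrating out the two angles reduces its volume
  to \<open>\<pi>\<^sup>2\<close> times a plane area.\<close>

lemma emeasure_hyperbolic_region:
  assumes "q > 1"
  shows "emeasure lborel (hyperbolic_region q) = ennreal (pi\<^sup>2 * ln q)"
proof -
  define k :: "real \<times> real \<Rightarrow> ennreal" where "k = indicator {(x, y). y \<le> x \<and> x < q\<^sup>2 * y \<and> x * y \<le> 1}"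
  have kb: "k \<in> borel_measurable (borel \<Otimes>\<^sub>M borel)"
  proof -
    have "{(x, y). y \<le> x \<and> x < q\<^sup>2 * y \<and> x * y \<le> 1} = {z::real \<times> real. snd z \<le> fst z} \<inter> {z. fst z < q\<^sup>2 * snd z}
      \<inter> {z. fst z * snd z \<le> 1}" by auto
    also have "\<dots> \<in> sets borel"
      by (intro sets.Int borel_closed borel_open closed_Collect_le open_Collect_less continuous_intros)
    finally show ?thesis unfolding k_def borel_prod by (rule borel_measurable_indicator)
  qed
  have [measurable]: "(\<lambda>x. k (x, y)) \<in> borel_measurable borel" for y
    by (simp add: measurable_compose[OF _ kb])
  have ind: "indicator (hyperbolic_region q) (u, v) = k ((cmod u)\<^sup>2, (cmod v)\<^sup>2)" for u v
  proof -
    have "cmod v \<le> cmod u \<longleftrightarrow> (cmod v)\<^sup>2 \<le> (cmod u)\<^sup>2" by (simp add: power_mono_iff)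
    moreover have "cmod u < q * cmod v \<longleftrightarrow> (cmod u)\<^sup>2 < q\<^sup>2 * (cmod v)\<^sup>2"
      using assms power_mono_iff[of "q * cmod v" "cmod u" 2]
      by (simp add: power_mult_distrib linorder_not_le[symmetric])
    moreover have "cmod u * cmod v \<le> 1 \<longleftrightarrow> (cmod u)\<^sup>2 * (cmod v)\<^sup>2 \<le> 1"
      using power_mono_iff[of "cmod u * cmod v" 1 2] by (simp add: power_mult_distrib)
    ultimately show ?thesis by (simp add: k_def hyperbolic_region_def indicator_def)
  qed
  have q2: "q\<^sup>2 > 1" using assms by (simp add: one_less_power)
  have "emeasure lborel (hyperbolic_region q) = (\<integral>\<^sup>+x. indicator (hyperbolic_region q) x \<partial>(lborel \<Otimes>\<^sub>M lborel))"
    using hyperbolic_region_sets by (simp add: lborel_prod)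
  also have "\<dots> = (\<integral>\<^sup>+v. \<integral>\<^sup>+u. indicator (hyperbolic_region q) (u, v) \<partial>lborel \<partial>lborel)"
    by (rule lborel_pair.nn_integral_snd[symmetric]) (use hyperbolic_region_sets in \<open>simp add: lborel_prod\<close>)
  also have "\<dots> = (\<integral>\<^sup>+v. ennreal pi * (\<integral>\<^sup>+x. k (x, (cmod v)\<^sup>2) * indicator {0..} x \<partial>lborel) \<partial>lborel)"
    unfolding ind by (intro nn_integral_cong nn_integral_norm_square) measurable
  also have "\<dots> = (\<integral>\<^sup>+v. ennreal pi * (indicator {0..1 / sqrt (q\<^sup>2)} ((cmod v)\<^sup>2) * ennreal ((q\<^sup>2 - 1) * (cmod v)\<^sup>2)
       + indicator {1 / sqrt (q\<^sup>2)<..1} ((cmod v)\<^sup>2) * ennreal (1 / (cmod v)\<^sup>2 - (cmod v)\<^sup>2)) \<partial>lborel)"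
    unfolding k_def by (subst hyperbola_section_length[OF q2]) simp_all
  also have "\<dots> = ennreal pi * (\<integral>\<^sup>+y. ennreal pi * (indicator {0..1 / sqrt (q\<^sup>2)} y * ennreal ((q\<^sup>2 - 1) * y)
       + indicator {1 / sqrt (q\<^sup>2)<..1} y * ennreal (1 / y - y)) * indicator {0..} y \<partial>lborel)"
    by (rule nn_integral_norm_square) measurable
  also have "(\<integral>\<^sup>+y. ennreal pi * (indicator {0..1 / sqrt (q\<^sup>2)} y * ennreal ((q\<^sup>2 - 1) * y)
       + indicator {1 / sqrt (q\<^sup>2)<..1} y * ennreal (1 / y - y)) * indicator {0..} y \<partial>lborel)
     = (\<integral>\<^sup>+y. ennreal pi * (indicator {0..1 / sqrt (q\<^sup>2)} y * ennreal ((q\<^sup>2 - 1) * y)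
       + indicator {1 / sqrt (q\<^sup>2)<..1} y * ennreal (1 / y - y)) \<partial>lborel)"
  proof (rule nn_integral_cong)
    fix y :: real
    define s where "s = 1 / sqrt (q\<^sup>2)"
    have "s > 0" using assms by (simp add: s_def)
    hence "indicator {0..s} y = (0::ennreal) \<and> indicator {s<..1} y = (0::ennreal)" if "y < 0"
      using that by (auto simp: indicator_def)
    thus "ennreal pi * (indicator {0..1 / sqrt (q\<^sup>2)} y * ennreal ((q\<^sup>2 - 1) * y)
       + indicator {1 / sqrt (q\<^sup>2)<..1} y * ennreal (1 / y - y)) * indicator {0..} y
      = ennreal pi * (indicator {0..1 / sqrt (q\<^sup>2)} y * ennreal ((q\<^sup>2 - 1) * y)
       + indicator {1 / sqrt (q\<^sup>2)<..1} y * ennreal (1 / y - y))"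
      unfolding s_def[symmetric] by (cases "y < 0") auto
  qed
  also have "\<dots> = ennreal pi * ennreal (ln (q\<^sup>2) / 2)"
    by (subst nn_integral_cmult) (use area_integral[OF q2] in auto)
  also have "ennreal pi * (ennreal pi * ennreal (ln (q\<^sup>2) / 2)) = ennreal (pi\<^sup>2 * ln q)"
  proof -
    have "ln (q\<^sup>2) / 2 = ln q" using assms by (simp add: ln_realpow)
    thus ?thesis using assms by (simp add: power2_eq_square mult.assoc flip: ennreal_mult)
  qed
  finally show ?thesis .
qed

definition golden_conj :: real where "golden_conj = 1 - golden_ratio"

lemma golden_facts:
  "golden_ratio\<^sup>2 = golden_ratio + 1" "golden_conj\<^sup>2 = golden_conj + 1"
  "golden_ratio * golden_conj = -1" "golden_ratio + golden_conj = 1" "golden_ratio - golden_conj = sqrt 5"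
  "golden_ratio > 1" "golden_ratio < 2" "\<bar>golden_conj\<bar> < 1"
proof -
  show "golden_ratio\<^sup>2 = golden_ratio + 1"
    by (simp add: golden_ratio_def power2_eq_square field_simps)
  show "golden_conj\<^sup>2 = golden_conj + 1"
    by (simp add: golden_conj_def golden_ratio_def power2_eq_square field_simps)
  show "golden_ratio * golden_conj = -1"
    by (simp add: golden_conj_def golden_ratio_def power2_eq_square field_simps)
  show "golden_ratio + golden_conj = 1" "golden_ratio - golden_conj = sqrt 5"
    by (simp_all add: golden_conj_def golden_ratio_def field_simps)
  have "sqrt 5 < 3" by (rule real_less_lsqrt) auto
  moreover have "sqrt 5 > 1" by simp
  ultimately show "golden_ratio > 1" "golden_ratio < 2" "\<bar>golden_conj\<bar> < 1"
    by (auto simp: golden_conj_def golden_ratio_def field_simps)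
qed

text \<open>The two embeddings of \<open>d + c \<phi>\<close> over \<open>K\<close>, where \<open>(c, d)\<close> is a bottom row.\<close>

definition conj_embed :: "complex \<times> complex \<Rightarrow> complex \<times> complex" where
  "conj_embed = (\<lambda>(c, d). (d + of_real golden_ratio * c, d + of_real golden_conj * c))"

lemma conj_embed_simps [simp]: "conj_embed (c, d) = (d + of_real golden_ratio * c, d + of_real golden_conj * c)"
  by (simp add: conj_embed_def)

lemma continuous_conj_embed [continuous_intros]: "continuous_on A conj_embed"
  unfolding conj_embed_def case_prod_beta by (intro continuous_intros)

text \<open>The map is a composition of two shears with the scaling of one complex coordinate by
  \<open>\<phi> - \<phi>' = sqrt 5\<close>, which multiplies the area of a complex line by 5.\<close>

lemma emeasure_conj_embed:
  assumes H: "H \<in> sets borel"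
  shows "emeasure lborel H = 5 * emeasure lborel (conj_embed -` H)"
proof -
  have contm: "f \<in> borel_measurable borel" if "continuous_on UNIV f" for f :: "complex \<times> complex \<Rightarrow> complex \<times> complex"
    using that by (rule borel_measurable_continuous_onI)
  have Hm: "(indicator H :: _ \<Rightarrow> ennreal) \<in> borel_measurable borel" using H by simp
  have embed_m: "conj_embed \<in> borel_measurable borel" by (intro contm continuous_intros)
  have sec1: "(\<lambda>u. indicator H (u, v) :: ennreal) \<in> borel_measurable borel" for v
    by (rule measurable_compose[OF _ Hm]) (simp add: borel_prod[symmetric])
  have m2: "(\<lambda>(v, c). indicator H (v + of_real (sqrt 5) * c, v) :: ennreal) \<in> borel_measurable (lborel \<Otimes>\<^sub>M lborel)"
  proof -
    have "(\<lambda>x. indicator H (fst x + of_real (sqrt 5) * snd x, fst x) :: ennreal) \<in> borel_measurable borel"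
      by (rule measurable_compose[OF _ Hm]) (intro contm continuous_intros)
    thus ?thesis by (simp add: case_prod_beta lborel_prod)
  qed
  have sec2: "(\<lambda>v. indicator H (v + of_real (sqrt 5) * c, v) :: ennreal) \<in> borel_measurable borel" for c
    by (rule measurable_compose[OF _ Hm])
       (rule borel_measurable_continuous_onI, intro continuous_intros)
  have "emeasure lborel H = (\<integral>\<^sup>+x. indicator H x \<partial>(lborel \<Otimes>\<^sub>M lborel))"
    using H by (simp add: lborel_prod)
  also have "\<dots> = (\<integral>\<^sup>+v. \<integral>\<^sup>+u. indicator H (u, v) \<partial>lborel \<partial>lborel)"
    by (rule lborel_pair.nn_integral_snd[symmetric]) (use H in \<open>simp add: lborel_prod\<close>)
  also have "\<dots> = (\<integral>\<^sup>+v. 5 * (\<integral>\<^sup>+c. indicator H (v + of_real (sqrt 5) * c, v) \<partial>lborel) \<partial>lborel)"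
    using nn_integral_complex_affine[OF sec1, of "sqrt 5"] by simp
  also have "\<dots> = 5 * (\<integral>\<^sup>+v. \<integral>\<^sup>+c. indicator H (v + of_real (sqrt 5) * c, v) \<partial>lborel \<partial>lborel)"
    using m2 by (intro nn_integral_cmult lborel.borel_measurable_nn_integral) auto
  also have "(\<integral>\<^sup>+v. \<integral>\<^sup>+c. indicator H (v + of_real (sqrt 5) * c, v) \<partial>lborel \<partial>lborel)
     = (\<integral>\<^sup>+c. \<integral>\<^sup>+v. indicator H (v + of_real (sqrt 5) * c, v) \<partial>lborel \<partial>lborel)"
    by (rule lborel_pair.Fubini'[symmetric]) (rule m2)
  also have "\<dots> = (\<integral>\<^sup>+c. \<integral>\<^sup>+d. indicator (conj_embed -` H) (c, d) \<partial>lborel \<partial>lborel)"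
  proof (rule nn_integral_cong)
    fix c :: complex
    have shift: "of_real golden_conj * c + d + of_real (sqrt 5) * c = d + of_real golden_ratio * c" for d
      unfolding golden_facts(5)[symmetric] by (simp add: algebra_simps)
    have "(\<integral>\<^sup>+v. indicator H (v + of_real (sqrt 5) * c, v) \<partial>lborel)
      = (\<integral>\<^sup>+d. indicator H (of_real golden_conj * c + d + of_real (sqrt 5) * c, of_real golden_conj * c + d) \<partial>lborel)"
      using nn_integral_complex_affine[OF sec2, of 1 c "of_real golden_conj * c"] by simp
    also have "\<dots> = (\<integral>\<^sup>+d. indicator (conj_embed -` H) (c, d) \<partial>lborel)"
      unfolding shift by (intro nn_integral_cong) (simp add: indicator_def add.commute)
    finally show "(\<integral>\<^sup>+v. indicator H (v + of_real (sqrt 5) * c, v) \<partial>lborel) = (\<integral>\<^sup>+d. indicator (conj_embed -` H) (c, d) \<partial>lborel)" .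
  qed
  also have "\<dots> = (\<integral>\<^sup>+x. indicator (conj_embed -` H) x \<partial>(lborel \<Otimes>\<^sub>M lborel))"
    using measurable_sets[OF embed_m H] by (intro lborel.nn_integral_fst) (simp add: lborel_prod)
  also have "\<dots> = emeasure lborel (conj_embed -` H)"
    using measurable_sets[OF embed_m H] by (simp add: lborel_prod)
  finally show ?thesis .
qed

text \<open>All sections with fixed \<open>v\<close> lie on circles.\<close>

lemma circle_family_null:
  assumes H: "H \<in> sets borel" and circ: "\<And>u v. (u, v) \<in> H \<Longrightarrow> cmod u = \<rho> v"
  shows "emeasure lborel (conj_embed -` H :: (complex \<times> complex) set) = 0"
proof -
  have sph: "emeasure lborel (sphere 0 r :: complex set) = 0" for r
  proof -
    have "sphere 0 r \<in> null_sets (lebesgue :: complex measure)"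
      using negligible_sphere[of "0::complex" r] negligible_iff_null_sets by blast
    hence "emeasure lebesgue (sphere 0 r :: complex set) = 0" by auto
    thus ?thesis by simp
  qed
  have "emeasure lborel H = (\<integral>\<^sup>+x. indicator H x \<partial>(lborel \<Otimes>\<^sub>M lborel))"
    using H by (simp add: lborel_prod)
  also have "\<dots> = (\<integral>\<^sup>+v. \<integral>\<^sup>+u. indicator H (u, v) \<partial>lborel \<partial>lborel)"
    by (rule lborel_pair.nn_integral_snd[symmetric]) (use H in \<open>simp add: lborel_prod\<close>)
  also have "\<dots> \<le> (\<integral>\<^sup>+v. \<integral>\<^sup>+u. indicator (sphere 0 (\<rho> v)) u \<partial>(lborel :: complex measure) \<partial>lborel)"
    using circ by (intro nn_integral_mono) (auto simp: indicator_def)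
  also have "\<dots> = 0" by (simp add: sph)
  finally have "emeasure lborel H = 0" by simp
  thus ?thesis using emeasure_conj_embed[OF H] by simp
qed

definition fundamental_region :: "real \<Rightarrow> (complex \<times> complex) set" where
  "fundamental_region q = conj_embed -` hyperbolic_region q"

lemma fundamental_region_sets: "fundamental_region q \<in> sets borel"
  using measurable_sets[OF borel_measurable_continuous_onI[OF continuous_conj_embed] hyperbolic_region_sets]
  by (simp add: fundamental_region_def)

lemma measure_fundamental_region:
  assumes "q > 1"
  shows "measure lborel (fundamental_region q) = pi\<^sup>2 * ln q / 5"
proof -
  have "5 * emeasure lborel (fundamental_region q) = ennreal (pi\<^sup>2 * ln q)"
    using emeasure_conj_embed[OF hyperbolic_region_sets, of q] emeasure_hyperbolic_region[OF assms]
    by (simp add: fundamental_region_def)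
  hence "enn2real (5 * emeasure lborel (fundamental_region q)) = pi\<^sup>2 * ln q" using assms by simp
  thus ?thesis by (simp add: enn2real_mult measure_def)
qed

lemma bounded_fundamental_region:
  assumes "q > 1"
  shows "bounded (fundamental_region q)"
proof (rule boundedI)
  fix x assume "x \<in> fundamental_region q"
  then obtain c d where x: "x = (c, d)" and "conj_embed (c, d) \<in> hyperbolic_region q"
    by (cases x) (auto simp: fundamental_region_def)
  define u v where "u = d + of_real golden_ratio * c" and "v = d + of_real golden_conj * c"
  have uv: "cmod v \<le> cmod u" "cmod u < q * cmod v" "cmod u * cmod v \<le> 1"
    using \<open>conj_embed (c, d) \<in> _\<close> by (auto simp: hyperbolic_region_def u_def v_def)
  have u: "cmod u \<le> q"
  proof -
    have "cmod u * cmod u \<le> cmod u * (q * cmod v)" using uv(2) by (intro mult_left_mono) auto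
    also have "\<dots> = q * (cmod u * cmod v)" by simp
    also have "\<dots> \<le> q * 1" using uv(3) assms by (intro mult_left_mono) auto
    also have "\<dots> \<le> q * q" using assms by (intro mult_left_mono) auto
    finally have "(cmod u)\<^sup>2 \<le> q\<^sup>2" by (simp add: power2_eq_square)
    thus ?thesis by (rule power2_le_imp_le) (use assms in simp)
  qed
  have "u - v = of_real (sqrt 5) * c"
    unfolding golden_facts(5)[symmetric] by (simp add: u_def v_def algebra_simps)
  hence "sqrt 5 * cmod c = cmod (u - v)" by (simp add: norm_mult)
  also have "\<dots> \<le> cmod u + cmod v" by (rule norm_triangle_ineq4)
  finally have "sqrt 5 * cmod c \<le> 2 * q" using u uv(1) by linarith
  moreover have "1 * cmod c \<le> sqrt 5 * cmod c" by (intro mult_right_mono) auto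
  ultimately have c: "cmod c \<le> 2 * q" by linarith
  have "cmod d = cmod (u - of_real golden_ratio * c)" by (simp add: u_def)
  also have "\<dots> \<le> cmod u + golden_ratio * cmod c"
    using norm_triangle_ineq4[of u "of_real golden_ratio * c"] golden_facts(6) by (simp add: norm_mult)
  also have "\<dots> \<le> q + 2 * (2 * q)" using u c golden_facts(6,7) by (intro add_mono mult_mono) auto
  finally have "cmod d \<le> 5 * q" by simp
  hence "norm x \<le> 2 * q + 5 * q" using norm_Pair_le[of c d] c x by simp
  thus "norm x \<le> 7 * q" by simp
qed

text \<open>A boundary point must satisfy one of the three defining inequalities with equality, and each
  equality prescribes \<open>|u|\<close> in terms of \<open>v\<close>.\<close>

lemma frontier_fundamental_region: "AE x in lborel. x \<notin> frontier (fundamental_region q)"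
proof -
  define U V where "U = (\<lambda>x. cmod (fst (conj_embed x)))" and "V = (\<lambda>x. cmod (snd (conj_embed x)))"
  have cont: "continuous_on UNIV U" "continuous_on UNIV V"
    unfolding U_def V_def by (intro continuous_intros)+
  define H1 H2 H3 :: "(complex \<times> complex) set"
    where "H1 = {x. cmod (fst x) = cmod (snd x)}" and "H2 = {x. cmod (fst x) = q * cmod (snd x)}"
      and "H3 = {x. cmod (fst x) * cmod (snd x) = 1}"
  have sets: "H1 \<in> sets borel" "H2 \<in> sets borel" "H3 \<in> sets borel"
    unfolding H1_def H2_def H3_def by (intro borel_closed closed_Collect_eq continuous_intros)+
  have null: "emeasure lborel (conj_embed -` H1) = 0" "emeasure lborel (conj_embed -` H2) = 0" "emeasure lborel (conj_embed -` H3) = 0"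
    by (rule circle_family_null[OF sets(1), of "\<lambda>v. cmod v"], simp add: H1_def)
       (rule circle_family_null[OF sets(2), of "\<lambda>v. q * cmod v"], simp add: H2_def,
        rule circle_family_null[OF sets(3), of "\<lambda>v. 1 / cmod v"], auto simp: H3_def eq_divide_eq)
  have es: "conj_embed -` H \<in> sets borel" if "H \<in> sets borel" for H
    using measurable_sets[OF borel_measurable_continuous_onI[OF continuous_conj_embed] that] by simp
  have "conj_embed -` H1 \<in> null_sets lborel" "conj_embed -` H2 \<in> null_sets lborel" "conj_embed -` H3 \<in> null_sets lborel"
    by (rule null_setsI[OF null(1)], simp add: es sets, rule null_setsI[OF null(2)], simp add: es sets,
        rule null_setsI[OF null(3)], simp add: es sets)
  hence N: "conj_embed -` H1 \<union> conj_embed -` H2 \<union> conj_embed -` H3 \<in> null_sets lborel" by auto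
  have sub: "frontier (fundamental_region q) \<subseteq> conj_embed -` H1 \<union> conj_embed -` H2 \<union> conj_embed -` H3"
  proof
    fix x assume x: "x \<in> frontier (fundamental_region q)"
    have mem: "y \<in> fundamental_region q \<longleftrightarrow> V y \<le> U y \<and> U y < q * V y \<and> U y * V y \<le> 1" for y
      by (cases "conj_embed y") (auto simp: fundamental_region_def hyperbolic_region_def U_def V_def)
    define A where "A = {y. V y < U y} \<inter> {y. U y < q * V y} \<inter> {y. U y * V y < 1}"
    define B where "B = {y. U y < V y} \<union> {y. q * V y < U y} \<union> {y. 1 < U y * V y}"
    have "open A" "open B" unfolding A_def B_def
      by (intro open_Int open_Un open_Collect_less continuous_intros cont)+
    have "A \<subseteq> fundamental_region q" using mem by (auto simp: A_def)
    hence "A \<subseteq> interior (fundamental_region q)" using \<open>open A\<close> by (rule interior_maximal)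
    hence "x \<notin> A" using x unfolding frontier_def by blast
    moreover have "fundamental_region q \<subseteq> - B" using mem by (auto simp: B_def)
    hence "closure (fundamental_region q) \<subseteq> - B" using \<open>open B\<close> by (intro closure_minimal) auto
    hence "x \<notin> B" using x by (auto simp: frontier_def)
    ultimately have "U x = V x \<or> U x = q * V x \<or> U x * V x = 1" by (auto simp: A_def B_def)
    thus "x \<in> conj_embed -` H1 \<union> conj_embed -` H2 \<union> conj_embed -` H3" by (auto simp: U_def V_def H1_def H2_def H3_def)
  qed
  show ?thesis using AE_not_in[OF N] by eventually_elim (use sub in blast)
qed

lemma zero_notin_fundamental_region: "0 \<notin> fundamental_region q"
  by (simp add: fundamental_region_def hyperbolic_region_def zero_prod_def)

section \<open>The sieve by maximal ideals\<close>

context imag_quad_ring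
begin

definition maximal_ideal :: "complex set \<Rightarrow> bool" where
  "maximal_ideal P \<longleftrightarrow> nonzero_ideal P \<and> P \<noteq> R \<and> (\<forall>J. nonzero_ideal J \<longrightarrow> P \<subseteq> J \<longrightarrow> J = P \<or> J = R)"

definition maximal_above :: "complex set \<Rightarrow> complex set set" where
  "maximal_above J = {P. maximal_ideal P \<and> J \<subseteq> P}"

text \<open>The Moebius function of the lattice of ideals. The first case singles out the finite
  intersections of maximal ideals, that is, the squarefree ideals; since the sign is read off
  from the maximal ideals above \<open>J\<close>, no factorization into primes is involved.\<close>

definition ideal_mu :: "complex set \<Rightarrow> real" where
  "ideal_mu J = (if J = R \<inter> \<Inter> (maximal_above J) then (-1) ^ card (maximal_above J) else 0)"

definition pair_ideal :: "complex \<times> complex \<Rightarrow> complex set" where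
  "pair_ideal p = {x * fst p + y * snd p | x y. x \<in> R \<and> y \<in> R}"

definition unimodular :: "complex \<times> complex \<Rightarrow> bool" where
  "unimodular p \<longleftrightarrow> (\<exists>a\<in>R. \<exists>b\<in>R. a * snd p - b * fst p = 1)"

lemma abs_ideal_mu_le: "\<bar>ideal_mu J\<bar> \<le> 1" by (simp add: ideal_mu_def power_abs)

lemma finite_maximal_above: "nonzero_ideal L \<Longrightarrow> finite (maximal_above L)"
  by (rule finite_subset[OF _ finite_nonzero_ideal_above]) (auto simp: maximal_above_def maximal_ideal_def)

lemma maximal_ideal_prime:
  assumes Q: "maximal_ideal Q" and p: "p \<in> R" "x \<in> R" "p * x \<in> Q" "p \<notin> Q"
  shows "x \<in> Q"
proof -
  have iQ: "nonzero_ideal Q" using Q by (simp add: maximal_ideal_def)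
  note q = nonzero_idealD[OF iQ]
  define J where "J = {y + p * r | y r. y \<in> Q \<and> r \<in> R}"
  have J1: "y + p * r \<in> J" if "y \<in> Q" "r \<in> R" for y r using that unfolding J_def by blast
  have sub: "Q \<subseteq> J" using J1[OF _ R_0] by auto
  have pJ: "p \<in> J" using J1[OF q(8) R_1] by simp
  have "nonzero_ideal J" unfolding nonzero_ideal_def
  proof (intro conjI ballI)
    show "J \<subseteq> R" unfolding J_def using q(2) p(1) by auto
    show "\<exists>x\<in>J. x \<noteq> 0" using sub q(9) by blast
    show "a + b \<in> J" if ab: "a \<in> J" "b \<in> J" for a b
    proof -
      obtain y r where 1: "a = y + p * r" "y \<in> Q" "r \<in> R" using ab(1) J_def by blast
      obtain z s where 2: "b = z + p * s" "z \<in> Q" "s \<in> R" using ab(2) J_def by blast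
      have "a + b = (y + z) + p * (r + s)" unfolding 1 2 by (simp add: algebra_simps)
      thus ?thesis using J1[OF q(3)[OF 1(2) 2(2)] R_add[OF 1(3) 2(3)]] by simp
    qed
    show "t * a \<in> J" if ta: "t \<in> R" "a \<in> J" for t a
    proof -
      obtain y r where 1: "a = y + p * r" "y \<in> Q" "r \<in> R" using ta(2) J_def by blast
      have "t * a = t * y + p * (t * r)" unfolding 1 by (simp add: algebra_simps)
      thus ?thesis using J1[OF q(4)[OF ta(1) 1(2)] R_mult[OF ta(1) 1(3)]] by simp
    qed
  qed
  hence "J = R" using Q sub pJ p(4) unfolding maximal_ideal_def by blast
  hence "1 \<in> J" by simp
  then obtain y r where yr: "1 = y + p * r" "y \<in> Q" "r \<in> R" using J_def by blast
  have "x = x * (y + p * r)" unfolding yr(1)[symmetric] by simp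
  also have "\<dots> = x * y + r * (p * x)" by (simp add: algebra_simps)
  finally show ?thesis using q(3)[OF q(4)[OF p(2) yr(2)] q(4)[OF yr(3) p(3)]] by simp
qed

lemma nonzero_ideal_rad: assumes "finite S" "\<And>P. P \<in> S \<Longrightarrow> maximal_ideal P" shows "nonzero_ideal (R \<inter> \<Inter> S)"
  using assms
proof (induction S rule: finite_induct)
  case (insert P S)
  have "R \<inter> \<Inter> (insert P S) = P \<inter> (R \<inter> \<Inter> S)" by auto
  thus ?case using insert by (simp add: nonzero_ideal_Int maximal_ideal_def)
qed (simp add: nonzero_ideal_R)

text \<open>Distinct sets of maximal ideals have distinct intersections.\<close>

lemma prime_avoidance:
  assumes "finite S" "\<And>P. P \<in> S \<Longrightarrow> maximal_ideal P" "maximal_ideal Q" "R \<inter> \<Inter> S \<subseteq> Q"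
  shows "Q \<in> S"
  using assms
proof (induction S rule: finite_induct)
  case empty
  hence "Q = R" using nonzero_idealD(1)[of Q] by (auto simp: maximal_ideal_def)
  thus ?case using empty by (simp add: maximal_ideal_def)
next
  case (insert P S)
  show ?case
  proof (cases "P = Q")
    case False
    have "maximal_ideal P" using insert.prems by simp
    hence "\<not> P \<subseteq> Q" using insert.prems(2) False unfolding maximal_ideal_def by metis
    then obtain p where p: "p \<in> P" "p \<notin> Q" by blast
    have iP: "nonzero_ideal P" using \<open>maximal_ideal P\<close> by (simp add: maximal_ideal_def)
    have iS: "nonzero_ideal (R \<inter> \<Inter> S)" using insert by (intro nonzero_ideal_rad) auto
    have "R \<inter> \<Inter> S \<subseteq> Q"
    proof
      fix x assume x: "x \<in> R \<inter> \<Inter> S"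
      have "p * x \<in> P" using nonzero_idealD(5)[OF iP _ p(1)] x by blast
      moreover have "p * x \<in> R \<inter> \<Inter> S" using nonzero_idealD(4)[OF iS _ x] nonzero_idealD(2)[OF iP p(1)] by blast
      ultimately have "p * x \<in> Q" using insert.prems(3) by auto
      thus "x \<in> Q" using maximal_ideal_prime[OF insert.prems(2)] nonzero_idealD(2)[OF iP p(1)] x p(2) by blast
    qed
    thus ?thesis using insert by simp
  qed simp
qed

lemma maximal_above_rad: assumes "finite S" "\<And>P. P \<in> S \<Longrightarrow> maximal_ideal P" shows "maximal_above (R \<inter> \<Inter> S) = S"
  using prime_avoidance[OF assms] assms(2) by (auto simp: maximal_above_def)

lemma maximal_above_nonempty: assumes "nonzero_ideal L" "L \<noteq> R" shows "maximal_above L \<noteq> {}"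
proof -
  let ?A = "{J. nonzero_ideal J \<and> L \<subseteq> J \<and> J \<noteq> R}"
  obtain P where P: "P \<in> ?A" "\<And>J. J \<in> ?A \<Longrightarrow> ideal_norm P \<le> ideal_norm J"
    using ex_has_least_nat[of "\<lambda>J. J \<in> ?A" L ideal_norm] assms by blast
  have "maximal_ideal P" unfolding maximal_ideal_def
  proof (intro conjI allI impI)
    fix J assume J: "nonzero_ideal J" "P \<subseteq> J"
    show "J = P \<or> J = R"
    proof (rule disjCI)
      assume "J \<noteq> R"
      hence "ideal_norm P \<le> ideal_norm J" using P J by blast
      moreover have "ideal_norm J \<le> ideal_norm P" using ideal_norm_mono J P by blast
      ultimately have "ideal_norm P = ideal_norm J" by simp
      thus "J = P" using ideal_norm_eq_subset[of P J] J P by blast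
    qed
  qed (use P in auto)
  thus ?thesis using P by (auto simp: maximal_above_def)
qed

lemma sum_Pow_sign: "finite F \<Longrightarrow> (\<Sum>S\<in>Pow F. (-1) ^ card S :: real) = (if F = {} then 1 else 0)"
proof (induction F rule: finite_induct)
  case (insert x F)
  have inj: "inj_on (insert x) (Pow F)" using insert.hyps(2) by (intro inj_onI) (metis Pow_iff insert_ident subsetD)
  have "(\<Sum>S\<in>Pow (insert x F). (-1) ^ card S :: real)
     = (\<Sum>S\<in>Pow F. (-1) ^ card S) + (\<Sum>S\<in>insert x ` Pow F. (-1) ^ card S)"
    unfolding Pow_insert using insert.hyps by (intro sum.union_disjoint) auto
  also have "(\<Sum>S\<in>insert x ` Pow F. (-1) ^ card S :: real) = (\<Sum>S\<in>Pow F. (-1) ^ card (insert x S))"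
    by (subst sum.reindex[OF inj]) simp
  also have "\<dots> = (\<Sum>S\<in>Pow F. - ((-1) ^ card S))"
  proof (rule sum.cong)
    fix S assume "S \<in> Pow F"
    hence "x \<notin> S" "finite S" using insert.hyps finite_subset by auto
    thus "(-1) ^ card (insert x S) = - ((-1) ^ card S :: real)" by simp
  qed simp
  finally show ?case by (simp add: sum_negf)
qed simp

text \<open>The ideals above \<open>L\<close> with nonzero sign correspond to the subsets of the finite set of maximal
  ideals above \<open>L\<close>, so this is an alternating sum over a power set.\<close>

lemma sum_ideal_mu:
  assumes L: "nonzero_ideal L"
  shows "(\<Sum>J\<in>{J. nonzero_ideal J \<and> L \<subseteq> J}. ideal_mu J) = (if L = R then 1 else 0)"
proof -
  define rad where "rad S = R \<inter> \<Inter> S" for S :: "complex set set"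
  have fin: "finite (maximal_above L)" by (rule finite_maximal_above[OF L])
  have S: "finite S" "\<And>P. P \<in> S \<Longrightarrow> maximal_ideal P" if "S \<in> Pow (maximal_above L)" for S
    using that fin finite_subset by (auto simp: maximal_above_def)
  have inj: "inj_on rad (Pow (maximal_above L))"
    using maximal_above_rad S unfolding rad_def by (intro inj_onI) metis
  have "(\<Sum>J\<in>{J. nonzero_ideal J \<and> L \<subseteq> J}. ideal_mu J) = (\<Sum>J\<in>rad ` Pow (maximal_above L). ideal_mu J)"
  proof (rule sum.mono_neutral_right)
    show "finite {J. nonzero_ideal J \<and> L \<subseteq> J}" by (rule finite_nonzero_ideal_above[OF L])
    show "rad ` Pow (maximal_above L) \<subseteq> {J. nonzero_ideal J \<and> L \<subseteq> J}"
    proof (rule image_subsetI)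
      fix S' assume a: "S' \<in> Pow (maximal_above L)"
      have "nonzero_ideal (rad S')" unfolding rad_def by (rule nonzero_ideal_rad[OF S(1)[OF a] S(2)[OF a]])
      moreover have "L \<subseteq> rad S'" using a nonzero_idealD(1)[OF L] unfolding rad_def maximal_above_def by blast
      ultimately show "rad S' \<in> {J. nonzero_ideal J \<and> L \<subseteq> J}" by blast
    qed
    show "\<forall>J\<in>{J. nonzero_ideal J \<and> L \<subseteq> J} - rad ` Pow (maximal_above L). ideal_mu J = 0"
    proof
      fix J assume J: "J \<in> {J. nonzero_ideal J \<and> L \<subseteq> J} - rad ` Pow (maximal_above L)"
      have "maximal_above J \<in> Pow (maximal_above L)" using J by (auto simp: maximal_above_def)
      hence "J \<noteq> rad (maximal_above J)" using J by blast
      thus "ideal_mu J = 0" by (simp add: ideal_mu_def rad_def)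
    qed
  qed
  also have "\<dots> = (\<Sum>S\<in>Pow (maximal_above L). ideal_mu (rad S))" by (simp add: sum.reindex[OF inj])
  also have "\<dots> = (\<Sum>S\<in>Pow (maximal_above L). (-1) ^ card S)"
    by (rule sum.cong) (use maximal_above_rad S in \<open>auto simp: ideal_mu_def rad_def\<close>)
  also have "\<dots> = (if maximal_above L = {} then 1 else 0)" by (rule sum_Pow_sign[OF fin])
  also have "maximal_above L = {} \<longleftrightarrow> L = R"
  proof -
    have "maximal_above R = {}" unfolding maximal_above_def maximal_ideal_def using nonzero_idealD(1) by blast
    thus ?thesis using maximal_above_nonempty[OF L] by metis
  qed
  finally show ?thesis .
qed

text \<open>For fixed \<open>J\<close> the products \<open>L = I J\<close> run through the ideals contained in \<open>J\<close>, and norms are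
  multiplicative; regrouping the double series by \<open>L\<close> leaves for each \<open>L\<close> the sum of the signs
  above it, which vanishes unless \<open>L = R\<close>.\<close>

lemma infsum_ideal_mu_zeta:
  "(\<Sum>\<^sub>\<infinity>J\<in>{J. nonzero_ideal J}. ideal_mu J / (real (ideal_norm J))\<^sup>2) * (\<Sum>\<^sub>\<infinity>I\<in>{I. nonzero_ideal I}. 1 / (real (ideal_norm I))\<^sup>2) = 1"
proof -
  define Id where "Id = {J. nonzero_ideal J}"
  define Z where "Z = (\<Sum>\<^sub>\<infinity>I\<in>Id. 1 / (real (ideal_norm I))\<^sup>2)"
  define F where "F J L = (if L \<subseteq> J then 1 / (real (ideal_norm L))\<^sup>2 else 0)" for J L
  have sumZ: "((\<lambda>I. 1 / (real (ideal_norm I))\<^sup>2) has_sum Z) Id"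
    unfolding Z_def Id_def by (rule has_sum_infsum[OF summable_ideal_norm])
  have FJ: "(F J has_sum (1 / (real (ideal_norm J))\<^sup>2 * Z)) Id" if J: "J \<in> Id" for J
  proof -
    have iJ: "nonzero_ideal J" using J by (simp add: Id_def)
    have "((\<lambda>I. 1 / (real (ideal_norm J))\<^sup>2 * (1 / (real (ideal_norm I))\<^sup>2)) has_sum (1 / (real (ideal_norm J))\<^sup>2 * Z)) Id"
      by (rule has_sum_cmult_right[OF sumZ])
    hence "((\<lambda>L. 1 / (real (ideal_norm J))\<^sup>2 * (1 / (real (ideal_norm (colon L J)))\<^sup>2)) has_sum (1 / (real (ideal_norm J))\<^sup>2 * Z)) {L. nonzero_ideal L \<and> L \<subseteq> J}"
      unfolding Id_def
      using has_sum_reindex_bij_betw[OF bij_betw_colon[OF iJ], of "\<lambda>I. 1 / (real (ideal_norm J))\<^sup>2 * (1 / (real (ideal_norm I))\<^sup>2)"] by simp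
    also have "?this \<longleftrightarrow> (F J has_sum (1 / (real (ideal_norm J))\<^sup>2 * Z)) Id"
      by (rule has_sum_cong_neutral) (use ideal_norm_colon[OF iJ] in \<open>auto simp: F_def Id_def power_mult_distrib\<close>)
    finally show ?thesis .
  qed
  have F0: "F J L \<ge> 0" for J L by (simp add: F_def)
  have sumF: "(\<lambda>(J, L). F J L) summable_on Id \<times> Id"
  proof (rule summable_on_SigmaI)
    show "((\<lambda>L. (case (J, L) of (J, L) \<Rightarrow> F J L)) has_sum (1 / (real (ideal_norm J))\<^sup>2 * Z)) Id" if "J \<in> Id" for J
      using FJ[OF that] by simp
    show "(\<lambda>J. 1 / (real (ideal_norm J))\<^sup>2 * Z) summable_on Id"
      unfolding Id_def by (rule summable_on_cmult_left[OF summable_ideal_norm])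
  qed (simp add: F0)
  have summF: "(\<lambda>(J, L). ideal_mu J * F J L) summable_on Id \<times> Id"
  proof (rule abs_summable_summable, rule summable_on_comparison_test[OF sumF])
    show "norm (case p of (J, L) \<Rightarrow> ideal_mu J * F J L) \<le> (case p of (J, L) \<Rightarrow> F J L)" for p
      using abs_ideal_mu_le F0 by (cases p) (simp add: abs_mult mult_left_le_one_le)
  qed simp
  have "(\<Sum>\<^sub>\<infinity>J\<in>Id. \<Sum>\<^sub>\<infinity>L\<in>Id. ideal_mu J * F J L) = (\<Sum>\<^sub>\<infinity>L\<in>Id. \<Sum>\<^sub>\<infinity>J\<in>Id. ideal_mu J * F J L)"
    by (rule infsum_swap_banach[OF summF])
  also have "\<dots> = (\<Sum>\<^sub>\<infinity>L\<in>Id. if L = R then 1 else 0)"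
  proof (rule infsum_cong)
    fix L assume "L \<in> Id"
    hence L: "nonzero_ideal L" by (simp add: Id_def)
    have "(\<Sum>\<^sub>\<infinity>J\<in>Id. ideal_mu J * F J L) = (\<Sum>\<^sub>\<infinity>J\<in>{J. nonzero_ideal J \<and> L \<subseteq> J}. ideal_mu J * (1 / (real (ideal_norm L))\<^sup>2))"
      by (rule infsum_cong_neutral) (auto simp: Id_def F_def)
    also have "\<dots> = (\<Sum>J\<in>{J. nonzero_ideal J \<and> L \<subseteq> J}. ideal_mu J * (1 / (real (ideal_norm L))\<^sup>2))"
      by (rule infsum_finite[OF finite_nonzero_ideal_above[OF L]])
    also have "\<dots> = (if L = R then 1 else 0) * (1 / (real (ideal_norm L))\<^sup>2)"
      unfolding sum_distrib_right[symmetric] sum_ideal_mu[OF L] ..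
    also have "\<dots> = (if L = R then 1 else 0)"
    proof -
      have "coset R x = coset R 0" if "x \<in> R" for x using coset_eq_iff[OF nonzero_ideal_R] that by simp
      hence "coset R ` R = {coset R 0}" using R_0 by blast
      hence "ideal_norm R = 1" by (simp add: ideal_norm_def)
      thus ?thesis by simp
    qed
    finally show "(\<Sum>\<^sub>\<infinity>J\<in>Id. ideal_mu J * F J L) = (if L = R then 1 else 0)" .
  qed
  also have "\<dots> = (\<Sum>\<^sub>\<infinity>L\<in>{R}. 1)"
    by (rule infsum_cong_neutral) (auto simp: Id_def nonzero_ideal_R)
  also have "\<dots> = 1" by simp
  finally have 1: "(\<Sum>\<^sub>\<infinity>J\<in>Id. \<Sum>\<^sub>\<infinity>L\<in>Id. ideal_mu J * F J L) = 1" .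
  have "(\<Sum>\<^sub>\<infinity>J\<in>Id. \<Sum>\<^sub>\<infinity>L\<in>Id. ideal_mu J * F J L) = (\<Sum>\<^sub>\<infinity>J\<in>Id. ideal_mu J / (real (ideal_norm J))\<^sup>2 * Z)"
  proof (rule infsum_cong)
    fix J assume J: "J \<in> Id"
    show "(\<Sum>\<^sub>\<infinity>L\<in>Id. ideal_mu J * F J L) = ideal_mu J / (real (ideal_norm J))\<^sup>2 * Z"
      using infsumI[OF has_sum_cmult_right[OF FJ[OF J], of "ideal_mu J"]] by simp
  qed
  also have "\<dots> = (\<Sum>\<^sub>\<infinity>J\<in>Id. ideal_mu J / (real (ideal_norm J))\<^sup>2) * Z" by (rule infsum_cmult_left')
  finally show ?thesis using 1 by (simp add: Id_def Z_def)
qed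

lemma nonzero_ideal_pair_ideal: assumes "p \<in> R \<times> R" "p \<noteq> 0" shows "nonzero_ideal (pair_ideal p)"
proof -
  obtain c d where p: "p = (c, d)" "c \<in> R" "d \<in> R" using assms(1) by auto
  have mem: "x * c + y * d \<in> pair_ideal p" if "x \<in> R" "y \<in> R" for x y using that p by (auto simp: pair_ideal_def)
  show ?thesis unfolding nonzero_ideal_def
  proof (intro conjI ballI)
    show "pair_ideal p \<subseteq> R" using p by (auto simp: pair_ideal_def)
    have "c \<in> pair_ideal p" "d \<in> pair_ideal p" using mem[OF R_1 R_0] mem[OF R_0 R_1] by simp_all
    moreover have "c \<noteq> 0 \<or> d \<noteq> 0" using assms(2) p(1) by (auto simp: zero_prod_def)
    ultimately show "\<exists>x\<in>pair_ideal p. x \<noteq> 0" by blast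
    show "a + b \<in> pair_ideal p" if ab: "a \<in> pair_ideal p" "b \<in> pair_ideal p" for a b
    proof -
      obtain x y where 1: "a = x * c + y * d" "x \<in> R" "y \<in> R" using ab(1) p by (auto simp: pair_ideal_def)
      obtain z u where 2: "b = z * c + u * d" "z \<in> R" "u \<in> R" using ab(2) p by (auto simp: pair_ideal_def)
      have "a + b = (x + z) * c + (y + u) * d" unfolding 1 2 by (simp add: algebra_simps)
      thus ?thesis using mem[OF R_add[OF 1(2) 2(2)] R_add[OF 1(3) 2(3)]] by simp
    qed
    show "r * a \<in> pair_ideal p" if ra: "r \<in> R" "a \<in> pair_ideal p" for r a
    proof -
      obtain x y where 1: "a = x * c + y * d" "x \<in> R" "y \<in> R" using ra(2) p by (auto simp: pair_ideal_def)
      have "r * a = (r * x) * c + (r * y) * d" unfolding 1 by (simp add: algebra_simps)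
      thus ?thesis using mem[OF R_mult[OF ra(1) 1(2)] R_mult[OF ra(1) 1(3)]] by simp
    qed
  qed
qed

lemma pair_ideal_subset_iff: assumes "nonzero_ideal J" shows "pair_ideal p \<subseteq> J \<longleftrightarrow> p \<in> J \<times> J"
proof
  assume a: "pair_ideal p \<subseteq> J"
  have "1 * fst p + 0 * snd p \<in> pair_ideal p" "0 * fst p + 1 * snd p \<in> pair_ideal p" unfolding pair_ideal_def using R_0 R_1 by blast+
  thus "p \<in> J \<times> J" using a by (cases p) auto
next
  assume "p \<in> J \<times> J"
  thus "pair_ideal p \<subseteq> J" using nonzero_idealD(3,4)[OF assms] by (auto simp: pair_ideal_def)
qed

lemma unimodular_iff: assumes "p \<in> R \<times> R" "p \<noteq> 0" shows "unimodular p \<longleftrightarrow> pair_ideal p = R"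
proof
  assume "unimodular p"
  then obtain a b where ab: "a \<in> R" "b \<in> R" "a * snd p - b * fst p = 1" by (auto simp: unimodular_def)
  have "(- b) * fst p + a * snd p \<in> pair_ideal p" unfolding pair_ideal_def using ab(1) R_uminus[OF ab(2)] by blast
  hence "1 \<in> pair_ideal p" using ab(3) by (simp add: algebra_simps)
  thus "pair_ideal p = R" by (rule nonzero_ideal_eq_R[OF nonzero_ideal_pair_ideal[OF assms]])
next
  assume "pair_ideal p = R"
  hence "1 \<in> pair_ideal p" by simp
  then obtain x y where xy: "x \<in> R" "y \<in> R" "1 = x * fst p + y * snd p" by (auto simp: pair_ideal_def)
  have "y * snd p - (- x) * fst p = 1" using xy(3) by (simp add: algebra_simps)
  thus "unimodular p" unfolding unimodular_def using xy(2) R_uminus[OF xy(1)] by blast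
qed

text \<open>The Hermite normal form, with the area of the cell in terms of the norm.\<close>

lemma ideal_plane_lattice:
  assumes "nonzero_ideal J"
  obtains a v where "a > 0" "Im v > 0" "J = plane_lattice a v" "a * Im v = real (ideal_norm J) * Im w"
proof -
  obtain a b c where h: "hermite_form J a b c" using ex_hermite_form[OF assms] by blast
  have ac: "a > 0" "c > 0" and J: "J = {of_int c * (of_int m * of_int a + of_int n * (of_int b + w)) | m n. True}"
    using h by (auto simp: hermite_form_def)
  show ?thesis
  proof (rule that)
    show "of_int (c * a) > (0::real)" using ac by simp
    show "Im (of_int c * (of_int b + w)) > 0" using ac Im_w by simp
    show "J = plane_lattice (of_int (c * a)) (of_int c * (of_int b + w))"
      unfolding J plane_lattice_def by (simp add: algebra_simps)
    have "real (ideal_norm J) = of_int (c * c * a)" using ideal_norm_hermite_form[OF assms h] by (metis of_int_of_nat_eq)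
    thus "of_int (c * a) * Im (of_int c * (of_int b + w)) = real (ideal_norm J) * Im w" by simp
  qed
qed

text \<open>Distinct points of \<open>J\<close> are at distance at least \<open>sqrt (N(J))\<close>, so a square of half that side
  contains at most one of them.\<close>

lemma card_ideal_disc:
  assumes J: "nonzero_ideal J" and \<rho>: "\<rho> \<ge> sqrt (real (ideal_norm J))"
  shows "finite {x \<in> J. cmod x \<le> \<rho>}" "real (card {x \<in> J. cmod x \<le> \<rho>}) \<le> 64 * \<rho>\<^sup>2 / real (ideal_norm J)"
proof -
  define \<delta> where "\<delta> = sqrt (real (ideal_norm J))"
  have \<delta>0: "\<delta> > 0" using ideal_norm_pos[OF J] by (simp add: \<delta>_def)
  have \<delta>2: "\<delta>\<^sup>2 = real (ideal_norm J)" by (simp add: \<delta>_def)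
  define f where "f x = (\<lfloor>2 * Re x / \<delta>\<rfloor>, \<lfloor>2 * Im x / \<delta>\<rfloor>)" for x :: complex
  define K where "K = \<lceil>2 * \<rho> / \<delta>\<rceil>"
  let ?A = "{x \<in> J. cmod x \<le> \<rho>}"
  have close: "\<bar>s - t\<bar> < \<delta> / 2" if "\<lfloor>2 * s / \<delta>\<rfloor> = \<lfloor>2 * t / \<delta>\<rfloor>" for s t
  proof -
    have "\<bar>2 * s / \<delta> - 2 * t / \<delta>\<bar> < 1" using that by linarith
    moreover have "2 * s / \<delta> - 2 * t / \<delta> = 2 * (s - t) / \<delta>" by (simp add: diff_divide_distrib algebra_simps)
    ultimately have "\<bar>2 * (s - t)\<bar> / \<delta> < 1" using \<delta>0 by (simp add: abs_divide)
    hence "\<bar>2 * (s - t)\<bar> < \<delta>" using \<delta>0 by (simp add: pos_divide_less_eq)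
    hence "2 * \<bar>s - t\<bar> < \<delta>" by (simp only: abs_mult abs_numeral)
    thus ?thesis by simp
  qed
  have inj: "inj_on f ?A"
  proof (rule inj_onI, rule ccontr)
    fix x y assume x: "x \<in> ?A" and y: "y \<in> ?A" and f: "f x = f y" and ne: "x \<noteq> y"
    have fl: "\<lfloor>2 * Re x / \<delta>\<rfloor> = \<lfloor>2 * Re y / \<delta>\<rfloor>" "\<lfloor>2 * Im x / \<delta>\<rfloor> = \<lfloor>2 * Im y / \<delta>\<rfloor>"
      using f by (simp_all add: f_def)
    have "\<bar>Re x - Re y\<bar> < \<delta> / 2" "\<bar>Im x - Im y\<bar> < \<delta> / 2" by (rule close[OF fl(1)], rule close[OF fl(2)])
    hence "cmod (x - y) < \<delta>" using cmod_le[of "x - y"] by simp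
    hence "(cmod (x - y))\<^sup>2 < real (ideal_norm J)" unfolding \<delta>2[symmetric] using \<delta>0 by (intro power_strict_mono) auto
    moreover have "real (ideal_norm J) \<le> (cmod (x - y))\<^sup>2"
      using x y ne nonzero_idealD(7)[OF J] by (intro ideal_norm_le_norm[OF J]) auto
    ultimately show False by simp
  qed
  have img: "f ` ?A \<subseteq> {-K..K} \<times> {-K..K}"
  proof
    fix z assume "z \<in> f ` ?A"
    then obtain x where x: "cmod x \<le> \<rho>" and f: "z = f x" by blast
    have *: "\<bar>\<lfloor>2 * s / \<delta>\<rfloor>\<bar> \<le> K" if "\<bar>s\<bar> \<le> \<rho>" for s
    proof -
      have "2 * s / \<delta> \<le> 2 * \<rho> / \<delta>" "- (2 * \<rho> / \<delta>) \<le> 2 * s / \<delta>"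
        using that \<delta>0 by (auto simp: field_simps)
      thus ?thesis unfolding K_def by linarith
    qed
    show "z \<in> {-K..K} \<times> {-K..K}"
      using f *[of "Re x"] *[of "Im x"] x abs_Re_le_cmod[of x] abs_Im_le_cmod[of x] by (auto simp: f_def)
  qed
  show fin: "finite ?A" by (rule inj_on_finite[OF inj img]) simp
  have Y: "2 * \<rho> / \<delta> \<ge> 2" using \<rho> \<delta>0 by (simp add: \<delta>_def[symmetric] field_simps)
  hence K0: "K \<ge> 0" unfolding K_def by linarith
  have "card ?A \<le> card ({-K..K} \<times> {-K..K})" by (rule card_inj_on_le[OF inj img]) simp
  also have "\<dots> = nat (2 * K + 1) * nat (2 * K + 1)" by (simp add: algebra_simps)
  finally have "real (card ?A) \<le> real (nat (2 * K + 1) * nat (2 * K + 1))" by (simp only: of_nat_le_iff)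
  also have "\<dots> = (of_int (2 * K + 1))\<^sup>2" using K0 by (simp add: power2_eq_square)
  also have "\<dots> \<le> (4 * (2 * \<rho> / \<delta>))\<^sup>2"
  proof (rule power_mono)
    have "of_int K \<le> 2 * \<rho> / \<delta> + 1" unfolding K_def by linarith
    thus "of_int (2 * K + 1) \<le> 4 * (2 * \<rho> / \<delta>)" using Y by simp
    show "(0::real) \<le> of_int (2 * K + 1)" using K0 by simp
  qed
  also have "\<dots> = 64 * \<rho>\<^sup>2 / real (ideal_norm J)" unfolding \<delta>2[symmetric] by (simp add: power_mult_distrib power_divide)
  finally show "real (card ?A) \<le> 64 * \<rho>\<^sup>2 / real (ideal_norm J)" .
qed

definition lattice_count :: "(complex \<times> complex) set \<Rightarrow> complex set \<Rightarrow> real \<Rightarrow> nat" where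
  "lattice_count E J r = card {p \<in> J \<times> J. p /\<^sub>R r \<in> E}"

text \<open>The uniformity in \<open>J\<close> is what justifies exchanging limit and sieve. A dilated region too small for
  a nonzero vector of \<open>J\<close> contributes nothing, as the origin is excluded; otherwise the packing
  bound applies to both coordinates.\<close>

lemma lattice_count_bound:
  assumes J: "nonzero_ideal J" and B: "\<And>x. x \<in> E \<Longrightarrow> norm x \<le> B" and E0: "0 \<notin> E" and r: "r > 0" and B0: "B \<ge> 0"
  shows "real (lattice_count E J r) \<le> (64 * B\<^sup>2)\<^sup>2 * r ^ 4 / (real (ideal_norm J))\<^sup>2"
proof -
  let ?A = "{x \<in> J. cmod x \<le> r * B}"
  have sub: "{p \<in> J \<times> J. p /\<^sub>R r \<in> E} \<subseteq> ?A \<times> ?A"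
  proof
    fix p assume p: "p \<in> {p \<in> J \<times> J. p /\<^sub>R r \<in> E}"
    have "norm (p /\<^sub>R r) \<le> B" using p B by blast
    hence "norm p \<le> r * B" using r by (simp add: field_simps)
    hence "cmod (fst p) \<le> r * B" "cmod (snd p) \<le> r * B"
      using norm_fst_le[of "fst p" "snd p"] norm_snd_le[of "snd p" "fst p"] by auto
    thus "p \<in> ?A \<times> ?A" using p by auto
  qed
  show ?thesis
  proof (cases "r * B \<ge> sqrt (real (ideal_norm J))")
    case True
    note c = card_ideal_disc[OF J True]
    have "lattice_count E J r \<le> card (?A \<times> ?A)" unfolding lattice_count_def by (rule card_mono[OF _ sub]) (use c(1) in simp)
    hence "real (lattice_count E J r) \<le> real (card ?A) * real (card ?A)" by (simp add: card_cartesian_product flip: of_nat_mult)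
    also have "\<dots> \<le> (64 * (r * B)\<^sup>2 / real (ideal_norm J)) * (64 * (r * B)\<^sup>2 / real (ideal_norm J))"
      using c(2) by (intro mult_mono) auto
    also have "\<dots> = (64 * B\<^sup>2)\<^sup>2 * r ^ 4 / (real (ideal_norm J))\<^sup>2"
      by (simp add: power2_eq_square power4_eq_xxxx mult_ac)
    finally show ?thesis .
  next
    case False
    have "x = 0" if "x \<in> ?A" for x
    proof (rule ccontr)
      assume "x \<noteq> 0"
      hence "real (ideal_norm J) \<le> (cmod x)\<^sup>2" using ideal_norm_le_norm[OF J, of x] that by blast
      hence "sqrt (real (ideal_norm J)) \<le> cmod x" by (intro real_le_lsqrt) auto
      thus False using False that by simp
    qed
    note zero = this
    have "p /\<^sub>R r \<notin> E" if p: "p \<in> J \<times> J" for p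
    proof
      assume pE: "p /\<^sub>R r \<in> E"
      have "p \<in> {p \<in> J \<times> J. p /\<^sub>R r \<in> E}" using p pE by blast
      from subsetD[OF sub this] have "fst p \<in> ?A" "snd p \<in> ?A" unfolding mem_Times_iff by blast+
      hence "fst p = 0 \<and> snd p = 0" using zero by blast
      hence "p = 0" by (simp add: prod_eq_iff)
      thus False using pE E0 by simp
    qed
    hence "{p \<in> J \<times> J. p /\<^sub>R r \<in> E} = {}" by blast
    hence "lattice_count E J r = 0" unfolding lattice_count_def by (simp only: card.empty)
    thus ?thesis by simp
  qed
qed

text \<open>A pair is unimodular iff no maximal ideal contains both entries, so the signs \<open>ideal_mu\<close> express the count by the
  counts of \<open>J \<times> J\<close>. These have the densities \<open>1 / N(J)\<^sup>2\<close>, the sum over \<open>J\<close> is dominated by a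
  convergent series, and the signed sum of the densities is \<open>1 / \<zeta>(2)\<close>.\<close>

theorem unimodular_asymptotics:
  assumes bE: "bounded E" and mE: "E \<in> sets borel" and fr: "AE x in lborel. x \<notin> frontier E" and E0: "0 \<notin> E"
  shows "((\<lambda>r. real (card {p \<in> R \<times> R. unimodular p \<and> p /\<^sub>R r \<in> E}) / r ^ 4) \<longlongrightarrow>
     measure lborel E / ((Im w)\<^sup>2 * (\<Sum>\<^sub>\<infinity>I\<in>{I. nonzero_ideal I}. 1 / (real (ideal_norm I))\<^sup>2))) at_top"
    and "\<And>r. r > 0 \<Longrightarrow> finite {p \<in> R \<times> R. p /\<^sub>R r \<in> E}"
proof -
  define Id where "Id = {J. nonzero_ideal J}"
  define V where "V = measure lborel E / (Im w)\<^sup>2"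
  obtain B where B: "\<And>x. x \<in> E \<Longrightarrow> norm x \<le> B" "B > 0" using bE bounded_pos by blast
  have lim: "((\<lambda>r. real (lattice_count E J r) / r ^ 4) \<longlongrightarrow> V / (real (ideal_norm J))\<^sup>2) at_top"
    and fin: "\<And>r. r > 0 \<Longrightarrow> finite {p \<in> J \<times> J. p /\<^sub>R r \<in> E}" if J: "nonzero_ideal J" for J
  proof -
    obtain a v where av: "a > 0" "Im v > 0" "J = plane_lattice a v" "a * Im v = real (ideal_norm J) * Im w"
      using ideal_plane_lattice[OF J] .
    note L = lattice_pairs_asymptotics[OF av(1,2) bE mE fr, folded av(3)]
    show "\<And>r. r > 0 \<Longrightarrow> finite {p \<in> J \<times> J. p /\<^sub>R r \<in> E}" by (rule L(2))
    have "measure lborel E / (a * Im v)\<^sup>2 = V / (real (ideal_norm J))\<^sup>2"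
      unfolding av(4) V_def by (simp add: power_mult_distrib mult.commute)
    thus "((\<lambda>r. real (lattice_count E J r) / r ^ 4) \<longlongrightarrow> V / (real (ideal_norm J))\<^sup>2) at_top"
      using L(1) unfolding lattice_count_def by simp
  qed
  show "\<And>r. r > 0 \<Longrightarrow> finite {p \<in> R \<times> R. p /\<^sub>R r \<in> E}" by (rule fin[OF nonzero_ideal_R])
  define M where "M = (64 * B\<^sup>2)\<^sup>2"
  have int1: "integrable (count_space Id) (\<lambda>J. c / (real (ideal_norm J))\<^sup>2)" for c
  proof -
    have "Infinite_Sum.abs_summable_on (\<lambda>J. c / (real (ideal_norm J))\<^sup>2) Id"
      using summable_on_cmult_right[OF summable_ideal_norm, of "\<bar>c\<bar>"] by (simp add: Id_def abs_mult)
    thus ?thesis unfolding abs_summable_equivalent abs_summable_on_def .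
  qed
  have limI: "((\<lambda>r. integral\<^sup>L (count_space Id) (\<lambda>J. ideal_mu J * (real (lattice_count E J r) / r ^ 4))) \<longlongrightarrow>
      integral\<^sup>L (count_space Id) (\<lambda>J. ideal_mu J * (V / (real (ideal_norm J))\<^sup>2))) at_top"
  proof (rule integral_dominated_convergence_at_top[where w="\<lambda>J. M / (real (ideal_norm J))\<^sup>2"])
    show "integrable (count_space Id) (\<lambda>J. M / (real (ideal_norm J))\<^sup>2)" by (rule int1)
    show "AE J in count_space Id. ((\<lambda>r. ideal_mu J * (real (lattice_count E J r) / r ^ 4)) \<longlongrightarrow> ideal_mu J * (V / (real (ideal_norm J))\<^sup>2)) at_top"
      unfolding AE_count_space Id_def using tendsto_mult[OF tendsto_const lim] by blast
    show "\<forall>\<^sub>F r in at_top. AE J in count_space Id. norm (ideal_mu J * (real (lattice_count E J r) / r ^ 4)) \<le> M / (real (ideal_norm J))\<^sup>2"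
      using eventually_gt_at_top[of 0]
    proof eventually_elim
      case (elim r)
      have "norm (ideal_mu J * (real (lattice_count E J r) / r ^ 4)) \<le> M / (real (ideal_norm J))\<^sup>2" if J: "nonzero_ideal J" for J
      proof -
        have "real (lattice_count E J r) / r ^ 4 \<le> (M * r ^ 4 / (real (ideal_norm J))\<^sup>2) / r ^ 4"
          unfolding M_def using elim B by (intro divide_right_mono lattice_count_bound[OF J] E0) auto
        also have "\<dots> = M / (real (ideal_norm J))\<^sup>2" using elim by simp
        finally have c: "real (lattice_count E J r) / r ^ 4 \<le> M / (real (ideal_norm J))\<^sup>2" .
        have "norm (ideal_mu J * (real (lattice_count E J r) / r ^ 4)) = \<bar>ideal_mu J\<bar> * (real (lattice_count E J r) / r ^ 4)"
          using elim by (simp add: abs_mult)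
        also have "\<dots> \<le> 1 * (real (lattice_count E J r) / r ^ 4)" using elim by (intro mult_right_mono abs_ideal_mu_le) auto
        finally show ?thesis using c by simp
      qed
      thus ?case by (simp add: AE_count_space Id_def)
    qed
  qed auto
  have eqI: "integral\<^sup>L (count_space Id) (\<lambda>J. ideal_mu J * (V / (real (ideal_norm J))\<^sup>2))
      = V * (\<Sum>\<^sub>\<infinity>J\<in>Id. ideal_mu J / (real (ideal_norm J))\<^sup>2)"
  proof -
    have "integrable (count_space Id) (\<lambda>J. ideal_mu J * (V / (real (ideal_norm J))\<^sup>2))"
    proof (rule Bochner_Integration.integrable_bound[OF int1[of V]])
      show "AE J in count_space Id. norm (ideal_mu J * (V / (real (ideal_norm J))\<^sup>2)) \<le> norm (V / (real (ideal_norm J))\<^sup>2)"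
      proof -
        have "norm (ideal_mu J * x) \<le> norm x" for J and x :: real
          using mult_right_mono[OF abs_ideal_mu_le[of J] norm_ge_zero[of x]] by (simp add: abs_mult)
        thus ?thesis unfolding AE_count_space by blast
      qed
    qed simp
    hence "integral\<^sup>L (count_space Id) (\<lambda>J. ideal_mu J * (V / (real (ideal_norm J))\<^sup>2)) = (\<Sum>\<^sub>\<infinity>J\<in>Id. ideal_mu J * (V / (real (ideal_norm J))\<^sup>2))"
      using infsetsum_infsum[of "\<lambda>J. ideal_mu J * (V / (real (ideal_norm J))\<^sup>2)" Id] by (simp add: infsetsum_def abs_summable_on_def)
    also have "\<dots> = (\<Sum>\<^sub>\<infinity>J\<in>Id. V * (ideal_mu J / (real (ideal_norm J))\<^sup>2))" by (simp add: mult_ac)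
    also have "\<dots> = V * (\<Sum>\<^sub>\<infinity>J\<in>Id. ideal_mu J / (real (ideal_norm J))\<^sup>2)" by (rule infsum_cmult_right')
    finally show ?thesis .
  qed
  have ev: "\<forall>\<^sub>F r in at_top. integral\<^sup>L (count_space Id) (\<lambda>J. ideal_mu J * (real (lattice_count E J r) / r ^ 4))
     = real (card {p \<in> R \<times> R. unimodular p \<and> p /\<^sub>R r \<in> E}) / r ^ 4"
    using eventually_gt_at_top[of 0]
  proof eventually_elim
    case (elim r)
    define S where "S = {p \<in> R \<times> R. p /\<^sub>R r \<in> E}"
    have finS: "finite S" unfolding S_def by (rule fin[OF nonzero_ideal_R elim])
    have Sp: "p \<in> R \<times> R" "p \<noteq> 0" if "p \<in> S" for p using that E0 by (auto simp: S_def)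
    define A where "A = (\<Union>p\<in>S. {J. nonzero_ideal J \<and> pair_ideal p \<subseteq> J})"
    have finA: "finite A" unfolding A_def using finS finite_nonzero_ideal_above[OF nonzero_ideal_pair_ideal] Sp by blast
    have AId: "A \<subseteq> Id" by (auto simp: A_def Id_def)
    have cntS: "lattice_count E J r = card {p \<in> S. p \<in> J \<times> J}" if "J \<in> Id" for J
      using nonzero_idealD(1)[of J] that unfolding lattice_count_def S_def Id_def by (intro arg_cong[where f=card]) auto
    have out: "lattice_count E J r = 0" if "J \<in> Id - A" for J
    proof -
      have e: "{p \<in> S. p \<in> J \<times> J} = {}" using that pair_ideal_subset_iff by (auto simp: A_def Id_def)
      have "lattice_count E J r = card {p \<in> S. p \<in> J \<times> J}" using cntS that by blast
      thus ?thesis by (simp only: e card.empty)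
    qed
    have supA: "{J \<in> Id. ideal_mu J * (real (lattice_count E J r) / r ^ 4) \<noteq> 0} \<subseteq> A"
    proof
      fix J assume "J \<in> {J \<in> Id. ideal_mu J * (real (lattice_count E J r) / r ^ 4) \<noteq> 0}"
      thus "J \<in> A" using out[of J] by (cases "J \<in> A") auto
    qed
    have "integral\<^sup>L (count_space Id) (\<lambda>J. ideal_mu J * (real (lattice_count E J r) / r ^ 4))
       = (\<Sum>J | J \<in> Id \<and> ideal_mu J * (real (lattice_count E J r) / r ^ 4) \<noteq> 0. ideal_mu J * (real (lattice_count E J r) / r ^ 4))"
      by (rule lebesgue_integral_count_space_finite_support, rule finite_subset[OF supA finA])
    also have "\<dots> = (\<Sum>J\<in>A. ideal_mu J * (real (lattice_count E J r) / r ^ 4))"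
      by (rule sum.mono_neutral_left[OF finA supA]) (use AId in auto)
    also have "\<dots> = (\<Sum>J\<in>A. \<Sum>p\<in>S. (if p \<in> J \<times> J then ideal_mu J else 0)) / r ^ 4"
    proof (subst sum_divide_distrib, rule sum.cong)
      fix J assume "J \<in> A"
      hence "real (lattice_count E J r) = (\<Sum>p\<in>S. if p \<in> J \<times> J then 1 else 0)"
        using cntS[of J] AId finS by (auto simp: sum.If_cases Int_def)
      hence "ideal_mu J * real (lattice_count E J r) = (\<Sum>p\<in>S. (if p \<in> J \<times> J then ideal_mu J else 0))"
        by (simp add: sum_distrib_left if_distrib cong: if_cong)
      thus "ideal_mu J * (real (lattice_count E J r) / r ^ 4) = (\<Sum>p\<in>S. (if p \<in> J \<times> J then ideal_mu J else 0)) / r ^ 4" by simp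
    qed simp
    also have "(\<Sum>J\<in>A. \<Sum>p\<in>S. (if p \<in> J \<times> J then ideal_mu J else 0)) = (\<Sum>p\<in>S. \<Sum>J\<in>A. (if p \<in> J \<times> J then ideal_mu J else 0))"
      by (rule sum.swap)
    also have "\<dots> = (\<Sum>p\<in>S. if unimodular p then 1 else 0)"
    proof (rule sum.cong)
      fix p assume p: "p \<in> S"
      have "(\<Sum>J\<in>A. (if p \<in> J \<times> J then ideal_mu J else 0)) = (\<Sum>J\<in>{J. nonzero_ideal J \<and> pair_ideal p \<subseteq> J}. ideal_mu J)"
      proof (rule sum.mono_neutral_cong_right[OF finA])
        show "{J. nonzero_ideal J \<and> pair_ideal p \<subseteq> J} \<subseteq> A" using p by (auto simp: A_def)
        show "\<forall>J\<in>A - {J. nonzero_ideal J \<and> pair_ideal p \<subseteq> J}. (if p \<in> J \<times> J then ideal_mu J else 0) = 0"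
          using pair_ideal_subset_iff AId by (auto simp: Id_def)
        show "(if p \<in> J \<times> J then ideal_mu J else 0) = ideal_mu J" if "J \<in> {J. nonzero_ideal J \<and> pair_ideal p \<subseteq> J}" for J
          using pair_ideal_subset_iff[of J p] that by simp
      qed
      also have "\<dots> = (if unimodular p then 1 else 0)"
        using sum_ideal_mu[OF nonzero_ideal_pair_ideal[OF Sp[OF p]]] unimodular_iff[OF Sp[OF p]] by simp
      finally show "(\<Sum>J\<in>A. (if p \<in> J \<times> J then ideal_mu J else 0)) = (if unimodular p then 1 else 0)" .
    qed simp
    also have "\<dots> = real (card {p \<in> R \<times> R. unimodular p \<and> p /\<^sub>R r \<in> E})"
      using finS by (simp add: sum.If_cases Int_def S_def conj_ac)
    finally show ?case .
  qed
  have "((\<lambda>r. real (card {p \<in> R \<times> R. unimodular p \<and> p /\<^sub>R r \<in> E}) / r ^ 4) \<longlongrightarrow>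
      V * (\<Sum>\<^sub>\<infinity>J\<in>Id. ideal_mu J / (real (ideal_norm J))\<^sup>2)) at_top"
    by (rule Lim_transform_eventually[OF limI[unfolded eqI] ev])
  moreover have "(\<Sum>\<^sub>\<infinity>J\<in>Id. ideal_mu J / (real (ideal_norm J))\<^sup>2) = 1 / (\<Sum>\<^sub>\<infinity>I\<in>Id. 1 / (real (ideal_norm I))\<^sup>2)"
  proof -
    have "x = 1 / y" if "x * y = 1" for x y :: real using that by (cases "y = 0") (auto simp: field_simps)
    from this[OF infsum_ideal_mu_zeta] show ?thesis unfolding Id_def .
  qed
  ultimately show "((\<lambda>r. real (card {p \<in> R \<times> R. unimodular p \<and> p /\<^sub>R r \<in> E}) / r ^ 4) \<longlongrightarrow>
     measure lborel E / ((Im w)\<^sup>2 * (\<Sum>\<^sub>\<infinity>I\<in>{I. nonzero_ideal I}. 1 / (real (ideal_norm I))\<^sup>2))) at_top"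
    by (simp add: V_def Id_def mult.commute)
qed

end

section \<open>The orbit of the golden ratio modulo translations\<close>

abbreviation phi :: complex where "phi \<equiv> of_real golden_ratio"
abbreviation phibar :: complex where "phibar \<equiv> of_real golden_conj"

lemma phi_facts: "phi * phi = phi + 1" "phibar * phibar = phibar + 1" "phi * phibar = -1" "phi + phibar = 1" "phi - phibar = of_real (sqrt 5)"
proof -
  show "phi * phi = phi + 1" using arg_cong[OF golden_facts(1), of complex_of_real] by (simp add: power2_eq_square)
  show "phibar * phibar = phibar + 1" using arg_cong[OF golden_facts(2), of complex_of_real] by (simp add: power2_eq_square)
  show "phi * phibar = -1" using arg_cong[OF golden_facts(3), of complex_of_real] by simp
  show "phi + phibar = 1" using arg_cong[OF golden_facts(4), of complex_of_real] by simp
  show "phi - phibar = of_real (sqrt 5)" using arg_cong[OF golden_facts(5), of complex_of_real] by simp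
qed

lemma sqrt5_irrational: "sqrt 5 \<notin> \<rat>"
proof
  assume "sqrt 5 \<in> \<rat>"
  moreover have "algebraic_int (5::real)" by (rule int_imp_algebraic_int) simp
  hence "algebraic_int (sqrt 5)" by (rule algebraic_int_sqrt)
  ultimately have "sqrt 5 \<in> \<int>" using rational_algebraic_int_is_int by blast
  then obtain n where n: "sqrt 5 = of_int n" by (auto elim: Ints_cases)
  have "sqrt 5 < 3" "sqrt 5 > 2" by (rule real_less_lsqrt real_less_rsqrt; simp)+
  hence "n < 3" "n > 2" unfolding n by simp_all
  thus False by simp
qed

lemma golden_irrational: "golden_ratio \<notin> \<rat>" "golden_conj \<notin> \<rat>"
proof -
  have 1: "sqrt 5 = 2 * golden_ratio - 1" "sqrt 5 = 1 - 2 * golden_conj"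
    by (simp_all add: golden_conj_def golden_ratio_def)
  show "golden_ratio \<notin> \<rat>" "golden_conj \<notin> \<rat>"
    using sqrt5_irrational 1 by (metis Rats_1 Rats_diff Rats_mult Rats_number_of)+
qed

text \<open>On \<open>K + K \<phi>\<close> the map \<open>A + B \<phi> \<mapsto> A + B \<phi>'\<close> is well defined and multiplicative, so it commutes
  with polynomials over \<open>K\<close>; the polynomial with roots \<open>\<alpha>\<close> and \<open>\<alpha>'\<close> has coefficients in \<open>K\<close> and
  leaves no other conjugate.\<close>

lemma galois_conj_golden:
  assumes K: "subfield K CC" and irr: "phi \<notin> K" and AB: "A \<in> K" "B \<in> K" "B \<noteq> 0"
  shows "galois_conj K (A + B * phi) = A + B * phibar"
proof -
  note s = subfield_CC[OF K]
  define \<alpha> \<alpha>' where "\<alpha> = A + B * phi" and "\<alpha>' = A + B * phibar"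
  have zero: "P = 0 \<and> Q = 0" if "P \<in> K" "Q \<in> K" "P + Q * phi = 0" for P Q
  proof -
    have "Q = 0"
    proof (rule ccontr)
      assume "Q \<noteq> 0"
      hence "phi = - P * inverse Q" using that(3) by (simp add: field_simps add_eq_0_iff)
      thus False using irr s(4)[OF s(5)[OF that(1)] s(6)[OF that(2)]] by simp
    qed
    thus ?thesis using that(3) by simp
  qed
  have lin: "\<exists>P\<in>K. \<exists>Q\<in>K. poly p \<alpha> = P + Q * phi \<and> poly p \<alpha>' = P + Q * phibar"
    if "\<forall>i. poly.coeff p i \<in> K" for p
    using that
  proof (induction p)
    case 0
    thus ?case using s(1) by (intro bexI[of _ 0]) auto
  next
    case (pCons c p)
    have c: "c \<in> K" using pCons.prems by (metis coeff_pCons_0)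
    have "\<forall>i. poly.coeff p i \<in> K" using pCons.prems by (metis coeff_pCons_Suc)
    then obtain P Q where PQ: "P \<in> K" "Q \<in> K" "poly p \<alpha> = P + Q * phi" "poly p \<alpha>' = P + Q * phibar"
      using pCons.IH by blast
    have mult: "c + (A + B * x) * (P + Q * x) = (c + A * P + B * Q) + (A * Q + B * P + B * Q) * x"
      if "x * x = x + 1" for x
    proof -
      have "c + (A + B * x) * (P + Q * x) = c + A * P + (A * Q + B * P) * x + B * Q * (x * x)" by (simp add: algebra_simps)
      thus ?thesis unfolding that by (simp add: algebra_simps)
    qed
    have "poly (pCons c p) \<alpha> = c + \<alpha> * (P + Q * phi)" by (simp add: PQ)
    also have "\<dots> = (c + A * P + B * Q) + (A * Q + B * P + B * Q) * phi"
      unfolding \<alpha>_def by (rule mult[OF phi_facts(1)])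
    finally have 1: "poly (pCons c p) \<alpha> = (c + A * P + B * Q) + (A * Q + B * P + B * Q) * phi" .
    have "poly (pCons c p) \<alpha>' = c + \<alpha>' * (P + Q * phibar)" by (simp add: PQ)
    also have "\<dots> = (c + A * P + B * Q) + (A * Q + B * P + B * Q) * phibar"
      unfolding \<alpha>'_def by (rule mult[OF phi_facts(2)])
    finally have 2: "poly (pCons c p) \<alpha>' = (c + A * P + B * Q) + (A * Q + B * P + B * Q) * phibar" .
    have "c + A * P + B * Q \<in> K" "A * Q + B * P + B * Q \<in> K"
      using c PQ(1,2) AB(1,2) s(3,4) by simp_all
    with 1 2 show ?case by blast
  qed
  have ne: "\<alpha>' \<noteq> \<alpha>" using AB(3) golden_facts(6,8) by (auto simp: \<alpha>_def \<alpha>'_def)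
  define f where "f = [:\<alpha> * \<alpha>', - (\<alpha> + \<alpha>'), 1:]"
  have fK: "\<forall>i. poly.coeff f i \<in> K"
  proof -
    have "\<alpha> + \<alpha>' = A + A + B * (phi + phibar)" by (simp add: \<alpha>_def \<alpha>'_def algebra_simps)
    hence "\<alpha> + \<alpha>' \<in> K" unfolding phi_facts using s(3)[OF s(3)[OF AB(1) AB(1)] AB(2)] by simp
    moreover have "\<alpha> * \<alpha>' = A * A + A * B * (phi + phibar) + B * B * (phi * phibar)" by (simp add: \<alpha>_def \<alpha>'_def algebra_simps)
    hence "\<alpha> * \<alpha>' = A * A + A * B + - (B * B)" unfolding phi_facts by simp
    hence "\<alpha> * \<alpha>' \<in> K" by (simp only:) (intro s(3) s(4) s(5) AB(1,2))
    ultimately show ?thesis unfolding f_def using s(1,2,5) by (auto simp: coeff_pCons simp del: minus_add_distrib split: nat.splits)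
  qed
  have pf: "poly f \<beta> = (\<beta> - \<alpha>) * (\<beta> - \<alpha>')" for \<beta> by (simp add: f_def algebra_simps)
  have "galois_conj K \<alpha> = \<alpha>'"
    unfolding galois_conj_def
  proof (rule the_equality)
    show "\<alpha>' \<noteq> \<alpha> \<and> (\<forall>p. (\<forall>i. poly.coeff p i \<in> K) \<and> poly p \<alpha> = 0 \<longrightarrow> poly p \<alpha>' = 0)"
    proof (intro conjI allI impI ne)
      fix p assume p: "(\<forall>i. poly.coeff p i \<in> K) \<and> poly p \<alpha> = 0"
      obtain P Q where PQ: "P \<in> K" "Q \<in> K" "poly p \<alpha> = P + Q * phi" "poly p \<alpha>' = P + Q * phibar"
        using lin p by blast
      have "P = 0 \<and> Q = 0" using zero[OF PQ(1,2)] PQ(3) p by simp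
      thus "poly p \<alpha>' = 0" using PQ(4) by simp
    qed
    fix \<beta> assume b: "\<beta> \<noteq> \<alpha> \<and> (\<forall>p. (\<forall>i. poly.coeff p i \<in> K) \<and> poly p \<alpha> = 0 \<longrightarrow> poly p \<beta> = 0)"
    have "poly f \<beta> = 0" using b fK pf[of \<alpha>] by simp
    thus "\<beta> = \<alpha>'" using b pf by simp
  qed
  thus ?thesis by (simp add: \<alpha>_def \<alpha>'_def)
qed

text \<open>Rationalizing the denominator; \<open>n\<close> is the relative norm of the denominator.\<close>

lemma moebius_golden:
  assumes "a * d - b * c = 1" "d + phi * c \<noteq> 0" "d + phibar * c \<noteq> 0"
  defines "n \<equiv> (d + phi * c) * (d + phibar * c)"
  shows "n = d * d + c * d - c * c" "n \<noteq> 0"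
    "moebius a b c d phi = (b * d + b * c - a * c) / n + 1 / n * phi"
    "moebius a b c d phibar = (b * d + b * c - a * c) / n + 1 / n * phibar"
proof -
  have "n = d * d + c * d * (phi + phibar) + c * c * (phi * phibar)" by (simp add: n_def algebra_simps)
  thus "n = d * d + c * d - c * c" unfolding phi_facts by simp
  show n0: "n \<noteq> 0" using assms by simp
  have num: "(a * x + b) * (d + y * c) = (b * d + b * c - a * c) + x" if "x + y = 1" "x * y = -1" for x y
  proof -
    have "(a * x + b) * (d + y * c) = b * d + b * c * (x + y) + a * c * (x * y) + (a * d - b * c) * x"
      by (simp add: algebra_simps)
    thus ?thesis unfolding assms(1) that by simp
  qed
  have "moebius a b c d phi = (a * phi + b) * (d + phibar * c) / n"
    using assms(2,3) by (simp add: moebius_def n_def add.commute mult.commute)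
  thus "moebius a b c d phi = (b * d + b * c - a * c) / n + 1 / n * phi"
    unfolding num[OF phi_facts(4,3)] by (simp add: add_divide_distrib)
  have "moebius a b c d phibar = (a * phibar + b) * (d + phi * c) / n"
    using assms(2,3) by (simp add: moebius_def n_def add.commute mult.commute)
  moreover have "phibar + phi = 1" "phibar * phi = -1" using phi_facts(3,4) by (simp_all add: add.commute mult.commute)
  note num[OF this]
  ultimately show "moebius a b c d phibar = (b * d + b * c - a * c) / n + 1 / n * phibar"
    by (simp add: add_divide_distrib)
qed

lemma card_two_to_one:
  fixes f :: "'a::ab_group_add \<Rightarrow> 'b"
  assumes "finite A" "\<And>p. p \<in> A \<Longrightarrow> {x \<in> A. f x = f p} = {p, - p}" "\<And>p. p \<in> A \<Longrightarrow> p \<noteq> - p"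
  shows "card A = 2 * card (f ` A)"
proof -
  have "card A = (\<Sum>y\<in>f ` A. card {x \<in> A. f x = y})"
    using sum.image_gen[OF assms(1), of "\<lambda>_. 1::nat" f] by simp
  also have "\<dots> = (\<Sum>y\<in>f ` A. 2)"
  proof (rule sum.cong)
    fix y assume "y \<in> f ` A"
    then obtain p where p: "p \<in> A" "y = f p" by blast
    show "card {x \<in> A. f x = y} = 2" using assms(2,3)[OF p(1)] by (simp add: p(2))
  qed simp
  finally show ?thesis by simp
qed

context imag_quad_ring
begin

text \<open>A zero would make a ratio of integers equal to \<open>\<phi>\<close> or its conjugate: multiply by \<open>cnj c\<close> and use
  that the real elements of \<open>R\<close> are integers.\<close>

lemma golden_form_nonzero:
  assumes "c \<in> R" "d \<in> R" "(c, d) \<noteq> 0"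
  shows "d + phi * c \<noteq> 0" "d + phibar * c \<noteq> 0"
proof -
  have "d + of_real x * c \<noteq> 0" if x: "x \<notin> \<rat>" for x
  proof
    assume 0: "d + of_real x * c = 0"
    hence c0: "c \<noteq> 0" using assms(3) by (auto simp: zero_prod_def)
    have d: "d = - of_real x * c" using 0 by (simp add: add_eq_0_iff)
    have dc: "d * cnj c = of_real (- x * (cmod c)\<^sup>2)" unfolding d
      by (simp add: complex_norm_square[symmetric] mult.assoc flip: of_real_power)
    have "d * cnj c \<in> R" using assms by blast
    then obtain k where k: "d * cnj c = of_int k" by (rule R_real) (simp add: dc)
    obtain n :: nat where n: "(cmod c)\<^sup>2 = of_nat n" using R_norm[OF assms(1)] .
    have "- x * of_nat n = of_int k"
      using arg_cong[OF k, of Re] unfolding dc n by simp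
    moreover have "of_nat n \<noteq> (0::real)" using n c0 by (metis norm_eq_zero zero_eq_power2)
    ultimately have "x = - of_int k / of_nat n" by (simp add: field_simps)
    hence "x \<in> \<rat>" by simp
    thus False using x by simp
  qed
  thus "d + phi * c \<noteq> 0" "d + phibar * c \<noteq> 0" using golden_irrational by blast+
qed

lemma golden_independent:
  assumes "x \<in> R" "y \<in> R" "x + y * phi = 0" shows "x = 0" "y = 0"
proof -
  show "y = 0"
  proof (rule ccontr)
    assume "y \<noteq> 0"
    thus False using golden_form_nonzero(1)[OF assms(2,1)] assms(3) by (simp add: zero_prod_def mult.commute)
  qed
  thus "x = 0" using assms(3) by simp
qed

text \<open>Modulo sign, the stabilizer of \<open>\<phi>\<close> is generated by multiplication with the relative unit
  \<open>\<phi>\<^sup>2\<close>, or with its square root \<open>\<i> \<phi>\<close> when \<open>\<i> \<in> R\<close>. The number below is the factor by which this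
  unit multiplies the ratio \<open>|u / v|\<close> of the two conjugate values of a bottom row.\<close>

definition stab_ratio :: real where
  "stab_ratio = (if \<i> \<in> R then golden_ratio ^ 2 else golden_ratio ^ 4)"

lemma stab_ratio_gt_1: "stab_ratio > 1"
  using golden_facts(6) by (simp add: stab_ratio_def one_less_power)

lemma add_inverse_mono: fixes x s :: real assumes "1 \<le> x" "x < s" shows "x + 1 / x < s + 1 / s"
proof -
  have "1 * 1 < s * x" using assms by (intro mult_less_le_imp_less) auto
  hence "0 < 1 - 1 / (x * s)" by (simp add: mult.commute)
  hence "0 < (s - x) * (1 - 1 / (x * s))" using assms by (intro mult_pos_pos) auto
  also have "\<dots> = (s - x) - (s - x) / (x * s)" by (simp add: algebra_simps)
  also have "(s - x) / (x * s) = 1 / x - 1 / s" using assms by (simp add: diff_divide_distrib)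
  finally show ?thesis by simp
qed

text \<open>This is the statement that the unit behind \<open>stab_ratio\<close> is fundamental. If \<open>\<i> \<in> R\<close>, the bounds on
  the unit already give \<open>|y| < 1\<close>. Otherwise let \<open>\<tau> = 2 x + y\<close> be the trace
  of the unit \<open>x + y \<phi>\<close>, so that \<open>\<tau>\<^sup>2 = 4 + 5 y\<^sup>2\<close>. The bounds then give \<open>|y|\<^sup>2 < 9/5\<close> and
  \<open>|\<tau>| < 3\<close>, hence \<open>|y| = 1\<close> if \<open>y \<noteq> 0\<close>. Then \<open>|\<tau>|\<^sup>4 = 41 + 20 k\<close> with \<open>k = 2 Re (y\<^sup>2) \<in> {-2..2}\<close> has to be the
  square of an integer less than 9, which leaves \<open>k = -2\<close> and \<open>y = \<plusminus>\<i>\<close>, contrary to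
  \<open>\<i> \<notin> R\<close>.\<close>

lemma unit_trivial:
  assumes R: "x \<in> R" "y \<in> R" and one: "(x + y * phi) * (x + y * phibar) = 1"
    and ge: "1 \<le> cmod (x + y * phi)" and lt: "(cmod (x + y * phi))\<^sup>2 < stab_ratio"
  shows "y = 0"
proof (rule ccontr)
  assume y0: "y \<noteq> 0"
  define l l' where "l = x + y * phi" and "l' = x + y * phibar"
  define s where "s = sqrt stab_ratio"
  have ls: "cmod l < s" unfolding s_def l_def using lt by (rule real_less_rsqrt)
  have l'1: "cmod l' = 1 / cmod l"
  proof -
    have "cmod l * cmod l' = 1" using one unfolding l_def l'_def by (metis norm_mult norm_one)
    moreover have "cmod l \<noteq> 0" using ge by (auto simp: l_def)
    ultimately show ?thesis by (simp add: eq_divide_eq mult.commute)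
  qed
  have bd: "cmod l + cmod l' < s + 1 / s" unfolding l'1 using ge ls by (intro add_inverse_mono) (auto simp: l_def)
  have diff: "of_real (sqrt 5) * y = l - l'" unfolding phi_facts(5)[symmetric] by (simp add: l_def l'_def algebra_simps)
  have y5: "sqrt 5 * cmod y < s + 1 / s"
  proof -
    have "sqrt 5 * cmod y = cmod (l - l')" unfolding diff[symmetric] by (simp add: norm_mult)
    also have "\<dots> \<le> cmod l + cmod l'" by (rule norm_triangle_ineq4)
    finally show ?thesis using bd by simp
  qed
  have inv: "1 / golden_ratio = golden_ratio - 1"
    using golden_facts(1,6) by (simp add: field_simps power2_eq_square)
  have y1: "cmod y \<ge> 1" by (rule R_norm_ge_1[OF R(2) y0])
  show False
  proof (cases "\<i> \<in> R")
    case True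
    have "s = golden_ratio" using True golden_facts(6) by (simp add: s_def stab_ratio_def)
    hence "s + 1 / s = golden_ratio + (golden_ratio - 1)" by (simp only: inv)
    also have "\<dots> = sqrt 5" by (simp add: golden_ratio_def field_simps)
    finally have "s + 1 / s = sqrt 5" .
    hence "sqrt 5 * cmod y < sqrt 5 * 1" using y5 by simp
    thus False using y1 by simp
  next
    case False
    have sr: "stab_ratio = (golden_ratio\<^sup>2)\<^sup>2" using False by (simp add: stab_ratio_def flip: power_mult)
    have "s = golden_ratio\<^sup>2" unfolding s_def sr by (simp only: real_sqrt_abs abs_power2)
    hence s: "s = golden_ratio + 1" using golden_facts(1) by simp
    have "1 / s = (1 / golden_ratio)\<^sup>2" using \<open>s = golden_ratio\<^sup>2\<close> by (simp add: power_divide)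
    also have "\<dots> = 2 - golden_ratio" unfolding inv using golden_facts(1) by (simp add: power2_eq_square algebra_simps)
    finally have s3: "s + 1 / s = 3" using s by simp
    obtain m :: nat where m: "(cmod y)\<^sup>2 = of_nat m" using R_norm[OF R(2)] .
    have "(sqrt 5 * cmod y)\<^sup>2 < 3\<^sup>2" using y5 s3 by (intro power_strict_mono) auto
    hence "5 * real m < 9" by (simp add: power_mult_distrib m)
    moreover have "m \<noteq> 0" using m y0 by (metis norm_eq_zero of_nat_0 zero_eq_power2)
    ultimately have "m = 1" by linarith
    hence ny: "(cmod y)\<^sup>2 = 1" using m by simp
    define \<tau> where "\<tau> = 2 * x + y"
    have tR: "\<tau> \<in> R" unfolding \<tau>_def using R R_of_int[of 2] by (auto intro!: R_add R_mult)
    have tau: "\<tau> = l + l'"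
    proof -
      have "l + l' = 2 * x + y * (phi + phibar)" by (simp add: l_def l'_def algebra_simps)
      thus ?thesis unfolding phi_facts by (simp add: \<tau>_def)
    qed
    have tau2: "\<tau> * \<tau> = 4 + 5 * (y * y)"
    proof -
      have "\<tau> * \<tau> = 4 * (l * l') + (l - l') * (l - l')" unfolding tau by (simp add: algebra_simps)
      also have "l * l' = 1" using one by (simp add: l_def l'_def)
      also have "(l - l') * (l - l') = of_real (sqrt 5 * sqrt 5) * (y * y)"
        by (simp only: diff[symmetric] of_real_mult mult_ac)
      also have "of_real (sqrt 5 * sqrt 5) = (5::complex)"
      proof -
        have "sqrt 5 * sqrt 5 = (5::real)" by simp
        thus ?thesis by (simp only: of_real_numeral)
      qed
      finally show ?thesis by simp
    qed
    have "cmod \<tau> \<le> cmod l + cmod l'" unfolding tau by (rule norm_triangle_ineq)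
    hence "cmod \<tau> < 3" using bd s3 by simp
    obtain N :: nat where N: "(cmod \<tau>)\<^sup>2 = of_nat N" using R_norm[OF tR] .
    have "(cmod \<tau>)\<^sup>2 < 3\<^sup>2" using \<open>cmod \<tau> < 3\<close> by (intro power_strict_mono) auto
    hence N9: "N < 9" using N by simp
    have "y * y + cnj (y * y) \<in> R" using R(2) by (intro R_add R_cnj R_mult) auto
    then obtain k where k: "y * y + cnj (y * y) = of_int k" by (rule R_real) simp
    have k2: "2 * Re (y * y) = of_int k" using arg_cong[OF k, of Re] by simp
    have yy: "cmod (y * y) = 1" using ny by (simp add: norm_mult power2_eq_square)
    have reim: "(Re (y * y))\<^sup>2 + (Im (y * y))\<^sup>2 = 1" using yy by (metis cmod_power2 one_power2)
    have "(cmod (\<tau> * \<tau>))\<^sup>2 = (4 + 5 * Re (y * y))\<^sup>2 + (5 * Im (y * y))\<^sup>2" unfolding tau2 by (simp add: cmod_power2)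
    also have "\<dots> = 16 + 40 * Re (y * y) + 25 * ((Re (y * y))\<^sup>2 + (Im (y * y))\<^sup>2)" by (simp only: power2_eq_square) (simp add: algebra_simps)
    also have "\<dots> = 41 + 20 * of_int k" unfolding reim k2[symmetric] by simp
    also have "(cmod (\<tau> * \<tau>))\<^sup>2 = of_nat (N * N)" using N by (simp add: norm_mult power2_eq_square)
    finally have "of_int (int (N * N)) = (of_int (41 + 20 * k) :: real)" by simp
    hence NN: "int (N * N) = 41 + 20 * k" by (simp only: of_int_eq_iff)
    have "\<bar>Re (y * y)\<bar> \<le> 1" using abs_Re_le_cmod[of "y * y"] yy by simp
    hence "\<bar>of_int k\<bar> \<le> (2::real)" using k2 by linarith
    hence kle: "- 2 \<le> k" "k \<le> 2" by linarith+
    have "N = 0 \<or> N = 1 \<or> N = 2 \<or> N = 3 \<or> N = 4 \<or> N = 5 \<or> N = 6 \<or> N = 7 \<or> N = 8" using N9 by linarith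
    hence "k = - 2" using NN kle by (elim disjE) (simp_all, presburger+)
    hence re: "Re (y * y) = - 1" using k2 by simp
    hence "Im (y * y) = 0" using reim by simp
    hence "y * y = - 1" using re by (simp add: complex_eq_iff)
    hence "y\<^sup>2 = \<i>\<^sup>2" by (simp add: power2_eq_square)
    hence "y = \<i> \<or> y = - \<i>" by (simp only: power2_eq_iff)
    hence "\<i> \<in> R" using R(2) R_uminus[OF R(2)] by auto
    thus False using False by simp
  qed
qed

text \<open>One of the two conjugates of a unit has absolute value at least one, and exchanging them is the
  substitution \<open>(x, y) \<mapsto> (x + y, - y)\<close>.\<close>

lemma unit_trivial':
  assumes R: "x \<in> R" "y \<in> R" and one: "(x + y * phi) * (x + y * phibar) = 1"
    and gt: "(cmod (x + y * phi))\<^sup>2 < stab_ratio" and lt: "(cmod (x + y * phibar))\<^sup>2 < stab_ratio"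
  shows "(x + y * phi = 1 \<and> x + y * phibar = 1) \<or> (x + y * phi = - 1 \<and> x + y * phibar = - 1)"
proof -
  have "y = 0"
  proof (cases "1 \<le> cmod (x + y * phi)")
    case True
    thus ?thesis by (rule unit_trivial[OF R one _ gt])
  next
    case False
    have sw: "(x + y) + (- y) * phi = x + y * phibar" "(x + y) + (- y) * phibar = x + y * phi"
    proof -
      have "(x + y) + (- y) * phi = x + y * (1 - phi)" "(x + y) + (- y) * phibar = x + y * (1 - phibar)"
        by (simp_all add: algebra_simps)
      moreover have "1 - phi = phibar" "1 - phibar = phi" using phi_facts(4) by (simp_all add: algebra_simps)
      ultimately show "(x + y) + (- y) * phi = x + y * phibar" "(x + y) + (- y) * phibar = x + y * phi" by simp_all
    qed
    have m: "cmod (x + y * phi) * cmod (x + y * phibar) = 1" using one by (metis norm_mult norm_one)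
    have "1 \<le> cmod (x + y * phibar)"
    proof (rule ccontr)
      assume "\<not> 1 \<le> cmod (x + y * phibar)"
      hence "cmod (x + y * phi) * cmod (x + y * phibar) < 1 * 1" using False by (intro mult_strict_mono') auto
      thus False using m by simp
    qed
    have "- y = 0"
    proof (rule unit_trivial[of "x + y" "- y"], unfold sw)
      show "(x + y * phibar) * (x + y * phi) = 1" using one by (simp only: mult.commute)
      show "1 \<le> cmod (x + y * phibar)" by fact
    qed (use R lt in auto)
    thus ?thesis by simp
  qed
  hence "x * x = 1" using one by simp
  hence "x = 1 \<or> x = - 1" by (metis mult_1 square_eq_iff)
  thus ?thesis using \<open>y = 0\<close> by auto
qed

text \<open>Unimodular pairs in the fundamental domain for the stabilizer of \<open>\<phi>\<close>. The half-open range of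
  \<open>|u / v|\<close> leaves exactly two pairs, differing by sign, in each orbit.\<close>

definition bottom_rows :: "(complex \<times> complex) set" where
  "bottom_rows = {p \<in> R \<times> R. unimodular p \<and> cmod (snd (conj_embed p)) \<le> cmod (fst (conj_embed p)) \<and>
     cmod (fst (conj_embed p)) < stab_ratio * cmod (snd (conj_embed p))}"

lemma unimodular_nonzero: assumes "unimodular p" shows "p \<noteq> 0" "p \<noteq> - p"
proof -
  show "p \<noteq> 0" using assms by (auto simp: unimodular_def)
  thus "p \<noteq> - p" by (cases p) (auto simp: zero_prod_def)
qed

text \<open>After absorbing the translation into the first matrix, both matrices send \<open>\<phi>\<close> to the same point,
  so they differ by an element of its stabilizer. That element acts on the bottom row as
  multiplication by a unit of \<open>R[\<phi>]\<close> of relative norm one, which the fundamental domain forces to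
  be \<open>\<plusminus>1\<close>.\<close>

lemma same_class_imp:
  assumes p: "(c, d) \<in> bottom_rows" "(c0, d0) \<in> bottom_rows"
    and R: "a \<in> R" "b \<in> R" "a0 \<in> R" "b0 \<in> R"
    and det: "a * d - b * c = 1" "a0 * d0 - b0 * c0 = 1"
    and diff: "moebius a0 b0 c0 d0 phi - moebius a b c d phi \<in> R"
  shows "(c0, d0) = (c, d) \<or> (c0, d0) = - (c, d)"
proof -
  have cd: "c \<in> R" "d \<in> R" "c0 \<in> R" "d0 \<in> R" using p by (auto simp: bottom_rows_def)
  have "(c, d) \<noteq> 0" "(c0, d0) \<noteq> 0" using p unimodular_nonzero(1) by (auto simp: bottom_rows_def)
  note nz = golden_form_nonzero[OF cd(1,2) this(1)] golden_form_nonzero[OF cd(3,4) this(2)]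
  define t where "t = moebius a0 b0 c0 d0 phi - moebius a b c d phi"
  have tR: "t \<in> R" using diff by (simp add: t_def)
  define n n0 where "n = (d + phi * c) * (d + phibar * c)" and "n0 = (d0 + phi * c0) * (d0 + phibar * c0)"
  note M = moebius_golden[OF det(1) nz(1,2), folded n_def]
  note M0 = moebius_golden[OF det(2) nz(3,4), folded n0_def]
  have nR: "n \<in> R" "n0 \<in> R" unfolding M(1) M0(1) using cd by (auto intro!: R_add R_diff R_mult)
  have "n * n0 * t = (n * (b0 * d0 + b0 * c0 - a0 * c0) - n0 * (b * d + b * c - a * c)) + (n - n0) * phi"
    unfolding t_def M(3) M0(3) using M(2) M0(2) by (simp add: field_simps)
  hence "((n * (b0 * d0 + b0 * c0 - a0 * c0) - n0 * (b * d + b * c - a * c)) - n * n0 * t) + (n - n0) * phi = 0" by simp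
  note ind = golden_independent[OF _ _ this]
  have nn: "n = n0" using ind(2) nR tR R cd by (auto intro!: R_add R_diff R_mult)
  have t': "moebius a0 b0 c0 d0 phibar - moebius a b c d phibar = t"
    unfolding t_def M(3,4) M0(3,4) nn by (simp add: diff_divide_distrib)
  \<comment> \<open>The first matrix, translated on the left so that both have the same value at \<open>\<phi>\<close> and at its conjugate.\<close>
  define a1 b1 where "a1 = a + t * c" and "b1 = b + t * d"
  have R1: "a1 \<in> R" "b1 \<in> R" unfolding a1_def b1_def using R cd tR by auto
  have det1: "a1 * d - b1 * c = 1" using det(1) by (simp add: a1_def b1_def algebra_simps)
  have eq: "(a1 * z + b1) * (d0 + z * c0) = (a0 * z + b0) * (d + z * c)"
    if "moebius a0 b0 c0 d0 z - moebius a b c d z = t" "d + z * c \<noteq> 0" "d0 + z * c0 \<noteq> 0" for z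
  proof -
    have "moebius a0 b0 c0 d0 z = (a0 * z + b0) / (d0 + z * c0)" by (simp add: moebius_def add.commute mult.commute)
    moreover have "moebius a b c d z = (a * z + b) / (d + z * c)" by (simp add: moebius_def add.commute mult.commute)
    ultimately have "(a0 * z + b0) / (d0 + z * c0) = (a * z + b) / (d + z * c) + t" using that(1) by (simp add: algebra_simps)
    hence "(a0 * z + b0) * (d + z * c) = ((a * z + b) + t * (d + z * c)) * (d0 + z * c0)"
      using that(2,3) by (simp add: field_simps)
    thus ?thesis by (simp add: a1_def b1_def algebra_simps)
  qed
  \<comment> \<open>The quotient of the two denominators, obtained from \<open>a (d + c \<phi>) - c (b + a \<phi>) = 1\<close>.\<close>
  define x y where "x = a1 * d0 - c * b0" and "y = a1 * c0 - c * a0"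
  have xyR: "x \<in> R" "y \<in> R" unfolding x_def y_def using R R1 cd by (auto intro!: R_diff R_mult)
  have unit: "(x + y * z) * (d + z * c) = d0 + z * c0" if e: "(a1 * z + b1) * (d0 + z * c0) = (a0 * z + b0) * (d + z * c)" for z
  proof -
    have "(x + y * z) * (d + z * c) = a1 * (d0 + z * c0) * (d + z * c) - c * ((a0 * z + b0) * (d + z * c))"
      by (simp add: x_def y_def algebra_simps)
    also have "\<dots> = (a1 * d - b1 * c) * (d0 + z * c0)" unfolding e[symmetric] by (simp add: algebra_simps)
    finally show ?thesis unfolding det1 by simp
  qed
  have l: "(x + y * phi) * (d + phi * c) = d0 + phi * c0"
    by (rule unit, rule eq) (use t_def nz in auto)
  have l': "(x + y * phibar) * (d + phibar * c) = d0 + phibar * c0"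
    by (rule unit, rule eq) (use t' nz in auto)
  have one: "(x + y * phi) * (x + y * phibar) = 1"
  proof -
    have "((x + y * phi) * (x + y * phibar)) * n = n0" unfolding n_def n0_def l[symmetric] l'[symmetric] by (simp add: mult_ac)
    thus ?thesis using nn M(2) by simp
  qed
  have bds: "cmod (d + phibar * c) \<le> cmod (d + phi * c)" "cmod (d + phi * c) < stab_ratio * cmod (d + phibar * c)"
    "cmod (d0 + phibar * c0) \<le> cmod (d0 + phi * c0)" "cmod (d0 + phi * c0) < stab_ratio * cmod (d0 + phibar * c0)"
    using p by (auto simp: bottom_rows_def)
  define L L' where "L = cmod (x + y * phi)" and "L' = cmod (x + y * phibar)"
  have LL: "L * L' = 1" unfolding L_def L'_def using one by (metis norm_mult norm_one)
  hence L0: "L > 0" "L' > 0" using norm_ge_zero unfolding L_def L'_def by (metis less_eq_real_def mult_zero_left mult_zero_right zero_neq_one)+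
  define U V where "U = cmod (d + phi * c)" and "V = cmod (d + phibar * c)"
  have UV: "U > 0" "V > 0" "V \<le> U" "U < stab_ratio * V" using nz bds by (auto simp: U_def V_def)
  have U0: "cmod (d0 + phi * c0) = L * U" unfolding l[symmetric] by (simp add: L_def U_def norm_mult)
  have V0: "cmod (d0 + phibar * c0) = L' * V" unfolding l'[symmetric] by (simp add: L'_def V_def norm_mult)
  have b0: "L' * V \<le> L * U" "L * U < stab_ratio * (L' * V)" using bds(3,4) unfolding U0 V0 .
  have "L\<^sup>2 < stab_ratio"
  proof -
    have "L * (L * V) \<le> L * (L * U)" using UV L0 by (intro mult_left_mono) auto
    also have "\<dots> < L * (stab_ratio * (L' * V))" using b0(2) L0 by (intro mult_strict_left_mono) auto
    also have "\<dots> = stab_ratio * V * (L * L')" by simp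
    finally have "L\<^sup>2 * V < stab_ratio * V" unfolding LL by (simp add: power2_eq_square)
    thus ?thesis using UV by simp
  qed
  moreover have "L'\<^sup>2 < stab_ratio"
  proof -
    have "L' * (L' * V) \<le> L' * (L * U)" using b0(1) L0 by (intro mult_left_mono) auto
    also have "\<dots> = U * (L * L')" by simp
    also have "\<dots> < stab_ratio * V" unfolding LL using UV by simp
    finally have "L'\<^sup>2 * V < stab_ratio * V" by (simp add: power2_eq_square)
    thus ?thesis using UV by simp
  qed
  ultimately consider "x + y * phi = 1 \<and> x + y * phibar = 1" | "x + y * phi = - 1 \<and> x + y * phibar = - 1"
    using unit_trivial'[OF xyR one] unfolding L_def L'_def by blast
  thus ?thesis
  proof cases
    case 1
    hence e: "d0 + phi * c0 = d + phi * c" using l by simp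
    hence "(d0 - d) + (c0 - c) * phi = 0" by (simp add: algebra_simps)
    from golden_independent[OF _ _ this] cd show ?thesis by auto
  next
    case 2
    hence e: "d0 + phi * c0 = - (d + phi * c)" using l by simp
    hence "(d0 + d) + (c0 + c) * phi = 0" by (simp add: algebra_simps)
    from golden_independent[OF _ _ this] cd show ?thesis by (auto simp: eq_neg_iff_add_eq_0)
  qed
qed

text \<open>Recording only the ratio \<open>|u / v|\<close> of a representing matrix suffices for moving it into the
  fundamental domain.\<close>

definition represents :: "complex \<Rightarrow> real \<Rightarrow> bool" where
  "represents \<alpha> \<rho> \<longleftrightarrow> (\<exists>a\<in>R. \<exists>b\<in>R. \<exists>c\<in>R. \<exists>d\<in>R. a * d - b * c = 1 \<and> \<alpha> = moebius a b c d phi \<and>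
     cmod (d + phi * c) = \<rho> * cmod (d + phibar * c))"

text \<open>Right multiplication by the generator of the stabilizer or by its inverse. The generator \<open>e\<close> is
  \<open>\<i> \<phi>\<close> or \<open>1 + \<phi> = \<phi>\<^sup>2\<close>, its inverse is \<open>-\<i> (\<phi> - 1)\<close> or \<open>2 - \<phi>\<close>.\<close>

lemma represents_step:
  assumes "represents \<alpha> \<rho>"
  shows "represents \<alpha> (\<rho> * stab_ratio)" "represents \<alpha> (\<rho> / stab_ratio)"
proof -
  obtain a b c d where R: "a \<in> R" "b \<in> R" "c \<in> R" "d \<in> R" and det: "a * d - b * c = 1"
    and \<alpha>: "\<alpha> = moebius a b c d phi" and \<rho>: "cmod (d + phi * c) = \<rho> * cmod (d + phibar * c)"
    using assms by (auto simp: represents_def)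
  have gi: "cmod phi = golden_ratio" "cmod phibar = 1 / golden_ratio"
  proof -
    show 1: "cmod phi = golden_ratio" using golden_facts(6) by simp
    have "cmod phi * cmod phibar = 1" using phi_facts(3) by (metis norm_minus_cancel norm_mult norm_one)
    thus "cmod phibar = 1 / golden_ratio" unfolding 1 using golden_facts(6) by (simp add: field_simps)
  qed
  have rat: "\<exists>q. represents \<alpha> q \<and> q = \<rho> * (cmod e / cmod e')"
    if abcd: "a' \<in> R" "b' \<in> R" "c' \<in> R" "d' \<in> R" "a' * d' - b' * c' = 1"
      and e: "b' + phi * a' = e * (b + phi * a)" "d' + phi * c' = e * (d + phi * c)" "d' + phibar * c' = e' * (d + phibar * c)"
      and e0: "e \<noteq> 0" "e' \<noteq> 0" for a' b' c' d' e e'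
  proof -
    have "moebius a' b' c' d' phi = (b' + phi * a') / (d' + phi * c')" by (simp add: moebius_def add.commute mult.commute)
    also have "\<dots> = (b + phi * a) / (d + phi * c)" unfolding e using e0 by simp
    also have "\<dots> = \<alpha>" by (simp add: \<alpha> moebius_def add.commute mult.commute)
    finally have m: "\<alpha> = moebius a' b' c' d' phi" ..
    have "cmod (d' + phi * c') = \<rho> * (cmod e / cmod e') * cmod (d' + phibar * c')"
      unfolding e norm_mult \<rho> using e0 by simp
    thus ?thesis using abcd m unfolding represents_def by blast
  qed
  show "represents \<alpha> (\<rho> * stab_ratio)"
  proof (cases "\<i> \<in> R")
    case True
    have m: "y * \<i> + x * (\<i> * (x1 + y)) = (\<i> * x) * (x1 + x * y)" if "x * x = x + 1" for x x1 y
    proof -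
      have "(\<i> * x) * (x1 + x * y) = \<i> * (x * x1 + (x * x) * y)" by (simp add: algebra_simps)
      thus ?thesis unfolding that by (simp add: algebra_simps)
    qed
    have "\<exists>q. represents \<alpha> q \<and> q = \<rho> * (cmod (\<i> * phi) / cmod (\<i> * phibar))"
    proof (rule rat[of "\<i> * (b + a)" "a * \<i>" "\<i> * (d + c)" "c * \<i>"])
      have "\<i> * (b + a) * (c * \<i>) - a * \<i> * (\<i> * (d + c)) = (\<i> * \<i>) * (b * c - a * d)" by (simp add: algebra_simps)
      thus "\<i> * (b + a) * (c * \<i>) - a * \<i> * (\<i> * (d + c)) = 1" using det by simp
    qed (use R True m[OF phi_facts(1)] m[OF phi_facts(2)] gi golden_facts(6) in auto)
    moreover have "cmod (\<i> * phi) / cmod (\<i> * phibar) = stab_ratio"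
      using True gi by (simp add: norm_mult stab_ratio_def power2_eq_square)
    ultimately show ?thesis by simp
  next
    case False
    have m: "(x1 + y) + x * (x1 + 2 * y) = (1 + x) * (x1 + x * y)" if "x * x = x + 1" for x x1 y :: complex
    proof -
      have "(1 + x) * (x1 + x * y) = x1 + x * x1 + x * y + (x * x) * y" by (simp add: algebra_simps)
      thus ?thesis unfolding that by (simp add: algebra_simps)
    qed
    have sq: "1 + phi = phi * phi" "1 + phibar = phibar * phibar" using phi_facts by (simp_all add: add.commute)
    have two: "2 \<in> R" using R_of_int[of 2] by simp
    have "\<exists>q. represents \<alpha> q \<and> q = \<rho> * (cmod (1 + phi) / cmod (1 + phibar))"
    proof (rule rat[of "b + 2 * a" "b + a" "d + 2 * c" "d + c"])
      have "(b + 2 * a) * (d + c) - (b + a) * (d + 2 * c) = a * d - b * c" by (simp add: algebra_simps)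
      thus "(b + 2 * a) * (d + c) - (b + a) * (d + 2 * c) = 1" using det by simp
      show "1 + phi \<noteq> 0" "1 + phibar \<noteq> 0" unfolding sq using gi golden_facts(6) by auto
    qed (use R two m[OF phi_facts(1)] m[OF phi_facts(2)] in auto)
    moreover have "cmod (1 + phi) / cmod (1 + phibar) = stab_ratio"
      unfolding sq norm_mult gi using False by (simp add: stab_ratio_def power4_eq_xxxx)
    ultimately show ?thesis by simp
  qed
  show "represents \<alpha> (\<rho> / stab_ratio)"
  proof (cases "\<i> \<in> R")
    case True
    have m: "- \<i> * (y - x1) + x * (- \<i> * x1) = (- \<i> * (x - 1)) * (x1 + x * y)" if "x * x = x + 1" for x x1 y
    proof -
      have "(- \<i> * (x - 1)) * (x1 + x * y) = - \<i> * (x * x1 - x1 + (x * x) * y - x * y)" by (simp add: algebra_simps)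
      thus ?thesis unfolding that by (simp add: algebra_simps)
    qed
    have sh: "phi - 1 = - phibar" "phibar - 1 = - phi" using phi_facts(4) by (simp_all add: algebra_simps)
    have iR: "- \<i> \<in> R" by (rule R_uminus[OF True])
    have "\<exists>q. represents \<alpha> q \<and> q = \<rho> * (cmod (- \<i> * (phi - 1)) / cmod (- \<i> * (phibar - 1)))"
    proof (rule rat[of "- \<i> * b" "- \<i> * (a - b)" "- \<i> * d" "- \<i> * (c - d)"])
      have "- \<i> * b * (- \<i> * (c - d)) - - \<i> * (a - b) * (- \<i> * d) = (\<i> * \<i>) * (b * c - a * d)" by (simp add: algebra_simps)
      thus "- \<i> * b * (- \<i> * (c - d)) - - \<i> * (a - b) * (- \<i> * d) = 1" using det by simp
      show "- \<i> * (phi - 1) \<noteq> 0" "- \<i> * (phibar - 1) \<noteq> 0" unfolding sh using gi golden_facts(6) by auto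
      show "- \<i> * b \<in> R" "- \<i> * (a - b) \<in> R" "- \<i> * d \<in> R" "- \<i> * (c - d) \<in> R" 
        by (rule R_mult[OF iR R(2)] R_mult[OF iR R_diff[OF R(1,2)]] R_mult[OF iR R(4)] R_mult[OF iR R_diff[OF R(3,4)]])+
    qed (rule m[OF phi_facts(1)] m[OF phi_facts(2)])+
    moreover have "cmod (- \<i> * (phi - 1)) / cmod (- \<i> * (phibar - 1)) = 1 / stab_ratio"
      unfolding sh using True gi golden_facts(6) by (simp add: norm_mult stab_ratio_def power2_eq_square)
    ultimately show ?thesis by (metis mult.right_neutral times_divide_eq_right)
  next
    case False
    have m: "(2 * x1 - y) + x * (y - x1) = (2 - x) * (x1 + x * y)" if "x * x = x + 1" for x x1 y :: complex
    proof -
      have "(2 - x) * (x1 + x * y) = 2 * x1 - x * x1 + 2 * x * y - (x * x) * y" by (simp add: algebra_simps)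
      thus ?thesis unfolding that by (simp add: algebra_simps)
    qed
    have sq: "2 - phi = phibar * phibar" "2 - phibar = phi * phi" using phi_facts by (simp_all add: algebra_simps)
    have two: "2 \<in> R" using R_of_int[of 2] by simp
    have "\<exists>q. represents \<alpha> q \<and> q = \<rho> * (cmod (2 - phi) / cmod (2 - phibar))"
    proof (rule rat[of "a - b" "2 * b - a" "c - d" "2 * d - c"])
      have "(a - b) * (2 * d - c) - (2 * b - a) * (c - d) = a * d - b * c" by (simp add: algebra_simps)
      thus "(a - b) * (2 * d - c) - (2 * b - a) * (c - d) = 1" using det by simp
      show "2 - phi \<noteq> 0" "2 - phibar \<noteq> 0" unfolding sq using gi golden_facts(6) by auto
      show "a - b \<in> R" "2 * b - a \<in> R" "c - d \<in> R" "2 * d - c \<in> R" 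
        by (rule R_diff[OF R(1,2)] R_diff[OF R_mult[OF two R(2)] R(1)] R_diff[OF R(3,4)] R_diff[OF R_mult[OF two R(4)] R(3)])+
    qed (rule m[OF phi_facts(1)] m[OF phi_facts(2)])+
    moreover have "cmod (2 - phi) / cmod (2 - phibar) = 1 / stab_ratio"
      unfolding sq norm_mult gi using False by (simp add: stab_ratio_def power4_eq_xxxx)
    ultimately show ?thesis by (metis mult.right_neutral times_divide_eq_right)
  qed
qed

lemma represents_powr: assumes "represents \<alpha> \<rho>" shows "represents \<alpha> (\<rho> * stab_ratio powr of_int k)"
proof (induction k rule: int_induct[where k=0])
  case base
  thus ?case using assms stab_ratio_gt_1 by simp
next
  case (step1 i)
  thus ?case using represents_step(1)[OF step1(2)] stab_ratio_gt_1 by (simp add: powr_add mult.assoc)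
next
  case (step2 i)
  thus ?case using represents_step(2)[OF step2(2)] stab_ratio_gt_1 by (simp add: powr_diff)
qed

lemma ex_bottom_row:
  assumes "\<alpha> \<in> PSL2_orbit R phi"
  shows "\<exists>a\<in>R. \<exists>b\<in>R. \<exists>p\<in>bottom_rows. a * snd p - b * fst p = 1 \<and> \<alpha> = moebius a b (fst p) (snd p) phi"
proof -
  obtain a b c d where R: "a \<in> R" "b \<in> R" "c \<in> R" "d \<in> R" and det: "a * d - b * c = 1"
    and \<alpha>: "\<alpha> = moebius a b c d phi" using assms by (auto simp: PSL2_orbit_def)
  have nz0: "(c, d) \<noteq> 0" using det by (auto simp: zero_prod_def)
  note nz = golden_form_nonzero[OF R(3,4) nz0]
  define \<rho> where "\<rho> = cmod (d + phi * c) / cmod (d + phibar * c)"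
  have \<rho>0: "\<rho> > 0" using nz by (simp add: \<rho>_def)
  have "represents \<alpha> \<rho>" unfolding represents_def using R det \<alpha> nz
    by (intro bexI[of _ a] bexI[of _ b] bexI[of _ c] bexI[of _ d] conjI) (auto simp: \<rho>_def)
  define k where "k = \<lfloor>log stab_ratio \<rho>\<rfloor>"
  define \<rho>' where "\<rho>' = \<rho> * stab_ratio powr of_int (- k)"
  have "represents \<alpha> \<rho>'" unfolding \<rho>'_def by (rule represents_powr) fact
  then obtain a b c d where R: "a \<in> R" "b \<in> R" "c \<in> R" "d \<in> R" and det: "a * d - b * c = 1"
    and \<alpha>: "\<alpha> = moebius a b c d phi" and r: "cmod (d + phi * c) = \<rho>' * cmod (d + phibar * c)"
    by (auto simp: represents_def)
  have \<rho>e: "\<rho> = stab_ratio powr log stab_ratio \<rho>" using \<rho>0 stab_ratio_gt_1 by simp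
  have "\<rho>' = stab_ratio powr (log stab_ratio \<rho> - of_int k)"
    unfolding \<rho>'_def by (subst \<rho>e) (simp add: powr_diff powr_minus divide_inverse)
  moreover have "0 \<le> log stab_ratio \<rho> - of_int k" "log stab_ratio \<rho> - of_int k < 1" unfolding k_def by linarith+
  ultimately have \<rho>': "1 \<le> \<rho>'" "\<rho>' < stab_ratio"
    using stab_ratio_gt_1 powr_less_mono[of "log stab_ratio \<rho> - of_int k" 1 stab_ratio]
      ge_one_powr_ge_zero[of stab_ratio "log stab_ratio \<rho> - of_int k"] by auto
  have nz0: "(c, d) \<noteq> 0" using det by (auto simp: zero_prod_def)
  note nz = golden_form_nonzero[OF R(3,4) nz0]
  have "(c, d) \<in> bottom_rows"
    unfolding bottom_rows_def unimodular_def using R det r \<rho>' nz by (auto simp: mult_le_cancel_right1)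
  thus ?thesis using R det \<alpha> by (intro bexI[of _ a] bexI[of _ b] bexI[of _ "(c, d)"]) auto
qed

text \<open>\<open>\<alpha> - \<alpha>\<^sup>\<sigma> = (\<phi> - \<phi>') / (u v)\<close> for a matrix of determinant one.\<close>

lemma orbit_height:
  assumes K: "subfield K CC" and RK: "R \<subseteq> K" and irr: "phi \<notin> K"
    and R: "a \<in> R" "b \<in> R" "c \<in> R" "d \<in> R" and det: "a * d - b * c = 1"
  shows "inverse (cmod (moebius a b c d phi - galois_conj K (moebius a b c d phi)))
    = cmod (d + phi * c) * cmod (d + phibar * c) / sqrt 5"
proof -
  note s = subfield_CC[OF K]
  have nz0: "(c, d) \<noteq> 0" using det by (auto simp: zero_prod_def)
  note nz = golden_form_nonzero[OF R(3,4) nz0]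
  define n where "n = (d + phi * c) * (d + phibar * c)"
  note M = moebius_golden[OF det nz, folded n_def]
  have "n \<in> R" unfolding M(1) using R by (auto intro!: R_add R_diff R_mult)
  hence "inverse n \<in> K" using s(6) RK by blast
  moreover have "b * d + b * c - a * c \<in> R" using R by (auto intro!: R_add R_diff R_mult)
  ultimately have AB: "(b * d + b * c - a * c) / n \<in> K" "1 / n \<in> K" "1 / n \<noteq> 0"
    using s(4) RK M(2) by (auto simp: divide_inverse)
  have "moebius a b c d phi - galois_conj K (moebius a b c d phi) = 1 / n * (phi - phibar)"
    unfolding M(3) galois_conj_golden[OF K irr AB] by (simp add: algebra_simps)
  hence "cmod (moebius a b c d phi - galois_conj K (moebius a b c d phi)) = sqrt 5 / cmod n"
    unfolding phi_facts by (simp add: norm_mult norm_divide)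
  thus ?thesis by (simp add: n_def norm_mult)
qed

text \<open>A bottom row determines the matrix up to a translation on the left, hence a point of the orbit
  modulo \<open>R\<close>; by the choice of the fundamental domain each class arises from exactly two rows.\<close>

lemma card_orbit:
  assumes K: "subfield K CC" and RK: "R \<subseteq> K" and irr: "phi \<notin> K" and t: "t > 0"
  defines "r \<equiv> sqrt (sqrt 5 * t)"
  defines "D \<equiv> {p \<in> R \<times> R. unimodular p \<and> p /\<^sub>R r \<in> fundamental_region stab_ratio}"
  assumes fin: "finite D"
  shows "card D = 2 * card ({\<alpha> \<in> PSL2_orbit R phi. inverse (cmod (\<alpha> - galois_conj K \<alpha>)) \<le> t} // translation_rel R)"
proof -
  define A where "A = {\<alpha> \<in> PSL2_orbit R phi. inverse (cmod (\<alpha> - galois_conj K \<alpha>)) \<le> t}"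
  have r0: "r > 0" and r2: "r * r = sqrt 5 * t" using t by (simp_all add: r_def)
  have D: "p \<in> D \<longleftrightarrow> p \<in> bottom_rows \<and> cmod (fst (conj_embed p)) * cmod (snd (conj_embed p)) \<le> sqrt 5 * t" for p
  proof -
    define U V where "U = cmod (fst (conj_embed p))" and "V = cmod (snd (conj_embed p))"
    have sc: "conj_embed (p /\<^sub>R r) = conj_embed p /\<^sub>R r"
      by (cases p) (simp add: scaleR_conv_of_real algebra_simps)
    have n: "cmod (fst (conj_embed (p /\<^sub>R r))) = U / r" "cmod (snd (conj_embed (p /\<^sub>R r))) = V / r"
      unfolding sc U_def V_def using r0 by (simp_all add: divide_inverse mult.commute)
    have "p /\<^sub>R r \<in> fundamental_region stab_ratio \<longleftrightarrow> V / r \<le> U / r \<and> U / r < stab_ratio * (V / r) \<and> U / r * (V / r) \<le> 1"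
      unfolding n[symmetric] fundamental_region_def hyperbolic_region_def vimage_eq by (simp add: case_prod_beta)
    moreover have "V / r \<le> U / r \<longleftrightarrow> V \<le> U" using r0 by (simp add: divide_le_cancel)
    moreover have "U / r < stab_ratio * (V / r) \<longleftrightarrow> U < stab_ratio * V" using r0 by (simp add: divide_less_cancel)
    moreover have "U / r * (V / r) \<le> 1 \<longleftrightarrow> U * V \<le> sqrt 5 * t"
      unfolding r2[symmetric] using r0 by (simp add: divide_le_eq_1)
    ultimately show ?thesis unfolding D_def bottom_rows_def U_def V_def by blast
  qed
  define lift where "lift p = (SOME ab. fst ab \<in> R \<and> snd ab \<in> R \<and> fst ab * snd p - snd ab * fst p = 1)" for p :: "complex \<times> complex"
  have lift: "fst (lift p) \<in> R" "snd (lift p) \<in> R" "fst (lift p) * snd p - snd (lift p) * fst p = 1" if "p \<in> D" for p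
  proof -
    have "\<exists>ab. fst ab \<in> R \<and> snd ab \<in> R \<and> fst ab * snd p - snd ab * fst p = 1"
      using that by (auto simp: D_def unimodular_def)
    from someI_ex[OF this] show "fst (lift p) \<in> R" "snd (lift p) \<in> R" "fst (lift p) * snd p - snd (lift p) * fst p = 1"
      unfolding lift_def by blast+
  qed
  define pt where "pt p = moebius (fst (lift p)) (snd (lift p)) (fst p) (snd p) phi" for p
  define cls where "cls p = translation_rel R `` {pt p}" for p
  have cls_eq: "translation_rel R `` {\<alpha>} = translation_rel R `` {\<beta>} \<longleftrightarrow> \<beta> - \<alpha> \<in> R" for \<alpha> \<beta>
  proof
    assume e: "translation_rel R `` {\<alpha>} = translation_rel R `` {\<beta>}"
    have "\<beta> \<in> translation_rel R `` {\<beta>}" by (simp add: translation_rel_def)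
    thus "\<beta> - \<alpha> \<in> R" unfolding e[symmetric] by (simp add: translation_rel_def)
  next
    assume d: "\<beta> - \<alpha> \<in> R"
    have "x - \<alpha> \<in> R \<longleftrightarrow> x - \<beta> \<in> R" for x
      using R_diff[OF _ d, of "x - \<alpha>"] R_add[OF _ d, of "x - \<beta>"] by auto
    thus "translation_rel R `` {\<alpha>} = translation_rel R `` {\<beta>}" by (auto simp: translation_rel_def)
  qed
  have DR: "fst p \<in> R" "snd p \<in> R" "p \<in> bottom_rows" if "p \<in> D" for p
    using that D[of p] by (auto simp: bottom_rows_def)
  have indep: "moebius a b (fst p) (snd p) phi - pt p \<in> R"
    if p: "p \<in> D" and ab: "a \<in> R" "b \<in> R" "a * snd p - b * fst p = 1" for p a b
  proof -
    obtain c d where cd: "p = (c, d)" by (cases p)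
    obtain a0 b0 where ab0: "lift p = (a0, b0)" by (cases "lift p")
    have 0: "a0 \<in> R" "b0 \<in> R" "a0 * d - b0 * c = 1" using lift[OF p] by (simp_all add: ab0[unfolded cd] cd)
    have 1: "a * d - b * c = 1" using ab by (simp add: cd)
    have R: "c \<in> R" "d \<in> R" using DR[OF p] by (simp_all add: cd)
    have nz0: "(c, d) \<noteq> 0" using 1 by (auto simp: zero_prod_def)
    have nz: "c * phi + d \<noteq> 0" using golden_form_nonzero(1)[OF R nz0] by (simp add: add.commute mult.commute)
    \<comment> \<open>Two matrices with the same bottom row differ by a translation by \<open>s\<close> on the left.\<close>
    define s where "s = b * a0 - a * b0"
    have "a = a0 + s * c"
    proof -
      have "a0 + s * c = a0 * (1 + b * c) - a * (b0 * c)" by (simp add: s_def algebra_simps)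
      also have "1 + b * c = a * d" using 1 by (simp add: algebra_simps)
      also have "a0 * (a * d) - a * (b0 * c) = a * (a0 * d - b0 * c)" by (simp add: algebra_simps)
      finally show ?thesis using 0(3) by simp
    qed
    moreover have "b = b0 + s * d"
    proof -
      have "b0 + s * d = b0 * (1 - a * d) + b * (a0 * d)" by (simp add: s_def algebra_simps)
      also have "1 - a * d = - (b * c)" using 1 by (simp add: algebra_simps)
      also have "b0 * - (b * c) + b * (a0 * d) = b * (a0 * d - b0 * c)" by (simp add: algebra_simps)
      finally show ?thesis using 0(3) by simp
    qed
    ultimately have "moebius a b c d phi - moebius a0 b0 c d phi = (s * (c * phi + d)) / (c * phi + d)"
      unfolding moebius_def diff_divide_distrib[symmetric] by (simp add: algebra_simps)
    also have "\<dots> = s" using nz by simp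
    finally have "moebius a b (fst p) (snd p) phi - pt p = s" by (simp add: cd ab0[unfolded cd] pt_def)
    thus ?thesis unfolding s_def using ab 0 by (auto intro!: R_diff R_mult)
  qed
  have ptA: "pt p \<in> A" if p: "p \<in> D" for p
  proof -
    have "pt p \<in> PSL2_orbit R phi" unfolding PSL2_orbit_def pt_def using lift[OF p] DR[OF p] by blast
    moreover have "inverse (cmod (pt p - galois_conj K (pt p))) \<le> t"
      unfolding pt_def orbit_height[OF K RK irr lift(1,2)[OF p] DR(1,2)[OF p] lift(3)[OF p]]
      using p unfolding D by (cases p) (simp add: field_simps)
    ultimately show ?thesis by (simp add: A_def)
  qed
  have onto: "cls ` D = A // translation_rel R"
  proof
    show "cls ` D \<subseteq> A // translation_rel R" unfolding cls_def using ptA by (auto intro: quotientI)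
    show "A // translation_rel R \<subseteq> cls ` D"
    proof
      fix Y assume "Y \<in> A // translation_rel R"
      then obtain \<alpha> where \<alpha>: "\<alpha> \<in> A" "Y = translation_rel R `` {\<alpha>}" by (auto elim: quotientE)
      obtain a b p where p: "a \<in> R" "b \<in> R" "p \<in> bottom_rows" "a * snd p - b * fst p = 1"
        "\<alpha> = moebius a b (fst p) (snd p) phi" using ex_bottom_row \<alpha>(1) unfolding A_def by blast
      have pR: "fst p \<in> R" "snd p \<in> R" using p(3) by (auto simp: bottom_rows_def)
      have "cmod (snd p + phi * fst p) * cmod (snd p + phibar * fst p) / sqrt 5 \<le> t"
        using \<alpha>(1) orbit_height[OF K RK irr p(1,2) pR p(4)] unfolding A_def p(5) by simp
      hence "cmod (fst (conj_embed p)) * cmod (snd (conj_embed p)) \<le> sqrt 5 * t" by (cases p) (simp add: field_simps)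
      hence pD: "p \<in> D" using D p(3) by blast
      have "cls p = Y" unfolding cls_def \<alpha>(2) cls_eq using indep[OF pD p(1,2,4)] by (simp add: p(5))
      thus "Y \<in> cls ` D" using pD by blast
    qed
  qed
  have "card D = 2 * card (cls ` D)"
  proof (rule card_two_to_one[OF fin])
    fix p assume p: "p \<in> D"
    show "p \<noteq> - p" using p unimodular_nonzero(2) by (auto simp: D_def)
    have neg: "- p \<in> D"
    proof -
      have u: "unimodular (- p)"
      proof -
        have "(- fst (lift p)) * snd (- p) - (- snd (lift p)) * fst (- p) = 1" using lift(3)[OF p] by simp
        thus ?thesis unfolding unimodular_def using R_uminus lift(1,2)[OF p] by blast
      qed
      have e: "conj_embed (- p) = - conj_embed p" by (cases p) simp
      have "- p \<in> R \<times> R" using DR[OF p] by (cases p) auto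
      hence "- p \<in> bottom_rows" using u DR(3)[OF p] by (simp add: bottom_rows_def e)
      thus ?thesis using p unfolding D e by simp
    qed
    have clsneg: "cls (- p) = cls p"
    proof -
      have "(- fst (lift p)) * snd (- p) - (- snd (lift p)) * fst (- p) = 1" using lift(3)[OF p] by simp
      from indep[OF neg _ _ this] have "moebius (- fst (lift p)) (- snd (lift p)) (fst (- p)) (snd (- p)) phi - pt (- p) \<in> R"
        using lift(1,2)[OF p] by blast
      moreover have "moebius (- x) (- y) (- z) (- u) phi = moebius x y z u phi" for x y z u
      proof -
        have "moebius (- x) (- y) (- z) (- u) phi = (- (x * phi + y)) / (- (z * phi + u))" by (simp add: moebius_def)
        thus ?thesis by (simp only: minus_divide_divide moebius_def)
      qed
      hence "moebius (- fst (lift p)) (- snd (lift p)) (fst (- p)) (snd (- p)) phi = pt p" by (simp add: pt_def)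
      ultimately show ?thesis unfolding cls_def cls_eq by simp
    qed
    show "{x \<in> D. cls x = cls p} = {p, - p}"
    proof
      show "{p, - p} \<subseteq> {x \<in> D. cls x = cls p}" using p neg clsneg by auto
      show "{x \<in> D. cls x = cls p} \<subseteq> {p, - p}"
      proof
        fix x assume "x \<in> {x \<in> D. cls x = cls p}"
        hence x: "x \<in> D" "cls p = cls x" by auto
        have "pt x - pt p \<in> R" using x(2) unfolding cls_def cls_eq .
        hence "moebius (fst (lift x)) (snd (lift x)) (fst x) (snd x) phi - moebius (fst (lift p)) (snd (lift p)) (fst p) (snd p) phi \<in> R"
          by (simp add: pt_def)
        from same_class_imp[OF _ _ lift(1,2)[OF p] lift(1,2)[OF x(1)] lift(3)[OF p] lift(3)[OF x(1)] this]
        have "(fst x, snd x) = (fst p, snd p) \<or> (fst x, snd x) = - (fst p, snd p)" using DR(3)[OF p] DR(3)[OF x(1)] by simp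
        thus "x \<in> {p, - p}" by simp
      qed
    qed
  qed
  thus ?thesis unfolding onto A_def .
qed

end

section \<open>Comparison with the ring-theoretic data and conclusion\<close>

context imag_quad_ring
begin

abbreviation Rring :: "complex ring" where "Rring \<equiv> CC\<lparr>carrier := R\<rparr>"

lemma Rring_ops: "carrier Rring = R" "x \<otimes>\<^bsub>Rring\<^esub> y = x * y" "x \<oplus>\<^bsub>Rring\<^esub> y = x + y" "\<zero>\<^bsub>Rring\<^esub> = 0" "\<one>\<^bsub>Rring\<^esub> = 1"
  by (simp_all add: ring_of_type_algebra_def)

lemma ring_Rring: "ring Rring"
proof -
  interpret C: Ring.ring CC by (rule ring_from_type_algebra)
  have a_inv: "\<ominus>\<^bsub>CC\<^esub> x = - x" for x
    by (rule C.minus_equality) (simp_all add: ring_of_type_algebra_def)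
  have "subring R CC"
    by (rule C.subringI) (auto simp: CC_ops a_inv)
  thus ?thesis by (rule C.subring_is_ring)
qed

lemma ideal_iff_nonzero_ideal: "ideal I Rring \<and> I \<noteq> {0} \<longleftrightarrow> nonzero_ideal I"
proof
  interpret ring Rring by (rule ring_Rring)
  assume a: "ideal I Rring \<and> I \<noteq> {0}"
  then interpret I: ideal I Rring by simp
  have "I \<subseteq> R" using I.a_subset by (simp only: Rring_ops)
  moreover have "0 \<in> I" using I.zero_closed by (simp only: Rring_ops)
  moreover have "x + y \<in> I" if "x \<in> I" "y \<in> I" for x y using I.a_closed[OF that] by (simp only: Rring_ops)
  moreover have "r * x \<in> I" if "r \<in> R" "x \<in> I" for r x using I.I_l_closed[of x r] that by (simp only: Rring_ops)
  moreover have "\<exists>x\<in>I. x \<noteq> 0" using a \<open>0 \<in> I\<close> by blast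
  ultimately show "nonzero_ideal I" by (simp add: nonzero_ideal_def)
next
  interpret ring Rring by (rule ring_Rring)
  assume I: "nonzero_ideal I"
  have a_inv: "\<ominus>\<^bsub>Rring\<^esub> x = - x" if "x \<in> R" for x
    by (rule minus_equality) (use that R_uminus in \<open>simp_all only: Rring_ops, simp_all\<close>)
  have "subgroup I (add_monoid Rring)"
  proof (rule add.subgroupI)
    show "I \<subseteq> carrier Rring" using nonzero_idealD(1)[OF I] by (simp only: Rring_ops)
    show "I \<noteq> {}" using nonzero_idealD(8)[OF I] by blast
    show "\<ominus>\<^bsub>Rring\<^esub> x \<in> I" if "x \<in> I" for x using a_inv nonzero_idealD(2,6)[OF I that] by simp
    show "x \<oplus>\<^bsub>Rring\<^esub> y \<in> I" if "x \<in> I" "y \<in> I" for x y using nonzero_idealD(3)[OF I that] by (simp only: Rring_ops)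
  qed
  moreover have "x \<otimes>\<^bsub>Rring\<^esub> a \<in> I" "a \<otimes>\<^bsub>Rring\<^esub> x \<in> I" if "a \<in> I" "x \<in> carrier Rring" for a x
    using nonzero_idealD(4,5)[OF I _ that(1)] that(2) by (simp_all only: Rring_ops)
  ultimately have "ideal I Rring" by (intro idealI ring_Rring) auto
  thus "ideal I Rring \<and> I \<noteq> {0}" using nonzero_idealD(9)[OF I] by blast
qed

lemma card_Quot: "card (carrier (Rring Quot I)) = ideal_norm I"
proof -
  have "a_r_coset Rring I x = coset I x" for x
    by (auto simp: a_r_coset_def' Rring_ops coset_def ring_of_type_algebra_def)
  hence "carrier (Rring Quot I) = coset I ` R"
    by (auto simp: FactRing_def A_RCOSETS_def' Rring_ops ring_of_type_algebra_def)
  thus ?thesis by (simp add: ideal_norm_def)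
qed

lemma dedekind_zeta_2:
  assumes "ring_of_integers K = R"
  shows "dedekind_zeta K 2 = (\<Sum>\<^sub>\<infinity>I\<in>{I. nonzero_ideal I}. 1 / (real (ideal_norm I))\<^sup>2)"
  unfolding dedekind_zeta_def Let_def assms ideal_iff_nonzero_ideal card_Quot
proof (rule infsum_cong)
  fix I assume "I \<in> {I. nonzero_ideal I}"
  hence "real (ideal_norm I) > 0" using ideal_norm_pos by simp
  thus "real (ideal_norm I) powr - 2 = 1 / (real (ideal_norm I))\<^sup>2" by (simp add: powr_minus powr_numeral divide_inverse)
qed

lemma zeta_positive: "(\<Sum>\<^sub>\<infinity>I\<in>{I. nonzero_ideal I}. 1 / (real (ideal_norm I))\<^sup>2) > 0"
proof -
  have "(\<Sum>\<^sub>\<infinity>I\<in>{I. nonzero_ideal I}. 1 / (real (ideal_norm I))\<^sup>2) \<ge> 0" by (rule infsum_nonneg) simp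
  moreover have "(\<Sum>\<^sub>\<infinity>I\<in>{I. nonzero_ideal I}. 1 / (real (ideal_norm I))\<^sup>2) \<noteq> 0" using infsum_ideal_mu_zeta by auto
  ultimately show ?thesis by simp
qed

end

theorem mainTheorem5:
  fixes K :: "complex set"
  assumes "imaginary_quadratic_field K"
  shows "(\<lambda>t::real. real (card
            ({\<alpha> \<in> PSL2_orbit (ring_of_integers K) (of_real golden_ratio).
                inverse (cmod (\<alpha> - galois_conj K \<alpha>)) \<le> t} // translation_rel (ring_of_integers K))))
         \<sim>[at_top]
         (\<lambda>t. (if imaginary_quadratic_disc K = -4 then 1 / 2 else 1) *
               (8 * pi\<^sup>2 * ln golden_ratio /
                 (real_of_int \<bar>imaginary_quadratic_disc K\<bar> * dedekind_zeta K 2)) * t\<^sup>2)"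
proof -
  define R where "R = ring_of_integers K"
  have K: "subfield K CC" using assms by (simp add: imaginary_quadratic_field_def)
  have RK: "R \<subseteq> K" by (auto simp: R_def ring_of_integers_def)
  have irr: "phi \<notin> K" using imaginary_quadratic_field_real[OF assms] golden_irrational(1) by blast
  obtain w tw nw where "imag_quad_ring R w tw nw"
    using imag_quad_ring_of_integers[OF assms] unfolding R_def by blast
  then interpret imag_quad_ring R w tw nw .
  define Z where "Z = (\<Sum>\<^sub>\<infinity>I\<in>{I. nonzero_ideal I}. 1 / (real (ideal_norm I))\<^sup>2)"
  have Z0: "Z > 0" unfolding Z_def by (rule zeta_positive)
  have zeta: "dedekind_zeta K 2 = Z" unfolding Z_def by (rule dedekind_zeta_2) (simp add: R_def)
  have disc: "imaginary_quadratic_disc K = tw\<^sup>2 - 4 * nw"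
    by (rule imaginary_quadratic_disc_eq) (simp add: R_def)
  have absdisc: "real_of_int \<bar>imaginary_quadratic_disc K\<bar> = 4 * (Im w)\<^sup>2"
    unfolding disc of_int_abs disc_int by simp
  define E where "E = fundamental_region stab_ratio"
  have lim: "((\<lambda>r. real (card {p \<in> R \<times> R. unimodular p \<and> p /\<^sub>R r \<in> E}) / r ^ 4) \<longlongrightarrow>
      (pi\<^sup>2 * ln stab_ratio / 5) / ((Im w)\<^sup>2 * Z)) at_top"
    and fin: "\<And>r. r > 0 \<Longrightarrow> finite {p \<in> R \<times> R. p /\<^sub>R r \<in> E}"
    using unimodular_asymptotics[OF bounded_fundamental_region[OF stab_ratio_gt_1] fundamental_region_sets
        frontier_fundamental_region zero_notin_fundamental_region]
    unfolding E_def Z_def measure_fundamental_region[OF stab_ratio_gt_1] by blast+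
  define f where "f t = real (card ({\<alpha> \<in> PSL2_orbit R phi. inverse (cmod (\<alpha> - galois_conj K \<alpha>)) \<le> t} // translation_rel R))" for t
  define C where "C = (if imaginary_quadratic_disc K = -4 then 1 / 2 else 1) *
    (8 * pi\<^sup>2 * ln golden_ratio / (real_of_int \<bar>imaginary_quadratic_disc K\<bar> * dedekind_zeta K 2))"
  have lnphi: "ln golden_ratio > 0" using golden_facts(6) by simp
  have lnq: "ln stab_ratio = (if imaginary_quadratic_disc K = -4 then 1 / 2 else 1) * (4 * ln golden_ratio)"
    using golden_facts(6) unfolding disc ii_in_R_iff[symmetric] stab_ratio_def by (simp add: ln_realpow)
  have C: "C = pi\<^sup>2 * ln stab_ratio / (2 * (Im w)\<^sup>2 * Z)"
    unfolding C_def absdisc zeta lnq by simp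
  have C0: "C \<noteq> 0" unfolding C using Z0 Im_w stab_ratio_gt_1 by simp
  \<comment> \<open>The height condition reads \<open>|u v| \<le> sqrt 5 t = r\<^sup>2\<close>, that is, \<open>(c, d) / r\<close> lies in the fundamental region.\<close>
  have r_lim: "filterlim (\<lambda>t. sqrt (sqrt 5 * t)) at_top at_top"
    by (rule filterlim_compose[OF sqrt_at_top]) (rule filterlim_tendsto_pos_mult_at_top[OF tendsto_const _ filterlim_ident], simp)
  have l1: "((\<lambda>t. real (card {p \<in> R \<times> R. unimodular p \<and> p /\<^sub>R sqrt (sqrt 5 * t) \<in> E}) / sqrt (sqrt 5 * t) ^ 4 * (5 / (2 * C)))
     \<longlongrightarrow> (pi\<^sup>2 * ln stab_ratio / 5) / ((Im w)\<^sup>2 * Z) * (5 / (2 * C))) at_top"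
    by (intro tendsto_mult tendsto_const filterlim_compose[OF lim r_lim])
  have e1: "(pi\<^sup>2 * ln stab_ratio / 5) / ((Im w)\<^sup>2 * Z) * (5 / (2 * C)) = 1"
    unfolding C using Z0 Im_w stab_ratio_gt_1 by simp
  have ev: "\<forall>\<^sub>F t in at_top. real (card {p \<in> R \<times> R. unimodular p \<and> p /\<^sub>R sqrt (sqrt 5 * t) \<in> E}) / sqrt (sqrt 5 * t) ^ 4 * (5 / (2 * C))
     = f t / (C * t\<^sup>2)"
    using eventually_gt_at_top[of 0]
  proof eventually_elim
    case (elim t)
    define r where "r = sqrt (sqrt 5 * t)"
    have r0: "r > 0" using elim by (simp add: r_def)
    have "r\<^sup>2 = sqrt 5 * t" using elim by (simp add: r_def)
    hence "(r\<^sup>2)\<^sup>2 = 5 * t\<^sup>2" by (simp add: power_mult_distrib)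
    hence r4: "r ^ 4 = 5 * t\<^sup>2" by (simp flip: power_mult)
    have "finite {p \<in> R \<times> R. unimodular p \<and> p /\<^sub>R r \<in> E}"
      by (rule finite_subset[OF _ fin[OF r0]]) auto
    from card_orbit[OF K RK irr elim, folded r_def E_def, OF this]
    have "real (card {p \<in> R \<times> R. unimodular p \<and> p /\<^sub>R r \<in> E}) = 2 * f t" by (simp add: f_def)
    thus ?case unfolding r_def[symmetric] r4 using elim C0 by (simp add: field_simps)
  qed
  have "((\<lambda>t. f t / (C * t\<^sup>2)) \<longlongrightarrow> 1) at_top"
    by (rule Lim_transform_eventually[OF l1[unfolded e1] ev])
  moreover have "\<forall>\<^sub>F t in at_top. f t \<noteq> 0 \<or> C * t\<^sup>2 \<noteq> 0"
    using eventually_gt_at_top[of 0] by eventually_elim (use C0 in simp)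
  ultimately have "f \<sim>[at_top] (\<lambda>t. C * t\<^sup>2)" by (intro asymp_equivI')
  thus ?thesis unfolding f_def C_def R_def .
qed

end
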